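(* Let $d\ge 3$ and $N\ge 3$ be integers. Suppose $n$ is the order of a linear automorphism of a smooth $(N-2)$-fold of degree $d$ in $\mathbb{P}^{N-1}$. Then $n$ is also the order of a linear automorphism of some $(N-2)$-fold of degree $d$ defined by a simple polynomial $F$ with at most one component of type $T_{\ge 2}$. Explicitly, $n$ is a factor of one of the following numbers: (i) $\frac{|1-(1-d)^N|}{d}$; or (ii) $(d-1)^{N-1}$; or (iii) $|1-(1-d)^a|$, where $1\le a\le N-1$; or (iv) $\mathrm{lcm}(|1-(1-d)^{a_1}|,\dots,|1-(1-d)^{a_t}|)$, where $t\ge 2$, $1\le a_1<\cdots<a_t$ and $\sum_{i=1}^t a_i\le N$; or (v) $\mathrm{lcm}(|1-(1-d)^{a_1}|,\dots,|1-(1-d)^{a_t}|,(d-1)^{b-1})$, where $t\ge 1$, $1\le a_1<\cdots<a_t$, $b\ge 2$ and $\sum_{i=1}^t a_i+b\le N$.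
   Context: All varieties are over $\mathbb{C}$. A homogeneous polynomial $F(x_1,\dots,x_k)$ is called smooth if the only common zero in $\mathbb{C}^k$ of $\partial F/\partial x_1,\dots,\partial F/\partial x_k$ is the origin. For a homogeneous polynomial $F$ of degree $d$ in $x_1,\dots,x_N$, $V(F)\subset\mathbb{P}^{N-1}$ is the hypersurface it defines; it is called an $(N-2)$-fold of degree $d$, and it is smooth when $F$ is smooth. A linear automorphism of $V(F)$ is an element of $\mathrm{PGL}(N,\mathbb{C})$ preserving $V(F)$; its order is its order in $\mathrm{PGL}(N,\mathbb{C})$. For $d\ge 3$, $k\ge 1$, a polynomial is of type $K_k$ if, up to naming of variables, it is $x_1^{d-1}x_2+x_2^{d-1}x_3+\cdots+x_k^{d-1}x_1$ (so type $K_1$ is $x_1^d$), and of type $T_k$ if, up to naming of variables, it is $x_1^{d-1}x_2+\cdots+x_{k-1}^{d-1}x_k+x_k^d$. Type $T_{\ge 2}$ means type $T_k$ for some $k\ge 2$. A simple polynomial is a sum of finitely many polynomials of type $K$ or $T$ (its components) of the same degree $d$ in pairwise disjoint sets of variables, which together are all the variables (here $x_1,\dots,x_N$). *)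

theory Defs
  imports
    "HOL-Library.Poly_Mapping"
    "HOL-Algebra.Multiplicative_Group"
    "Jordan_Normal_Form.Matrix"
begin

text \<open>
  A complex polynomial in variables indexed by naturals is a finitely supported map from
  exponent vectors to coefficients; products in this type are products of polynomials. The
  variables \<open>x\<^sub>1, \<dots>, x\<^sub>N\<close> have the indices \<open>0, \<dots>, N - 1\<close>, matching the coordinates of
  \<^term>\<open>carrier_vec N\<close>.
\<close>

type_synonym cpoly = "(nat \<Rightarrow>\<^sub>0 nat) \<Rightarrow>\<^sub>0 complex"

definition pvar :: "nat \<Rightarrow> cpoly" where
  "pvar i = Poly_Mapping.single (Poly_Mapping.single i 1) 1"

definition peval :: "cpoly \<Rightarrow> complex vec \<Rightarrow> complex" where
  "peval F v = (\<Sum>m\<in>Poly_Mapping.keys F. Poly_Mapping.lookup F m *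
     (\<Prod>i\<in>Poly_Mapping.keys m. (v $ i) ^ Poly_Mapping.lookup m i))"

text \<open>
  Subtraction of exponent vectors is truncated, but wherever it truncates the coefficient
  \<open>lookup m i\<close> vanishes.
\<close>

definition partial_deriv :: "nat \<Rightarrow> cpoly \<Rightarrow> cpoly" where
  "partial_deriv i F = (\<Sum>m\<in>Poly_Mapping.keys F.
     Poly_Mapping.single (m - Poly_Mapping.single i 1)
       (of_nat (Poly_Mapping.lookup m i) * Poly_Mapping.lookup F m))"

definition pvars :: "cpoly \<Rightarrow> nat set" where
  "pvars F = (\<Union>m\<in>Poly_Mapping.keys F. Poly_Mapping.keys m)"

definition homogeneous :: "nat \<Rightarrow> nat \<Rightarrow> cpoly \<Rightarrow> bool" where
  "homogeneous N d F \<longleftrightarrow> pvars F \<subseteq> {..<N} \<and>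
     (\<forall>m\<in>Poly_Mapping.keys F. (\<Sum>i\<in>Poly_Mapping.keys m. Poly_Mapping.lookup m i) = d)"

definition smooth :: "nat \<Rightarrow> cpoly \<Rightarrow> bool" where
  "smooth N F \<longleftrightarrow>
     {v \<in> carrier_vec N. \<forall>i<N. peval (partial_deriv i F) v = 0} = {0\<^sub>v N}"


text \<open>
  A point of \<open>\<P>\<^sup>N\<^sup>-\<^sup>1\<close> is the class of a nonzero vector modulo nonzero scalars, i.e. a line
  through the origin with the origin removed. \<open>hypersurface N F\<close> is \<open>V(F)\<close>.
\<close>

definition proj_point :: "complex vec \<Rightarrow> complex vec set" where
  "proj_point v = {c \<cdot>\<^sub>v v | c. c \<noteq> 0}"

definition hypersurface :: "nat \<Rightarrow> cpoly \<Rightarrow> complex vec set set" where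
  "hypersurface N F =
     {proj_point v | v. v \<in> carrier_vec N \<and> v \<noteq> 0\<^sub>v N \<and> peval F v = 0}"

definition GL :: "nat \<Rightarrow> complex mat monoid" where
  "GL N = units_of (ring_mat TYPE(complex) N ())"

definition scalars :: "nat \<Rightarrow> complex mat set" where
  "scalars N = {c \<cdot>\<^sub>m 1\<^sub>m N | c. c \<noteq> 0}"

definition PGL :: "nat \<Rightarrow> complex mat set monoid" where
  "PGL N = GL N Mod scalars N"

text \<open>
  An element of \<^term>\<open>PGL N\<close> is a class \<open>g\<close> of matrices and a point is a class \<open>p\<close> of vectors;
  their elementwise products again form one point, see \<open>proj_action_point\<close> below.
\<close>

definition proj_action :: "complex mat set \<Rightarrow> complex vec set \<Rightarrow> complex vec set" where
  "proj_action g p = {A *\<^sub>v v | A v. A \<in> g \<and> v \<in> p}"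

definition linear_automorphism :: "nat \<Rightarrow> cpoly \<Rightarrow> complex mat set \<Rightarrow> bool" where
  "linear_automorphism N F g \<longleftrightarrow>
     g \<in> carrier (PGL N) \<and> proj_action g ` hypersurface N F = hypersurface N F"

text \<open>\<^const>\<open>group.ord\<close> is \<open>0\<close> for elements of infinite order, whence the condition \<open>n > 0\<close>.\<close>

definition order_of_linear_automorphism :: "nat \<Rightarrow> cpoly \<Rightarrow> nat \<Rightarrow> bool" where
  "order_of_linear_automorphism N F n \<longleftrightarrow>
     n > 0 \<and> (\<exists>g. linear_automorphism N F g \<and> group.ord (PGL N) g = n)"


text \<open>The lists below name the variables: \<open>xs ! i\<close> is the index of the variable \<open>x\<^sub>i\<^sub>+\<^sub>1\<close>.\<close>

definition type_K :: "nat \<Rightarrow> nat \<Rightarrow> cpoly \<Rightarrow> bool" where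
  "type_K d k P \<longleftrightarrow> k \<ge> 1 \<and> (\<exists>xs. distinct xs \<and> length xs = k \<and>
     P = (\<Sum>i<k. pvar (xs ! i) ^ (d - 1) * pvar (xs ! ((i + 1) mod k))))"

definition type_T :: "nat \<Rightarrow> nat \<Rightarrow> cpoly \<Rightarrow> bool" where
  "type_T d k P \<longleftrightarrow> k \<ge> 1 \<and> (\<exists>xs. distinct xs \<and> length xs = k \<and>
     P = (\<Sum>i<k - 1. pvar (xs ! i) ^ (d - 1) * pvar (xs ! (i + 1))) + pvar (xs ! (k - 1)) ^ d)"

text \<open>
  The components are collected in a set: having pairwise disjoint nonempty sets of variables,
  they are distinct.
\<close>

definition simple_with_components :: "nat \<Rightarrow> nat \<Rightarrow> cpoly \<Rightarrow> cpoly set \<Rightarrow> bool" where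
  "simple_with_components N d F \<C> \<longleftrightarrow>
     finite \<C> \<and>
     (\<forall>P\<in>\<C>. \<exists>k. type_K d k P \<or> type_T d k P) \<and>
     (\<forall>P\<in>\<C>. \<forall>Q\<in>\<C>. P \<noteq> Q \<longrightarrow> pvars P \<inter> pvars Q = {}) \<and>
     (\<Union>P\<in>\<C>. pvars P) = {..<N} \<and>
     F = (\<Sum>P\<in>\<C>. P)"

definition type_T_ge2 :: "nat \<Rightarrow> cpoly \<Rightarrow> bool" where
  "type_T_ge2 d P \<longleftrightarrow> (\<exists>k\<ge>2. type_T d k P)"

definition cyc :: "nat \<Rightarrow> nat \<Rightarrow> nat" where
  "cyc d a = nat \<bar>1 - (1 - int d) ^ a\<bar>"


lemma d_dvd_cyc: "d dvd cyc d a"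
proof -
  have "(1 - (1 - int d)) dvd (1 ^ a - (1 - int d) ^ a)"
    by (simp only: power_diff_sumr2[of 1 a "1 - int d"] dvd_triv_left)
  then show ?thesis
    by (simp add: cyc_def flip: int_dvd_int_iff)
qed

lemma carrier_GL: "carrier (GL N) = {A \<in> carrier_mat N N. invertible_mat A}"
proof (intro equalityI subsetI)
  fix A :: "complex mat" assume "A \<in> carrier (GL N)"
  then obtain B where "A \<in> carrier_mat N N" "B \<in> carrier_mat N N" "B * A = 1\<^sub>m N" "A * B = 1\<^sub>m N"
    unfolding GL_def units_of_def Units_def ring_mat_def by auto
  then have "inverts_mat A B" "inverts_mat B A" "square_mat A"
    unfolding inverts_mat_def by auto
  then show "A \<in> {A \<in> carrier_mat N N. invertible_mat A}"
    using \<open>A \<in> carrier_mat N N\<close> unfolding invertible_mat_def by blast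
next
  fix A :: "complex mat" assume "A \<in> {A \<in> carrier_mat N N. invertible_mat A}"
  then obtain B where A: "A \<in> carrier_mat N N" and B: "inverts_mat A B" "inverts_mat B A"
    unfolding invertible_mat_def by auto
  from A B(1) have AB: "A * B = 1\<^sub>m N"
    unfolding inverts_mat_def by auto
  from A B(2) have BA: "B * A = 1\<^sub>m (dim_row B)"
    unfolding inverts_mat_def by auto
  from arg_cong[OF AB, of dim_col] arg_cong[OF BA, of dim_col] A
  have "B \<in> carrier_mat N N" by auto
  with A AB BA show "A \<in> carrier (GL N)"
    unfolding GL_def units_of_def Units_def ring_mat_def by auto
qed

lemma group_GL: "group (GL N)"
proof -
  interpret semiring "ring_mat TYPE(complex) N ()" by (rule semiring_mat)
  show ?thesis unfolding GL_def by (rule units_group)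
qed

lemma mult_GL: "A \<otimes>\<^bsub>GL N\<^esub> B = A * B" and one_GL: "\<one>\<^bsub>GL N\<^esub> = 1\<^sub>m N"
  by (simp_all add: GL_def units_of_def ring_mat_def)

lemma scalar_mult:
  fixes A :: "complex mat"
  assumes "A \<in> carrier_mat N N"
  shows "(c \<cdot>\<^sub>m 1\<^sub>m N) * A = c \<cdot>\<^sub>m A" "A * (c \<cdot>\<^sub>m 1\<^sub>m N) = c \<cdot>\<^sub>m A"
  by (simp_all only: mult_smult_assoc_mat[OF one_carrier_mat assms] left_mult_one_mat[OF assms]
      mult_smult_distrib[OF assms one_carrier_mat] right_mult_one_mat[OF assms])

lemma smult_smult_mat: "a \<cdot>\<^sub>m (b \<cdot>\<^sub>m A) = (a * b) \<cdot>\<^sub>m A" for A :: "complex mat"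
  by (rule eq_matI) auto

lemma scalar_times_scalar: "(a \<cdot>\<^sub>m 1\<^sub>m N) * (b \<cdot>\<^sub>m 1\<^sub>m N) = (a * b) \<cdot>\<^sub>m (1\<^sub>m N :: complex mat)"
  by (subst scalar_mult(1)) (simp_all only: smult_smult_mat smult_carrier_mat one_carrier_mat)

lemma one_smult_one: "1 \<cdot>\<^sub>m 1\<^sub>m N = (1\<^sub>m N :: complex mat)"
  by (rule eq_matI) auto

lemma scalars_in_GL:
  assumes "c \<noteq> 0"
  shows "c \<cdot>\<^sub>m 1\<^sub>m N \<in> carrier (GL N)"
proof -
  have "(1 / c) \<cdot>\<^sub>m 1\<^sub>m N * (c \<cdot>\<^sub>m 1\<^sub>m N) = 1\<^sub>m N" "c \<cdot>\<^sub>m 1\<^sub>m N * ((1 / c) \<cdot>\<^sub>m 1\<^sub>m N) = 1\<^sub>m N"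
    using assms by (simp_all add: scalar_times_scalar one_smult_one)
  moreover have "c \<cdot>\<^sub>m 1\<^sub>m N \<in> carrier_mat N N" "(1 / c) \<cdot>\<^sub>m 1\<^sub>m N \<in> carrier_mat N N"
    by simp_all
  ultimately show ?thesis
    unfolding GL_def units_of_def Units_def ring_mat_def by auto
qed

lemma normal_scalars: "scalars N \<lhd> GL N"
proof -
  interpret group "GL N" by (rule group_GL)
  have inv: "inv\<^bsub>GL N\<^esub> (c \<cdot>\<^sub>m 1\<^sub>m N) = (1 / c) \<cdot>\<^sub>m 1\<^sub>m N" if "c \<noteq> 0" for c
    using that by (intro inv_equality)
      (simp_all add: scalars_in_GL mult_GL one_GL scalar_times_scalar one_smult_one)
  have sub: "subgroup (scalars N) (GL N)"
  proof (rule subgroupI)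
    show "scalars N \<subseteq> carrier (GL N)"
      using scalars_in_GL unfolding scalars_def by blast
    show "scalars N \<noteq> {}"
      unfolding scalars_def using one_neq_zero by blast
    show "inv\<^bsub>GL N\<^esub> A \<in> scalars N" if A: "A \<in> scalars N" for A
    proof -
      obtain c where "c \<noteq> 0" "A = c \<cdot>\<^sub>m 1\<^sub>m N"
        using A unfolding scalars_def by blast
      then have "1 / c \<noteq> 0" "inv\<^bsub>GL N\<^esub> A = (1 / c) \<cdot>\<^sub>m 1\<^sub>m N"
        using inv by simp_all
      then show ?thesis unfolding scalars_def by blast
    qed
    show "A \<otimes>\<^bsub>GL N\<^esub> B \<in> scalars N" if AB: "A \<in> scalars N" "B \<in> scalars N" for A B
    proof -
      obtain a b where "a \<noteq> 0" "b \<noteq> 0" "A = a \<cdot>\<^sub>m 1\<^sub>m N" "B = b \<cdot>\<^sub>m 1\<^sub>m N"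
        using AB unfolding scalars_def by blast
      then have "a * b \<noteq> 0" "A \<otimes>\<^bsub>GL N\<^esub> B = (a * b) \<cdot>\<^sub>m 1\<^sub>m N"
        by (simp_all add: mult_GL scalar_times_scalar)
      then show ?thesis unfolding scalars_def by blast
    qed
  qed
  have comm: "h \<otimes>\<^bsub>GL N\<^esub> A = A \<otimes>\<^bsub>GL N\<^esub> h" if "A \<in> carrier (GL N)" "h \<in> scalars N" for h A
    using that unfolding scalars_def by (auto simp: mult_GL scalar_mult carrier_GL)
  show ?thesis
  proof (rule normalI[OF sub], rule ballI)
    fix A assume "A \<in> carrier (GL N)"
    then show "scalars N #>\<^bsub>GL N\<^esub> A = A <#\<^bsub>GL N\<^esub> scalars N"
      unfolding r_coset_def l_coset_def by (intro SUP_cong refl) (metis comm)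
  qed
qed

lemma group_PGL: "group (PGL N)"
  unfolding PGL_def by (rule normal.factorgroup_is_group[OF normal_scalars])

lemma carrier_PGL: "carrier (PGL N) = (\<lambda>A. {c \<cdot>\<^sub>m A | c. c \<noteq> 0}) ` carrier (GL N)"
proof -
  have "scalars N #>\<^bsub>GL N\<^esub> A = {c \<cdot>\<^sub>m A | c. c \<noteq> 0}" if A: "A \<in> carrier (GL N)" for A
  proof -
    have "(c \<cdot>\<^sub>m 1\<^sub>m N) \<otimes>\<^bsub>GL N\<^esub> A = c \<cdot>\<^sub>m A" for c
      using A by (simp add: mult_GL scalar_mult carrier_GL)
    then show ?thesis
      unfolding r_coset_def scalars_def by (auto; metis)
  qed
  then show ?thesis
    unfolding PGL_def carrier_FactGroup by (intro image_cong) auto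
qed

lemma proj_action_point:
  assumes "A \<in> carrier_mat N N" "v \<in> carrier_vec N"
  shows "proj_action {c \<cdot>\<^sub>m A | c. c \<noteq> 0} (proj_point v) = proj_point (A *\<^sub>v v)"
proof -
  have *: "(a \<cdot>\<^sub>m A) *\<^sub>v (b \<cdot>\<^sub>v v) = (a * b) \<cdot>\<^sub>v (A *\<^sub>v v)" for a b
    using assms by (intro eq_vecI) (auto simp: scalar_prod_def sum_distrib_left ac_simps)
  show ?thesis
  proof (intro equalityI subsetI)
    fix w assume "w \<in> proj_action {c \<cdot>\<^sub>m A | c. c \<noteq> 0} (proj_point v)"
    then obtain a b where "a \<noteq> 0" "b \<noteq> 0" "w = (a \<cdot>\<^sub>m A) *\<^sub>v (b \<cdot>\<^sub>v v)"
      unfolding proj_action_def proj_point_def by blast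
    then have "a * b \<noteq> 0" "w = (a * b) \<cdot>\<^sub>v (A *\<^sub>v v)"
      by (simp_all only: * mult_eq_0_iff simp_thms)
    then show "w \<in> proj_point (A *\<^sub>v v)"
      unfolding proj_point_def by blast
  next
    fix w assume "w \<in> proj_point (A *\<^sub>v v)"
    then obtain c where "c \<noteq> 0" "w = c \<cdot>\<^sub>v (A *\<^sub>v v)"
      unfolding proj_point_def by blast
    then have "w = (c \<cdot>\<^sub>m A) *\<^sub>v (1 \<cdot>\<^sub>v v)" "c \<noteq> 0"
      by (simp_all only: * mult_1_right simp_thms)
    then show "w \<in> proj_action {c \<cdot>\<^sub>m A | c. c \<noteq> 0} (proj_point v)"
      unfolding proj_action_def proj_point_def using one_neq_zero by blast
  qed
qed

lemma proj_point_in_hypersurface: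
  assumes "homogeneous N d F" "v \<in> carrier_vec N" "v \<noteq> 0\<^sub>v N"
  shows "proj_point v \<in> hypersurface N F \<longleftrightarrow> peval F v = 0"
proof
  assume "proj_point v \<in> hypersurface N F"
  then obtain w where w: "w \<in> carrier_vec N" "proj_point v = proj_point w" "peval F w = 0"
    unfolding hypersurface_def by blast
  have "1 \<cdot>\<^sub>v v \<in> proj_point v"
    unfolding proj_point_def using one_neq_zero by blast
  then have "v \<in> proj_point w"
    by (simp add: w(2))
  then obtain c where c: "v = c \<cdot>\<^sub>v w"
    unfolding proj_point_def by blast
  have "peval F (c \<cdot>\<^sub>v w) = (\<Sum>m\<in>Poly_Mapping.keys F. c ^ d * (Poly_Mapping.lookup F m *
      (\<Prod>i\<in>Poly_Mapping.keys m. (w $ i) ^ Poly_Mapping.lookup m i)))"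
    unfolding peval_def
  proof (rule sum.cong)
    fix m assume m: "m \<in> Poly_Mapping.keys F"
    have "(\<Prod>i\<in>Poly_Mapping.keys m. ((c \<cdot>\<^sub>v w) $ i) ^ Poly_Mapping.lookup m i)
        = (\<Prod>i\<in>Poly_Mapping.keys m. c ^ Poly_Mapping.lookup m i * (w $ i) ^ Poly_Mapping.lookup m i)"
    proof (rule prod.cong)
      fix i assume "i \<in> Poly_Mapping.keys m"
      then have "i < N"
        using m assms(1) unfolding homogeneous_def pvars_def by blast
      then show "((c \<cdot>\<^sub>v w) $ i) ^ Poly_Mapping.lookup m i =
          c ^ Poly_Mapping.lookup m i * (w $ i) ^ Poly_Mapping.lookup m i"
        using w(1) by (simp add: power_mult_distrib)
    qed simp
    also have "\<dots> = c ^ d * (\<Prod>i\<in>Poly_Mapping.keys m. (w $ i) ^ Poly_Mapping.lookup m i)"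
      using m assms(1) by (simp add: homogeneous_def prod.distrib flip: power_sum)
    finally show "Poly_Mapping.lookup F m *
        (\<Prod>i\<in>Poly_Mapping.keys m. ((c \<cdot>\<^sub>v w) $ i) ^ Poly_Mapping.lookup m i) =
        c ^ d * (Poly_Mapping.lookup F m *
        (\<Prod>i\<in>Poly_Mapping.keys m. (w $ i) ^ Poly_Mapping.lookup m i))"
      by simp
  qed simp
  also have "\<dots> = c ^ d * peval F w"
    by (simp add: peval_def sum_distrib_left)
  finally show "peval F v = 0"
    by (simp add: c w(3))
next
  assume "peval F v = 0"
  then show "proj_point v \<in> hypersurface N F"
    using assms unfolding hypersurface_def by blast
qed

end

theory Submission
  imports Defs
    "HOL-Computational_Algebra.Field_as_Ring"
    "Subresultants.Subresultant_Gcd"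
    "Jordan_Normal_Form.Jordan_Normal_Form_Existence"
begin

text \<open>
Let \<open>M\<close> be a matrix whose class has finite order \<open>n\<close> and maps \<open>V(F)\<close> to itself. Some power of \<open>M\<close> is
scalar, so \<open>M\<close> is diagonalizable (\<open>root_of_scalar_diagonalizable\<close>), and \<open>F\<close> is multiplied by a
constant when \<open>M\<close> is applied to its argument (\<open>hypersurface_preserved_imp_semi_invariant\<close>); after
rescaling \<open>M\<close> the constant is \<open>1\<close>. In an eigenbasis every monomial that occurs in \<open>F\<close> then has
weight \<open>1\<close>, where a monomial's weight is the same monomial in the eigenvalues \<open>l\<^sub>i\<close>.

Smoothness at the \<open>i\<close>-th basis vector provides a monomial \<open>x\<^sub>i\<^sup>d\<^sup>-\<^sup>1 x\<^sub>j\<close>. Choosing one \<open>j = \<phi>(i)\<close> for every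
\<open>i\<close> gives a map \<open>\<phi>\<close> of the \<open>N\<close> indices with \<open>l (\<phi> i) = l i powi (1 - d)\<close>. Its graph consists of cycles
with trees hanging from them. On a cycle of length \<open>a\<close> every eigenvalue is killed by
\<open>\<bar>1 - (1 - d)\<^sup>a\<bar>\<close>, and an index at distance \<open>r\<close> from the cycles costs a further factor \<open>(d - 1)\<^sup>r\<close>. If
\<open>A\<close> is the set of cycle lengths and \<open>h\<close> is the greatest distance, then \<open>n\<close> divides
\<open>(d - 1)\<^sup>h \<cdot> lcm {\<bar>1 - (1 - d)\<^sup>a\<bar> | a \<in> A}\<close> and counting indices gives \<open>\<Sum>A + h \<le> N\<close>. This is one
less than what a chain of length \<open>h + 1\<close> needs, so the case \<open>\<Sum>A + h = N\<close>, \<open>h \<ge> 1\<close> requires an extra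
argument. There the graph is rigid: one cycle for each length and a single path, entering a cycle at \<open>j\<close>. If \<open>1 \<in> A\<close>,
the fixed point can be discarded or its weight normalized (\<open>exponent_bound_fixed_point\<close>). Now let \<open>1 \<notin> A\<close>.
The end \<open>i'\<close> of the path and the predecessor \<open>i\<close> of \<open>j\<close> on the cycle share the image \<open>j\<close>, and
smoothness on the plane of these two basis vectors provides another monomial
\<open>x\<^sub>i\<^sup>\<alpha> x\<^sub>i\<^sub>'\<^sup>\<beta> x\<^sub>k\<close> with \<open>\<alpha> + \<beta> = d - 1\<close> and \<open>k \<noteq> j\<close> (\<open>eigenvalue_pair_relation\<close>). Its weight relation
lets one delete or shorten a cycle, or lower \<open>h\<close> (\<open>exponent_bound_tight\<close>). This proves the list of
divisors (\<open>exponent_bound\<close>).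

Conversely, every divisor of a number in the list is attained. A cycle or chain block of variables
carries an automorphism whose eigenvalues are successive \<open>(1 - d)\<close>-th powers of a root of unity. A divisor
of a least common multiple splits into pairwise coprime divisors of the individual numbers
(\<open>dvd_lcm_coprime_split\<close>), which are realized on disjoint blocks; two blocks with coprime orders have no
nontrivial common scalar, so nothing is lost in the projective group (\<open>simple_order_two_blocks\<close>).
\<close>

section \<open>Polynomials in two variables and multiple factors\<close>

text \<open>
In a factorization of \<open>g\<close> into primes of \<open>\<complex>[s][t]\<close>, the degrees in \<open>t\<close> add up, so not all of them vanish.
\<close>

lemma prime_factor_of_positive_degree:
  fixes g :: "complex poly poly"
  assumes "degree g \<noteq> 0"
  obtains p where "prime p" "p dvd g" "degree p > 0"
proof -
  from assms have "g \<noteq> 0" by auto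
  have "\<exists>p. prime p \<and> p dvd g \<and> degree p > 0"
    using assms \<open>g \<noteq> 0\<close>
  proof (induction g rule: prime_divisors_induct)
    case zero then show ?case by simp
  next
    case (unit x) then show ?case by (auto simp: is_unit_poly_iff)
  next
    case (factor p x)
    show ?case
    proof (cases "degree p > 0")
      case True with factor show ?thesis by auto
    next
      case False
      with factor have "degree x \<noteq> 0" "x \<noteq> 0" by (auto simp: degree_mult_eq)
      with factor.IH show ?thesis by auto
    qed
  qed
  then show ?thesis using that by blast
qed

text \<open>
If \<open>f = p k\<close>, then \<open>p\<close> divides \<open>k p'\<close>; it cannot divide \<open>p'\<close>, which has smaller degree and is nonzero in
characteristic \<open>0\<close>, so it divides \<open>k\<close>.
\<close>

lemma square_dvd_if_dvd_pderiv:
  fixes f p :: "complex poly poly"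
  assumes "prime p" "degree p > 0" "p dvd f" "p dvd pderiv f"
  shows "p^2 dvd f"
proof -
  obtain k where k: "f = p * k" using assms by blast
  have "p dvd p * pderiv k + k * pderiv p"
    using assms(4) by (simp add: k pderiv_mult)
  then have "p dvd k * pderiv p"
    by (simp add: dvd_add_right_iff)
  moreover have "\<not> p dvd pderiv p"
    using assms(2) by (metis degree_pderiv diff_less dvd_imp_degree_le less_one linorder_not_le pderiv_eq_0_iff less_numeral_extra(3))
  ultimately have "p dvd k" using assms(1) by (simp add: prime_dvd_mult_iff)
  then show ?thesis by (simp add: k power2_eq_square mult_dvd_mono)
qed

text \<open>
A polynomial \<open>f \<in> \<complex>[s][t]\<close> is a \<^typ>\<open>complex poly poly\<close> with outer variable \<open>t\<close>;
\<open>specialize s f\<close> is the polynomial \<open>f(s, t)\<close> in \<open>t\<close> alone.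
\<close>

abbreviation specialize :: "complex \<Rightarrow> complex poly poly \<Rightarrow> complex poly" where
  "specialize s \<equiv> map_poly (\<lambda>c. poly c s)"

lemma specialize_hom: "comm_ring_hom (\<lambda>c. poly c s)" "zero_hom (\<lambda>c::complex poly. poly c s)"
  by (unfold_locales, auto)

lemma degree_specialize:
  assumes "lead_coeff f = [:c:]" "c \<noteq> 0" shows "degree (specialize s f) = degree f"
  using assms by (intro map_poly_degree_eq) auto

lemma specialize_pderiv: "specialize s (pderiv f) = pderiv (specialize s f)"
  by (rule poly_eqI) (simp add: coeff_pderiv coeff_map_poly)

lemma poly_eq_0_if_cofinitely_0:
  fixes p :: "complex poly"
  assumes "finite S" "\<And>s. s \<notin> S \<Longrightarrow> poly p s = 0" shows "p = 0"
proof (rule ccontr)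
  assume "p \<noteq> 0"
  then have "finite {s. poly p s = 0}" by (rule poly_roots_finite)
  moreover have "UNIV = S \<union> {s. poly p s = 0}" using assms by auto
  ultimately show False using assms(1) by (metis finite_UnI infinite_UNIV_char_0)
qed

text \<open>
A form of the Nullstellensatz for plane curves. The discriminant of \<open>f\<close> with respect to \<open>t\<close> is a polynomial in
\<open>s\<close>. If it vanished, \<open>f\<close> and its derivative would share a factor, whose square would divide \<open>f\<close>. Otherwise, for
all but finitely many \<open>s\<close>, the polynomial \<open>f(s, t)\<close> in \<open>t\<close> has as many distinct roots as its degree; all of them
are roots of \<open>h(s, t)\<close>, whose degree is smaller, so \<open>h(s, t) = 0\<close>.
\<close>

lemma zero_or_multiple_factor:
  fixes f h :: "complex poly poly"
  assumes lc: "lead_coeff f = [:c:]" "c \<noteq> 0" and deg: "degree f > 0"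
    and hd: "degree h < degree f"
    and zeros: "\<And>s t. poly (specialize s f) t = 0 \<Longrightarrow> poly (specialize s h) t = 0"
    and sf: "\<And>p. degree p > 0 \<Longrightarrow> \<not> p^2 dvd f"
  shows "h = 0"
proof -
  define R where "R = resultant f (pderiv f)"
  have "R \<noteq> 0"
  proof
    assume "R = 0"
    then have "degree (gcd f (pderiv f)) \<noteq> 0"
      unfolding R_def by (simp add: resultant_0_gcd)
    then obtain p where p: "prime p" "p dvd gcd f (pderiv f)" "degree p > 0"
      by (rule prime_factor_of_positive_degree)
    then show False using sf[of p] square_dvd_if_dvd_pderiv[of p f] by auto
  qed
  then have fin: "finite {s. poly R s = 0}" by (rule poly_roots_finite)
  have *: "specialize s h = 0" if s: "poly R s \<noteq> 0" for s
  proof (rule ccontr)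
    assume h0: "specialize s h \<noteq> 0"
    have d: "degree (specialize s f) = degree f" using degree_specialize[OF lc] .
    have nz: "specialize s f \<noteq> 0" using d deg by auto
    have "resultant (specialize s f) (specialize s (pderiv f)) = poly R s"
      unfolding R_def
    proof (rule comm_ring_hom.resultant_map_poly[OF specialize_hom(1) d])
      show "degree (specialize s (pderiv f)) = degree (pderiv f)"
        unfolding specialize_pderiv degree_pderiv d ..
    qed
    with s have "degree (gcd (specialize s f) (pderiv (specialize s f))) = 0"
      using resultant_0_gcd by (metis specialize_pderiv)
    then have cop: "is_unit (gcd (specialize s f) (pderiv (specialize s f)))"
      using nz by (simp add: is_unit_iff_degree)
    have "rsquarefree (specialize s f)"
      unfolding rsquarefree_roots
    proof (intro allI notI)
      fix a assume "poly (specialize s f) a = 0 \<and> poly (pderiv (specialize s f)) a = 0"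
      then have "[:-a,1:] dvd gcd (specialize s f) (pderiv (specialize s f))"
        by (simp add: poly_eq_0_iff_dvd)
      with cop have "is_unit [:-a,1:]" by (rule dvd_trans[rotated])
      then show False by (simp add: is_unit_iff_degree)
    qed
    then have "card {t. poly (specialize s f) t = 0} = degree f"
      using rsquarefree_card_degree[OF nz] d by simp
    moreover have "card {t. poly (specialize s f) t = 0} \<le> card {t. poly (specialize s h) t = 0}"
      using zeros by (intro card_mono poly_roots_finite h0) auto
    moreover have "card {t. poly (specialize s h) t = 0} \<le> degree (specialize s h)"
      using h0 by (rule card_poly_roots_bound)
    moreover have "degree (specialize s h) \<le> degree h"
      by (rule degree_map_poly_le)
    ultimately show False using hd by linarith
  qed
  show "h = 0"
  proof (rule poly_eqI)
    fix n
    have "coeff h n = 0"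
      using fin
    proof (rule poly_eq_0_if_cofinitely_0)
      fix s assume "s \<notin> {s. poly R s = 0}"
      then have "specialize s h = 0" using * by simp
      then show "poly (coeff h n) s = 0"
        by (metis coeff_0 coeff_map_poly poly_0)
    qed
    then show "coeff h n = coeff 0 n" by simp
  qed
qed

section \<open>Evaluation in commutative rings\<close>

definition monomial_at :: "(nat \<Rightarrow>\<^sub>0 nat) \<Rightarrow> (nat \<Rightarrow> 'a::comm_ring_1) \<Rightarrow> 'a" where
  "monomial_at m x = (\<Prod>i\<in>Poly_Mapping.keys m. x i ^ Poly_Mapping.lookup m i)"

text \<open>
The values lie in an arbitrary ring because the same polynomial has to be evaluated at complex points, at
linear polynomials in one variable (restriction to a line) and at linear polynomials in two variables
(restriction to a plane). The map \<open>\<iota>\<close> embeds the coefficients.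
\<close>

definition eval_at :: "(complex \<Rightarrow> 'a::comm_ring_1) \<Rightarrow> cpoly \<Rightarrow> (nat \<Rightarrow> 'a) \<Rightarrow> 'a" where
  "eval_at \<iota> F x = (\<Sum>m\<in>Poly_Mapping.keys F. \<iota> (Poly_Mapping.lookup F m) * monomial_at m x)"

lemma monomial_at_superset:
  assumes "finite S" "Poly_Mapping.keys m \<subseteq> S"
  shows "monomial_at m x = (\<Prod>i\<in>S. x i ^ Poly_Mapping.lookup m i)"
  unfolding monomial_at_def using assms
  by (intro prod.mono_neutral_left) (auto simp: in_keys_iff)

lemma eval_at_superset:
  assumes "finite S" "Poly_Mapping.keys F \<subseteq> S" "\<iota> 0 = 0"
  shows "eval_at \<iota> F x = (\<Sum>m\<in>S. \<iota> (Poly_Mapping.lookup F m) * monomial_at m x)"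
  unfolding eval_at_def using assms
  by (intro sum.mono_neutral_left) (auto simp: in_keys_iff)

context
  fixes \<iota> :: "complex \<Rightarrow> 'a::comm_ring_1"
  assumes \<iota>: "comm_ring_hom \<iota>"
begin

interpretation comm_ring_hom \<iota> by (rule \<iota>)

lemma eval_at_add: "eval_at \<iota> (F + G) x = eval_at \<iota> F x + eval_at \<iota> G x"
proof -
  let ?S = "Poly_Mapping.keys F \<union> Poly_Mapping.keys G"
  have "Poly_Mapping.keys (F + G) \<subseteq> ?S" by (rule Poly_Mapping.keys_add)
  then show ?thesis
    by (simp add: eval_at_superset[of ?S] lookup_add hom_add distrib_right sum.distrib)
qed

lemma eval_at_0 [simp]: "eval_at \<iota> 0 x = 0"
  by (simp add: eval_at_def)

lemma eval_at_sum: "eval_at \<iota> (\<Sum>a\<in>A. F a) x = (\<Sum>a\<in>A. eval_at \<iota> (F a) x)"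
  by (induction A rule: infinite_finite_induct) (simp_all add: eval_at_add)

lemma eval_at_single: "eval_at \<iota> (Poly_Mapping.single m c) x = \<iota> c * monomial_at m x"
  by (simp add: eval_at_def)

lemma eval_at_partial_deriv:
  "eval_at \<iota> (partial_deriv i F) x = (\<Sum>m\<in>Poly_Mapping.keys F.
     of_nat (Poly_Mapping.lookup m i) * \<iota> (Poly_Mapping.lookup F m) *
     monomial_at (m - Poly_Mapping.single i 1) x)"
  by (simp add: partial_deriv_def eval_at_sum eval_at_single hom_mult hom_of_nat)

end

text \<open>
Specializing a plane to a line, or a line to a point, commutes with evaluation.
\<close>

lemma (in comm_ring_hom) hom_eval_at:
  "hom (eval_at \<iota> F x) = eval_at (\<lambda>c. hom (\<iota> c)) F (\<lambda>i. hom (x i))"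
  by (simp add: eval_at_def monomial_at_def hom_sum hom_mult hom_prod hom_power)

lemma pderiv_prod_nat:
  fixes y :: "nat \<Rightarrow> 'a::idom poly"
  assumes "finite S"
  shows "pderiv (\<Prod>k\<in>S. y k) = (\<Sum>i\<in>S. pderiv (y i) * (\<Prod>k\<in>S - {i}. y k))"
  using assms by (simp add: pderiv_prod mult.commute)

lemma pderiv_monomial_at:
  fixes x :: "nat \<Rightarrow> complex poly"
  assumes "Poly_Mapping.keys m \<subseteq> {..<N}"
  shows "pderiv (monomial_at m x) =
    (\<Sum>i<N. of_nat (Poly_Mapping.lookup m i) * monomial_at (m - Poly_Mapping.single i 1) x * pderiv (x i))"
proof -
  let ?l = "Poly_Mapping.lookup m"
  have "pderiv (monomial_at m x) = (\<Sum>i<N. pderiv (x i ^ ?l i) * (\<Prod>k\<in>{..<N} - {i}. x k ^ ?l k))"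
    by (simp add: monomial_at_superset[OF _ assms] pderiv_prod_nat)
  also have "\<dots> = (\<Sum>i<N. of_nat (?l i) * monomial_at (m - Poly_Mapping.single i 1) x * pderiv (x i))"
  proof (rule sum.cong[OF refl])
    fix i assume i: "i \<in> {..<N}"
    have k: "Poly_Mapping.keys (m - Poly_Mapping.single i 1) \<subseteq> {..<N}"
      using assms by (auto simp: in_keys_iff lookup_minus subset_iff)
    have "monomial_at (m - Poly_Mapping.single i 1) x = x i ^ (?l i - 1) * (\<Prod>k\<in>{..<N} - {i}. x k ^ ?l k)"
      unfolding monomial_at_superset[OF finite_lessThan k] prod.remove[OF finite_lessThan i]
      by (auto simp: lookup_minus lookup_single when_def intro!: prod.cong)
    then show "pderiv (x i ^ ?l i) * (\<Prod>k\<in>{..<N} - {i}. x k ^ ?l k)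
       = of_nat (?l i) * monomial_at (m - Poly_Mapping.single i 1) x * pderiv (x i)"
      by (cases "?l i") (simp, simp only: pderiv_power_Suc, simp add: of_nat_poly algebra_simps)
  qed
  finally show ?thesis .
qed

lemma const_poly_hom: "comm_ring_hom (\<lambda>c::'a::comm_ring_1. [:c:])"
  by unfold_locales (simp_all flip: one_pCons)

text \<open>
The chain rule. Where the truncated subtraction of exponents in a partial derivative loses information, its
coefficient is \<open>0\<close>.
\<close>

lemma pderiv_eval_at:
  fixes x :: "nat \<Rightarrow> complex poly"
  assumes "pvars F \<subseteq> {..<N}"
  shows "pderiv (eval_at (\<lambda>c. [:c:]) F x)
    = (\<Sum>i<N. eval_at (\<lambda>c. [:c:]) (partial_deriv i F) x * pderiv (x i))"
proof -
  have k: "Poly_Mapping.keys m \<subseteq> {..<N}" if "m \<in> Poly_Mapping.keys F" for m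
    using assms that unfolding pvars_def by blast
  have "pderiv (eval_at (\<lambda>c. [:c:]) F x)
      = (\<Sum>m\<in>Poly_Mapping.keys F. [:Poly_Mapping.lookup F m:] * pderiv (monomial_at m x))"
    unfolding eval_at_def by (simp add: pderiv_sum pderiv_smult)
  also have "\<dots> = (\<Sum>m\<in>Poly_Mapping.keys F. \<Sum>i<N. [:Poly_Mapping.lookup F m:] *
     (of_nat (Poly_Mapping.lookup m i) * monomial_at (m - Poly_Mapping.single i 1) x * pderiv (x i)))"
    using k by (intro sum.cong refl) (simp only: pderiv_monomial_at[of _ N] sum_distrib_left)
  also have "\<dots> = (\<Sum>i<N. eval_at (\<lambda>c. [:c:]) (partial_deriv i F) x * pderiv (x i))"
    by (subst sum.swap)
       (simp add: eval_at_partial_deriv[OF const_poly_hom] sum_distrib_right sum_distrib_left mult_ac)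
  finally show ?thesis .
qed

abbreviation ev :: "cpoly \<Rightarrow> (nat \<Rightarrow> complex) \<Rightarrow> complex" where
  "ev F x \<equiv> eval_at (\<lambda>c. c) F x"

definition dir_deriv :: "nat \<Rightarrow> cpoly \<Rightarrow> (nat \<Rightarrow> complex) \<Rightarrow> (nat \<Rightarrow> complex) \<Rightarrow> complex" where
  "dir_deriv N F x y = (\<Sum>i<N. ev (partial_deriv i F) x * y i)"

lemma pvars_keys: "pvars F \<subseteq> S \<Longrightarrow> m \<in> Poly_Mapping.keys F \<Longrightarrow> Poly_Mapping.keys m \<subseteq> S"
  unfolding pvars_def by blast

lemma eval_at_cong:
  assumes "pvars F \<subseteq> {..<N}" "\<And>i. i < N \<Longrightarrow> x i = y i"
  shows "eval_at \<iota> F x = eval_at \<iota> F y"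
  unfolding eval_at_def monomial_at_def
  using pvars_keys[OF assms(1)] assms(2)
  by (intro sum.cong refl arg_cong2[where f = "(*)"] prod.cong arg_cong2[where f = "(^)"]) blast

lemma homogeneousD:
  assumes "homogeneous N d F"
  shows "pvars F \<subseteq> {..<N}"
    "m \<in> Poly_Mapping.keys F \<Longrightarrow> (\<Sum>i\<in>Poly_Mapping.keys m. Poly_Mapping.lookup m i) = d"
    "m \<in> Poly_Mapping.keys F \<Longrightarrow> (\<Sum>i<N. Poly_Mapping.lookup m i) = d"
proof -
  show 1: "pvars F \<subseteq> {..<N}" using assms by (auto simp: homogeneous_def)
  assume m: "m \<in> Poly_Mapping.keys F"
  then show 2: "(\<Sum>i\<in>Poly_Mapping.keys m. Poly_Mapping.lookup m i) = d"
    using assms by (auto simp: homogeneous_def)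
  have "(\<Sum>i<N. Poly_Mapping.lookup m i) = (\<Sum>i\<in>Poly_Mapping.keys m. Poly_Mapping.lookup m i)"
    using pvars_keys[OF 1 m]
    by (intro sum.mono_neutral_right) (auto simp: in_keys_iff)
  then show "(\<Sum>i<N. Poly_Mapping.lookup m i) = d" using 2 by simp
qed

lemma homogeneous_partial_deriv:
  assumes "homogeneous N d F"
  shows "homogeneous N (d - 1) (partial_deriv i F)"
proof -
  have *: "\<exists>m\<in>Poly_Mapping.keys F. m' = m - Poly_Mapping.single i 1 \<and> Poly_Mapping.lookup m i \<noteq> 0"
    if "m' \<in> Poly_Mapping.keys (partial_deriv i F)" for m'
  proof -
    have "m' \<in> (\<Union>m\<in>Poly_Mapping.keys F. Poly_Mapping.keys (Poly_Mapping.single (m - Poly_Mapping.single i 1)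
       (of_nat (Poly_Mapping.lookup m i) * Poly_Mapping.lookup F m)))"
      using that unfolding partial_deriv_def by (rule subsetD[OF keys_sum])
    then show ?thesis by (fastforce split: if_splits)
  qed
  have sub: "Poly_Mapping.keys m' \<subseteq> {..<N}" "(\<Sum>k<N. Poly_Mapping.lookup m' k) = d - 1"
    if "m' \<in> Poly_Mapping.keys (partial_deriv i F)" for m'
  proof -
    from *[OF that] obtain m where m: "m \<in> Poly_Mapping.keys F" "m' = m - Poly_Mapping.single i 1"
      "Poly_Mapping.lookup m i \<noteq> 0" by blast
    have k: "Poly_Mapping.keys m \<subseteq> {..<N}" using pvars_keys homogeneousD(1)[OF assms] m(1) by blast
    then show "Poly_Mapping.keys m' \<subseteq> {..<N}"
      by (auto simp: m(2) in_keys_iff lookup_minus subset_iff)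
    have i: "i \<in> {..<N}" using k m(3) by (meson in_keys_iff subsetD)
    have "(\<Sum>k<N. Poly_Mapping.lookup m' k) + 1 = (\<Sum>k<N. Poly_Mapping.lookup m k)"
      unfolding sum.remove[OF finite_lessThan i] m(2) using m(3)
      by (simp add: lookup_minus lookup_single when_def cong: sum.cong_simp)
    then show "(\<Sum>k<N. Poly_Mapping.lookup m' k) = d - 1"
      using homogeneousD(3)[OF assms m(1)] by simp
  qed
  have "(\<Sum>k\<in>Poly_Mapping.keys m'. Poly_Mapping.lookup m' k) = d - 1"
    if "m' \<in> Poly_Mapping.keys (partial_deriv i F)" for m'
    unfolding sub(2)[OF that, symmetric]
    using sub(1)[OF that] by (intro sum.mono_neutral_left) (auto simp: in_keys_iff)
  then show ?thesis unfolding homogeneous_def pvars_def using sub(1) by blast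
qed

lemma eval_at_scale:
  assumes "homogeneous N d F"
  shows "eval_at \<iota> F (\<lambda>i. c * x i) = c ^ d * eval_at \<iota> F x"
proof -
  have "monomial_at m (\<lambda>i. c * x i) = c ^ d * monomial_at m x" if "m \<in> Poly_Mapping.keys F" for m
    using homogeneousD(2)[OF assms that]
    by (simp add: monomial_at_def power_mult_distrib prod.distrib flip: power_sum)
  then show ?thesis
    by (simp add: eval_at_def sum_distrib_left algebra_simps cong: sum.cong_simp)
qed

lemma coeff_mult_top:
  assumes "degree p \<le> m" "degree q \<le> n"
  shows "coeff (p * q) (m + n) = coeff p m * coeff q n"
proof -
  have "coeff (p * q) (m + n) = (\<Sum>i\<le>m + n. coeff p i * coeff q (m + n - i))"
    by (simp add: coeff_mult)
  also have "\<dots> = (\<Sum>i\<in>{m}. coeff p i * coeff q (m + n - i))"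
  proof (rule sum.mono_neutral_right)
    show "\<forall>i\<in>{..m + n} - {m}. coeff p i * coeff q (m + n - i) = 0"
    proof
      fix i assume i: "i \<in> {..m + n} - {m}"
      show "coeff p i * coeff q (m + n - i) = 0"
      proof (cases "i > m")
        case True then show ?thesis using assms by (simp add: coeff_eq_0)
      next
        case False then have "m + n - i > n" using i by auto
        then show ?thesis using assms by (simp add: coeff_eq_0)
      qed
    qed
  qed auto
  finally show ?thesis by simp
qed

lemma degree_coeff_power_linear:
  fixes a b :: "'a::comm_ring_1"
  shows "degree ([:a, b:] ^ e) \<le> e \<and> coeff ([:a, b:] ^ e) e = b ^ e"
proof (induction e)
  case (Suc e)
  have 1: "degree [:a, b:] \<le> 1" by simp
  have "coeff ([:a, b:] * [:a, b:] ^ e) (1 + e) = coeff [:a, b:] 1 * coeff ([:a, b:] ^ e) e"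
    using coeff_mult_top[OF 1] Suc by blast
  moreover have "degree ([:a, b:] * [:a, b:] ^ e) \<le> 1 + e"
    by (rule degree_mult_le[THEN order_trans]) (use Suc 1 in linarith)
  ultimately show ?case using Suc by simp
qed auto

lemma degree_coeff_prod_linear:
  fixes a b :: "'i \<Rightarrow> 'a::comm_ring_1"
  assumes "finite S"
  shows "degree (\<Prod>i\<in>S. [:a i, b i:] ^ e i) \<le> sum e S \<and>
    coeff (\<Prod>i\<in>S. [:a i, b i:] ^ e i) (sum e S) = (\<Prod>i\<in>S. b i ^ e i)"
  using assms
proof (induction S)
  case (insert x S)
  note l = degree_coeff_power_linear[of "a x" "b x" "e x"]
  have "coeff ([:a x, b x:] ^ e x * (\<Prod>i\<in>S. [:a i, b i:] ^ e i)) (e x + sum e S)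
     = coeff ([:a x, b x:] ^ e x) (e x) * coeff (\<Prod>i\<in>S. [:a i, b i:] ^ e i) (sum e S)"
    using coeff_mult_top insert.IH l by blast
  moreover have "degree ([:a x, b x:] ^ e x * (\<Prod>i\<in>S. [:a i, b i:] ^ e i)) \<le> e x + sum e S"
    by (rule degree_mult_le[THEN order_trans]) (use insert.IH l in linarith)
  ultimately show ?case using insert l by simp
qed simp

text \<open>
On the line \<open>a + t b\<close>, a homogeneous polynomial of degree \<open>d\<close> has degree at most \<open>d\<close> in \<open>t\<close>, and the coefficient at
\<open>t\<^sup>d\<close> is its value at the point \<open>b\<close> at infinity. This also holds when \<open>a\<close> is itself a family of points.
\<close>

lemma eval_at_line_top:
  assumes "homogeneous N d F"
  shows "degree (eval_at (\<lambda>c. [:\<iota> c:]) F (\<lambda>i. [:a i, b i:])) \<le> d"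
    "coeff (eval_at (\<lambda>c. [:\<iota> c:]) F (\<lambda>i. [:a i, b i:])) d = eval_at \<iota> F b"
proof -
  have m: "degree (monomial_at m (\<lambda>i. [:a i, b i:])) \<le> d"
    "coeff (monomial_at m (\<lambda>i. [:a i, b i:])) d = monomial_at m b"
    if "m \<in> Poly_Mapping.keys F" for m
    using degree_coeff_prod_linear[of "Poly_Mapping.keys m" a b "Poly_Mapping.lookup m"]
      homogeneousD(2)[OF assms that] by (simp_all add: monomial_at_def)
  show "degree (eval_at (\<lambda>c. [:\<iota> c:]) F (\<lambda>i. [:a i, b i:])) \<le> d"
    unfolding eval_at_def using m(1)
    by (intro degree_sum_le) (auto intro: degree_smult_le[THEN order_trans])
  show "coeff (eval_at (\<lambda>c. [:\<iota> c:]) F (\<lambda>i. [:a i, b i:])) d = eval_at \<iota> F b"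
    unfolding eval_at_def using m(2) by (simp add: coeff_sum)
qed

lemma poly_eval_hom: "comm_ring_hom (\<lambda>p. poly p (t::'a::comm_ring_1))"
  by unfold_locales auto

lemma eval_line:
  "poly (eval_at (\<lambda>c. [:c:]) F (\<lambda>i. [:x i, y i:])) t = ev F (\<lambda>i. x i + t * y i)"
  by (simp add: comm_ring_hom.hom_eval_at[OF poly_eval_hom])

lemma pderiv_eval_line:
  assumes "pvars F \<subseteq> {..<N}"
  shows "poly (pderiv (eval_at (\<lambda>c. [:c:]) F (\<lambda>i. [:x i, y i:]))) t = dir_deriv N F (\<lambda>i. x i + t * y i) y"
  unfolding pderiv_eval_at[OF assms] dir_deriv_def
  by (simp add: poly_sum eval_line pderiv_pCons mult.commute)

section \<open>Linear maps preserving a smooth hypersurface\<close>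

text \<open>
Finitely many hyperplanes do not cover the space: a hyperplane contains only finitely many points of the curve
\<open>(1, z, z\<^sup>2, \<dots>)\<close>.
\<close>

lemma avoid_hyperplanes:
  fixes w :: "'t \<Rightarrow> nat \<Rightarrow> complex"
  assumes "finite T" "\<And>t. t \<in> T \<Longrightarrow> \<exists>i<N. w t i \<noteq> 0"
  obtains r where "\<And>t. t \<in> T \<Longrightarrow> (\<Sum>i<N. w t i * r i) \<noteq> 0"
proof -
  define P where "P t = (\<Sum>i<N. monom (w t i) i)" for t
  have "P t \<noteq> 0" if "t \<in> T" for t
  proof -
    obtain i where i: "i < N" "w t i \<noteq> 0" using assms(2)[OF \<open>t \<in> T\<close>] by blast
    have "coeff (P t) i = w t i"
      using i(1) by (simp add: P_def coeff_sum when_def if_distrib cong: if_cong)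
    then show ?thesis using i(2) by auto
  qed
  then have "finite (\<Union>t\<in>T. {z. poly (P t) z = 0})"
    using assms(1) by (simp add: poly_roots_finite)
  then obtain z where z: "z \<notin> (\<Union>t\<in>T. {z. poly (P t) z = 0})"
    using ex_new_if_finite[OF infinite_UNIV_char_0] by blast
  show ?thesis
    by (rule that[of "\<lambda>i. z ^ i"]) (use z in \<open>auto simp: P_def poly_sum poly_monom\<close>)
qed

text \<open>
Smoothness for points given by coordinate functions in place of vectors; the origin is any function that vanishes
below \<open>N\<close>.
\<close>

definition nonsingular :: "nat \<Rightarrow> cpoly \<Rightarrow> bool" where
  "nonsingular N F \<longleftrightarrow> (\<forall>x. (\<forall>i<N. ev (partial_deriv i F) x = 0) \<longrightarrow> (\<forall>i<N. x i = 0))"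

lemma root_of_positive_degree:
  fixes p :: "complex poly"
  assumes "degree p > 0" obtains z where "poly p z = 0"
  using fundamental_theorem_of_algebra[of p] constant_degree assms by (metis less_numeral_extra(3))

text \<open>
Compare \<open>F \<circ> L\<close> with the multiple \<open>\<mu> F\<close> that agrees with it at a point \<open>q\<close> outside the hypersurface. Take a point
\<open>p\<close> off the line of \<open>q\<close> and restrict both to a plane \<open>p + s r + t q\<close>. The difference \<open>h\<close> vanishes on the zeros
of the restriction \<open>f\<close> of \<open>F\<close>, and it has smaller degree in \<open>t\<close> because it vanishes at \<open>q\<close>. By
\<open>zero_or_multiple_factor\<close>, either \<open>h = 0\<close>, so that \<open>F \<circ> L\<close> and \<open>\<mu> F\<close> agree at \<open>p\<close>, or \<open>f\<close> has a multiple factor.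
In the latter case the derivative in the direction \<open>r\<close> vanishes at a zero of \<open>F\<close> on the line \<open>p + t q\<close>. Since \<open>F\<close> is
smooth and this line has finitely many zeros, \<open>r\<close> can be chosen to exclude that.
\<close>

lemma hypersurface_preserved_imp_semi_invariant:
  assumes hom: "homogeneous N d F" and d: "d > 0" and sm: "nonsingular N F"
    and q: "ev F q \<noteq> 0"
    and L: "L = (\<lambda>x i. \<Sum>j<N. a i j * x j)"
    and pres: "\<And>x. ev F x = 0 \<Longrightarrow> ev F (L x) = 0"
  shows "ev F (L p) = ev F (L q) / ev F q * ev F p"
proof (cases "\<exists>t. \<forall>i<N. p i + t * q i = 0")
  case True
  then obtain t where "\<And>i. i < N \<Longrightarrow> p i = (- t) * q i" by (auto simp: add_eq_0_iff2)
  then have p: "ev F p = (- t) ^ d * ev F q" "L p = L (\<lambda>i. (- t) * q i)"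
    using eval_at_cong[OF homogeneousD(1)[OF hom], of p "\<lambda>i. (- t) * q i"]
    unfolding eval_at_scale[OF hom] by (simp_all add: L)
  have "L p = (\<lambda>i. (- t) * L q i)"
    unfolding p(2) by (simp add: L sum_distrib_left algebra_simps sum_negf)
  then show ?thesis using p(1) q by (simp only: eval_at_scale[OF hom]) simp
next
  case False
  define \<mu> where "\<mu> = ev F (L q) / ev F q"
  define T where "T = {t. ev F (\<lambda>i. p i + t * q i) = 0}"
  define l where "l = eval_at (\<lambda>c. [:c:]) F (\<lambda>i. [:p i, q i:])"
  have "coeff l d = ev F q" unfolding l_def by (rule eval_at_line_top(2)[OF hom])
  then have "l \<noteq> 0" using q by auto
  then have "finite T"
    using poly_roots_finite[of l] by (simp add: T_def l_def eval_line)
  then obtain r where r: "\<And>t. t \<in> T \<Longrightarrow> dir_deriv N F (\<lambda>i. p i + t * q i) r \<noteq> 0"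
  proof (rule avoid_hyperplanes[where w = "\<lambda>t i. ev (partial_deriv i F) (\<lambda>i. p i + t * q i)" and N = N])
    fix t show "\<exists>i<N. ev (partial_deriv i F) (\<lambda>i. p i + t * q i) \<noteq> 0"
      using sm False unfolding nonsingular_def by blast
  qed (auto simp: dir_deriv_def)

  \<comment> \<open>the restrictions of \<open>F\<close> and \<open>F \<circ> L\<close> to the plane \<open>p + s r + t q\<close>\<close>
  define f where "f = eval_at (\<lambda>c. [:[:c:]:]) F (\<lambda>i. [:[:p i, r i:], [:q i:]:])"
  define g where "g = eval_at (\<lambda>c. [:[:c:]:]) F (\<lambda>i. [:[:L p i, L r i:], [:L q i:]:])"
  define h where "h = g - smult [:\<mu>:] f"
  have spec: "specialize s (eval_at (\<lambda>c. [:[:c:]:]) F (\<lambda>i. [:[:x i, y i:], [:z i:]:]))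
      = eval_at (\<lambda>c. [:c:]) F (\<lambda>i. [:x i + s * y i, z i:])" for x y z s
  proof -
    interpret map_poly_comm_ring_hom "\<lambda>c. poly c s"
      by (intro map_poly_comm_ring_hom.intro specialize_hom)
    show ?thesis by (simp add: hom_eval_at poly_hom.map_poly_pCons_hom)
  qed
  have const: "eval_at (\<lambda>c. [:c:]) F (\<lambda>i. [:z i:]) = [:ev F z:]" for z :: "nat \<Rightarrow> complex"
    using comm_ring_hom.hom_eval_at[OF const_poly_hom, of "\<lambda>c. c" F z] by simp
  have top: "degree f \<le> d" "coeff f d = [:ev F q:]" "degree g \<le> d" "coeff g d = [:ev F (L q):]"
    unfolding f_def g_def using eval_at_line_top[OF hom, where \<iota> = "\<lambda>c. [:c:]"] by (auto simp: const)
  have deg: "degree f = d" using top q by (intro antisym le_degree) auto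
  have hd: "degree h < degree f"
  proof -
    have "degree h \<le> d" unfolding h_def using top
      by (intro degree_diff_le) (auto intro: degree_smult_le[THEN order_trans])
    moreover have "coeff h d = 0" using top q by (simp add: h_def \<mu>_def)
    ultimately show ?thesis using d deg
      by (metis eq_zero_or_degree_less degree_0)
  qed
  have specf: "poly (specialize s f) t = ev F (\<lambda>i. p i + s * r i + t * q i)" for s t
    by (simp add: f_def spec eval_line)
  have spech: "poly (specialize s h) t = ev F (L (\<lambda>i. p i + s * r i + t * q i))
      - \<mu> * ev F (\<lambda>i. p i + s * r i + t * q i)" for s t
  proof -
    interpret map_poly_comm_ring_hom "\<lambda>c. poly c s"
      by (intro map_poly_comm_ring_hom.intro specialize_hom)
    have L': "(\<lambda>i. L p i + s * L r i + t * L q i) = L (\<lambda>i. p i + s * r i + t * q i)"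
      by (simp add: L sum.distrib sum_distrib_left algebra_simps)
    have "specialize s (smult [:\<mu>:] f) = smult \<mu> (specialize s f)"
      using hom_mult[of "[:[:\<mu>:]:]" f] by (simp add: poly_hom.map_poly_pCons_hom)
    then have "poly (specialize s h) t = poly (specialize s g) t - \<mu> * poly (specialize s f) t"
      by (simp add: h_def hom_minus)
    then show ?thesis by (simp add: specf) (simp add: g_def spec eval_line L')
  qed
  have "h = 0"
  proof (rule zero_or_multiple_factor[of f "ev F q"])
    show "lead_coeff f = [:ev F q:]" using deg top by simp
    show "ev F q \<noteq> 0" "degree f > 0" "degree h < degree f" using q deg d hd by auto
    show "poly (specialize s h) t = 0" if "poly (specialize s f) t = 0" for s t
      using that pres by (simp add: specf spech)
    show "\<not> b\<^sup>2 dvd f" if b: "degree b > 0" for b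
    proof
      assume "b\<^sup>2 dvd f"
      then obtain k where k: "f = b\<^sup>2 * k" by blast
      have "lead_coeff b ^ 2 * lead_coeff k = [:ev F q:]"
        using deg top(2) by (metis k lead_coeff_mult lead_coeff_power)
      then have "lead_coeff b dvd [:ev F q:]"
        by (metis dvd_triv_left dvd_mult_left power2_eq_square)
      \<comment> \<open>so specializing \<open>s\<close> does not lower the degree of \<open>b\<close>, and \<open>b(0, t)\<close> has a root\<close>
      then have "is_unit (lead_coeff b)"
        using q by (metis dvd_trans is_unit_triv)
      then obtain c where c: "lead_coeff b = [:c:]" "c \<noteq> 0"
        by (metis is_unit_polyE not_is_unit_0)
      then have "degree (specialize 0 b) > 0" using degree_specialize[OF c] b by simp
      then obtain t where t: "poly (specialize 0 b) t = 0" by (rule root_of_positive_degree)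
      \<comment> \<open>specializing in either order gives the same value; now \<open>t\<close> comes first, to differentiate by \<open>s\<close>\<close>
      have sw: "poly (specialize s u) t = poly (poly u [:t:]) s" for u s
        by (induction u) (simp_all add: poly_hom.map_poly_pCons_hom)
      have "poly f [:t:] = eval_at (\<lambda>c. [:c:]) F (\<lambda>i. [:p i + t * q i, r i:])"
        unfolding f_def comm_ring_hom.hom_eval_at[OF poly_eval_hom] by (simp add: mult.commute)
      then have "poly (pderiv (poly f [:t:])) 0 = dir_deriv N F (\<lambda>i. p i + t * q i) r"
        by (simp add: pderiv_eval_line[OF homogeneousD(1)[OF hom]])
      moreover have "poly (pderiv (poly f [:t:])) 0 = 0"
        using t by (simp add: k sw pderiv_mult power2_eq_square)
      moreover have "t \<in> T"
        using t specf[of 0 t] by (simp add: T_def k sw power2_eq_square)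
      ultimately show False using r by simp
    qed
  qed
  then show ?thesis using spech[of 0 0] by (simp add: \<mu>_def)
qed

section \<open>Diagonal matrices in the projective linear group\<close>

abbreviation proj_class :: "complex mat \<Rightarrow> complex mat set" where
  "proj_class A \<equiv> {c \<cdot>\<^sub>m A | c. c \<noteq> 0}"

definition diag :: "nat \<Rightarrow> (nat \<Rightarrow> complex) \<Rightarrow> complex mat" where
  "diag N l = mat N N (\<lambda>(i, j). if i = j then l i else 0)"

lemma diag_carrier [simp]: "diag N l \<in> carrier_mat N N" "dim_row (diag N l) = N" "dim_col (diag N l) = N"
  by (simp_all add: diag_def)

lemma diag_index: "i < N \<Longrightarrow> j < N \<Longrightarrow> diag N l $$ (i, j) = (if i = j then l i else 0)"
  by (simp add: diag_def)

lemma diag_mult: "diag N k * diag N l = diag N (\<lambda>i. k i * l i)"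
  by (rule eq_matI) (auto simp: diag_def scalar_prod_def if_distrib[where f = "\<lambda>x. x * _"] cong: if_cong)

lemma diag_pow: "diag N l ^\<^sub>m m = diag N (\<lambda>i. l i ^ m)"
proof (induction m)
  case 0
  show ?case by (rule eq_matI) (auto simp: diag_def)
qed (simp add: diag_mult mult.commute)

lemma diag_const: "diag N (\<lambda>i. c) = c \<cdot>\<^sub>m 1\<^sub>m N"
  by (rule eq_matI) (auto simp: diag_def)

lemma diag_cong: "(\<And>i. i < N \<Longrightarrow> k i = l i) \<Longrightarrow> diag N k = diag N l"
  by (auto simp: diag_def)

lemma diag_mult_vec: "v \<in> carrier_vec N \<Longrightarrow> i < N \<Longrightarrow> (diag N l *\<^sub>v v) $ i = l i * v $ i"
  by (auto simp: diag_def scalar_prod_def if_distrib[where f = "\<lambda>x. x * _"] cong: if_cong)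

lemma diag_in_GL:
  assumes "\<And>i. i < N \<Longrightarrow> l i \<noteq> 0" shows "diag N l \<in> carrier (GL N)"
proof -
  have "diag N l * diag N (\<lambda>i. inverse (l i)) = 1\<^sub>m N" "diag N (\<lambda>i. inverse (l i)) * diag N l = 1\<^sub>m N"
    using assms diag_const[of N 1] by (simp_all add: diag_mult one_smult_one cong: diag_cong)
  then have "invertible_mat (diag N l)"
    unfolding invertible_mat_def inverts_mat_def by (intro conjI exI[of _ "diag N (\<lambda>i. inverse (l i))"]) auto
  then show ?thesis by (simp add: carrier_GL)
qed

lemma proj_class_eq_coset:
  assumes "A \<in> carrier (GL N)" shows "proj_class A = scalars N #>\<^bsub>GL N\<^esub> A"
proof -
  have "(c \<cdot>\<^sub>m 1\<^sub>m N) \<otimes>\<^bsub>GL N\<^esub> A = c \<cdot>\<^sub>m A" for c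
    using assms by (simp add: mult_GL scalar_mult carrier_GL)
  then show ?thesis
    unfolding r_coset_def scalars_def by (auto; metis)
qed

lemma pow_GL: "A \<in> carrier (GL N) \<Longrightarrow> A [^]\<^bsub>GL N\<^esub> (m::nat) = A ^\<^sub>m m"
  by (induction m) (auto simp: nat_pow_def one_GL mult_GL carrier_GL)

lemma ord_PGL_dvd_iff:
  assumes A: "A \<in> carrier (GL N)"
  shows "group.ord (PGL N) (proj_class A) dvd m \<longleftrightarrow> A ^\<^sub>m m \<in> scalars N"
proof -
  interpret GL: group "GL N" by (rule group_GL)
  interpret S: normal "scalars N" "GL N" by (rule normal_scalars)
  interpret group "PGL N" by (rule group_PGL)
  have "proj_class A \<in> carrier (PGL N)" using A by (auto simp: carrier_PGL)
  then have "ord (proj_class A) dvd m \<longleftrightarrow> proj_class A [^]\<^bsub>PGL N\<^esub> m = \<one>\<^bsub>PGL N\<^esub>"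
    by (simp add: pow_eq_id)
  also have "\<dots> \<longleftrightarrow> scalars N #>\<^bsub>GL N\<^esub> (A [^]\<^bsub>GL N\<^esub> m) = scalars N"
    using S.FactGroup_pow[OF A, of m] by (simp add: PGL_def proj_class_eq_coset[OF A])
  also have "\<dots> \<longleftrightarrow> A [^]\<^bsub>GL N\<^esub> m \<in> scalars N"
    using A GL.rcos_self[OF _ S.subgroup_axioms] S.rcos_const[OF group_GL]
      GL.nat_pow_closed[OF A] by metis
  finally show ?thesis by (simp add: pow_GL[OF A])
qed

lemma ord_diag_dvd_iff:
  assumes "\<And>i. i < N \<Longrightarrow> l i \<noteq> 0" "N > 0"
  shows "group.ord (PGL N) (proj_class (diag N l)) dvd m \<longleftrightarrow> (\<exists>c. \<forall>i<N. l i ^ m = c)"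
proof -
  have "diag N l ^\<^sub>m m \<in> scalars N \<longleftrightarrow> (\<exists>c. \<forall>i<N. l i ^ m = c)"
  proof
    assume "diag N l ^\<^sub>m m \<in> scalars N"
    then obtain c where "diag N (\<lambda>i. l i ^ m) = diag N (\<lambda>i. c)"
      by (auto simp: scalars_def diag_pow simp flip: diag_const)
    then have "diag N (\<lambda>i. l i ^ m) $$ (i, i) = diag N (\<lambda>i. c) $$ (i, i)" for i by simp
    then have "\<forall>i<N. l i ^ m = c" by (metis diag_index)
    then show "\<exists>c. \<forall>i<N. l i ^ m = c" by blast
  next
    assume "\<exists>c. \<forall>i<N. l i ^ m = c"
    then obtain c where c: "\<And>i. i < N \<Longrightarrow> l i ^ m = c" by blast
    then have "diag N l ^\<^sub>m m = c \<cdot>\<^sub>m 1\<^sub>m N"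
      by (auto simp: diag_pow simp flip: diag_const intro!: diag_cong)
    moreover have "c \<noteq> 0" using c[of 0] assms by auto
    ultimately show "diag N l ^\<^sub>m m \<in> scalars N" by (auto simp: scalars_def)
  qed
  then show ?thesis using ord_PGL_dvd_iff[OF diag_in_GL] assms(1) by blast
qed

text \<open>
Used for the Jordan blocks of a matrix with a scalar power.
\<close>

lemma blocks_of_scalar_mat:
  fixes c :: complex
  assumes "diag_block_mat Bs = c \<cdot>\<^sub>m 1\<^sub>m N" "B \<in> set Bs" "\<And>B. B \<in> set Bs \<Longrightarrow> square_mat B"
  shows "B = c \<cdot>\<^sub>m 1\<^sub>m (dim_row B)"
  using assms
proof (induction Bs arbitrary: N)
  case (Cons C Cs)
  let ?D = "diag_block_mat Cs"
  have sq: "dim_row C = dim_col C" "dim_row ?D = dim_col ?D"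
    using Cons.prems(3) diag_block_mat_square[of Cs] by auto
  have eq: "diag_block_mat (C # Cs) = four_block_mat C (0\<^sub>m (dim_row C) (dim_col ?D)) (0\<^sub>m (dim_row ?D) (dim_col C)) ?D"
    by (simp add: Let_def)
  have N: "N = dim_row C + dim_row ?D"
    using arg_cong[OF Cons.prems(1), of dim_row] by (simp add: Let_def)
  have ent: "diag_block_mat (C # Cs) $$ (i, j) = (if i = j then c else 0)" if "i < N" "j < N" for i j
    using that unfolding Cons.prems(1) by simp
  have "C = c \<cdot>\<^sub>m 1\<^sub>m (dim_row C)"
  proof (rule eq_matI)
    fix i j assume "i < dim_row (c \<cdot>\<^sub>m 1\<^sub>m (dim_row C))" "j < dim_col (c \<cdot>\<^sub>m 1\<^sub>m (dim_row C))"
    then show "C $$ (i, j) = (c \<cdot>\<^sub>m 1\<^sub>m (dim_row C)) $$ (i, j)"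
      using ent[of i j] sq N unfolding eq by simp
  qed (use sq in auto)
  moreover have "?D = c \<cdot>\<^sub>m 1\<^sub>m (dim_row ?D)"
  proof (rule eq_matI)
    fix i j assume "i < dim_row (c \<cdot>\<^sub>m 1\<^sub>m (dim_row ?D))" "j < dim_col (c \<cdot>\<^sub>m 1\<^sub>m (dim_row ?D))"
    then show "?D $$ (i, j) = (c \<cdot>\<^sub>m 1\<^sub>m (dim_row ?D)) $$ (i, j)"
      using ent[of "i + dim_row C" "j + dim_row C"] sq N unfolding eq by simp
  qed (use sq in auto)
  ultimately show ?case using Cons.IH Cons.prems by auto
qed simp

lemma diagonal_diag_block_mat:
  assumes "\<And>B. B \<in> set Bs \<Longrightarrow> square_mat B \<and> diagonal_mat B"
  shows "diagonal_mat (diag_block_mat Bs)"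
  using assms
proof (induction Bs)
  case (Cons C Cs)
  let ?D = "diag_block_mat Cs"
  have sq: "dim_row C = dim_col C" "dim_row ?D = dim_col ?D"
    using Cons.prems diag_block_mat_square[of Cs] by auto
  have "diagonal_mat ?D" "diagonal_mat C" using Cons by auto
  then show ?case using sq
    by (auto simp: diagonal_mat_def Let_def)
qed (simp add: diagonal_mat_def)

text \<open>
A Jordan block of size at least \<open>2\<close> with eigenvalue \<open>a \<noteq> 0\<close> has the entry \<open>n a\<^sup>n\<^sup>-\<^sup>1 \<noteq> 0\<close> above the diagonal of its
\<open>n\<close>-th power, so a matrix with a nonzero scalar power has only blocks of size \<open>1\<close>.
\<close>

lemma root_of_scalar_diagonalizable:
  fixes A :: "complex mat"
  assumes A: "A \<in> carrier_mat N N" and n: "n > 0" and c: "c \<noteq> 0" and pow: "A ^\<^sub>m n = c \<cdot>\<^sub>m 1\<^sub>m N"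
  obtains P Q l where "P \<in> carrier_mat N N" "Q \<in> carrier_mat N N" "P * Q = 1\<^sub>m N" "Q * P = 1\<^sub>m N"
    "A = P * diag N l * Q"
proof -
  obtain as where "char_poly A = (\<Prod>a\<leftarrow>as. [:- a, 1:])" using char_poly_factorized[OF A] by blast
  from jordan_nf_exists[OF A this] obtain n_as where nf: "jordan_nf A n_as" by blast
  define J where "J = jordan_matrix n_as"
  from nf have 0: "0 \<notin> fst ` set n_as" and "similar_mat A J" by (auto simp: jordan_nf_def J_def)
  then obtain P Q where "similar_mat_wit A J P Q" by (auto simp: similar_mat_def)
  then have PQ: "P \<in> carrier_mat N N" "Q \<in> carrier_mat N N" "P * Q = 1\<^sub>m N" "Q * P = 1\<^sub>m N"
    "A = P * J * Q" "J \<in> carrier_mat N N" and wit': "similar_mat_wit J A Q P"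
    using A similar_mat_wit_sym by (auto simp: similar_mat_wit_def Let_def)
  have "J ^\<^sub>m n = Q * (c \<cdot>\<^sub>m 1\<^sub>m N) * P"
    using similar_mat_wit_pow_id[OF wit', of n] by (simp add: pow)
  also have "\<dots> = c \<cdot>\<^sub>m 1\<^sub>m N"
    using PQ by (metis mult_smult_assoc_mat scalar_mult(2))
  finally have Jn: "J ^\<^sub>m n = c \<cdot>\<^sub>m 1\<^sub>m N" .
  define Bs where "Bs = map (\<lambda>(k, a). jordan_block k a ^\<^sub>m n) n_as"
  have Bs: "diag_block_mat Bs = c \<cdot>\<^sub>m 1\<^sub>m N"
    using Jn by (simp add: J_def jordan_matrix_pow Bs_def)
  have sqB: "square_mat B" if "B \<in> set Bs" for B using that by (auto simp: Bs_def)
  have size1: "k = 1" if ka: "(k, a) \<in> set n_as" for k a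
  proof (rule ccontr)
    assume "k \<noteq> 1"
    moreover have "k \<noteq> 0" using 0 ka by force
    ultimately have k: "1 < k" by simp
    have B: "jordan_block k a ^\<^sub>m n \<in> set Bs" using ka by (force simp: Bs_def)
    have "jordan_block k a ^\<^sub>m n = c \<cdot>\<^sub>m 1\<^sub>m k"
      using blocks_of_scalar_mat[OF Bs B sqB] by simp
    then have ent: "(jordan_block k a ^\<^sub>m n) $$ (i, j) = (c \<cdot>\<^sub>m 1\<^sub>m k) $$ (i, j)" for i j by simp
    have "of_nat n * a ^ (n - 1) = 0" using ent[of 0 1] k n by (simp add: jordan_block_pow)
    moreover have "a ^ n = c" using ent[of 0 0] k by (simp add: jordan_block_pow)
    ultimately show False using n c by (auto simp: power_0_left)
  qed
  have "diagonal_mat J"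
    unfolding J_def jordan_matrix_def
    by (rule diagonal_diag_block_mat) (auto simp: diagonal_mat_def dest!: size1)
  then have "J = diag N (\<lambda>i. J $$ (i, i))"
    using PQ(6) by (intro eq_matI) (auto simp: diag_def diagonal_mat_def)
  then show ?thesis using that PQ by metis
qed

section \<open>Weight relations between eigenvalues\<close>

lemma dir_deriv_cong:
  assumes "homogeneous N d F" "\<And>i. i < N \<Longrightarrow> x i = x' i" "\<And>i. i < N \<Longrightarrow> y i = y' i"
  shows "dir_deriv N F x y = dir_deriv N F x' y'"
  unfolding dir_deriv_def
  using assms(2,3) eval_at_cong[OF homogeneousD(1)[OF homogeneous_partial_deriv[OF assms(1)]], of x x']
  by (intro sum.cong refl) simp

lemma dir_deriv_scale:
  assumes "homogeneous N d F"
  shows "dir_deriv N F (\<lambda>i. a * x i) (\<lambda>i. b * y i) = a ^ (d - 1) * b * dir_deriv N F x y"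
  unfolding dir_deriv_def eval_at_scale[OF homogeneous_partial_deriv[OF assms]]
  by (simp add: sum_distrib_left algebra_simps)

text \<open>
Differentiate \<open>F (L (x + t y)) = \<mu> F (x + t y)\<close> at \<open>t = 0\<close>.
\<close>

lemma dir_deriv_semi_invariant:
  assumes hom: "homogeneous N d F" and L: "L = (\<lambda>x i. \<Sum>j<N. a i j * x j)"
    and semi: "\<And>x. ev F (L x) = \<mu> * ev F x"
  shows "dir_deriv N F (L x) (L y) = \<mu> * dir_deriv N F x y"
proof -
  let ?p = "eval_at (\<lambda>c. [:c:]) F (\<lambda>i. [:L x i, L y i:])"
  let ?q = "eval_at (\<lambda>c. [:c:]) F (\<lambda>i. [:x i, y i:])"
  have "poly ?p = poly (smult \<mu> ?q)"
  proof
    fix t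
    have "(\<lambda>i. L x i + t * L y i) = L (\<lambda>i. x i + t * y i)"
      by (simp add: L sum.distrib sum_distrib_left algebra_simps)
    then show "poly ?p t = poly (smult \<mu> ?q) t" by (simp add: eval_line semi)
  qed
  then have "poly (pderiv ?p) 0 = poly (pderiv (smult \<mu> ?q)) 0" by (simp add: poly_eq_poly_eq_iff)
  then show ?thesis by (simp add: pderiv_smult pderiv_eval_line[OF homogeneousD(1)[OF hom]])
qed

text \<open>
The derivative in the direction \<open>w\<close> at the points \<open>x + t y\<close>, as a polynomial in \<open>t\<close>. It represents a binary form of
degree \<open>d - 1\<close> on the plane of \<open>x\<close> and \<open>y\<close>; its coefficient at \<open>t\<^sup>d\<^sup>-\<^sup>1\<close> is the value of that form at \<open>y\<close>, the point
that the parametrization misses.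
\<close>

definition dir_deriv_line :: "nat \<Rightarrow> cpoly \<Rightarrow> (nat \<Rightarrow> complex) \<Rightarrow> (nat \<Rightarrow> complex) \<Rightarrow> (nat \<Rightarrow> complex) \<Rightarrow> complex poly" where
  "dir_deriv_line N F x y w = (\<Sum>i<N. smult (w i) (eval_at (\<lambda>c. [:c:]) (partial_deriv i F) (\<lambda>i. [:x i, y i:])))"

lemma dir_deriv_line:
  assumes "homogeneous N d F"
  shows "poly (dir_deriv_line N F x y w) t = dir_deriv N F (\<lambda>i. x i + t * y i) w"
    "degree (dir_deriv_line N F x y w) \<le> d - 1"
    "coeff (dir_deriv_line N F x y w) (d - 1) = dir_deriv N F y w"
proof -
  note top = eval_at_line_top[OF homogeneous_partial_deriv[OF assms]]
  show "poly (dir_deriv_line N F x y w) t = dir_deriv N F (\<lambda>i. x i + t * y i) w"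
    by (simp add: dir_deriv_line_def dir_deriv_def poly_sum eval_line mult.commute)
  show "degree (dir_deriv_line N F x y w) \<le> d - 1"
    unfolding dir_deriv_line_def
    by (intro degree_sum_le finite_lessThan order_trans[OF degree_smult_le top(1)])
  show "coeff (dir_deriv_line N F x y w) (d - 1) = dir_deriv N F y w"
    unfolding dir_deriv_line_def dir_deriv_def coeff_sum coeff_smult top(2) by (simp add: mult.commute)
qed

text \<open>
The vectors \<open>v k\<close> form a basis of eigenvectors of \<open>L\<close>. That they are linearly independent is expressed by the dual basis \<open>w\<close>,
and that they span by the fact that only the zero functional vanishes on all of them.
\<close>

context
  fixes N d :: nat and F :: cpoly and L :: "(nat \<Rightarrow> complex) \<Rightarrow> nat \<Rightarrow> complex"
    and a v w :: "nat \<Rightarrow> nat \<Rightarrow> complex" and l :: "nat \<Rightarrow> complex" and \<mu> :: complex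
  assumes hom: "homogeneous N d F" and d: "d \<ge> 2" and sm: "nonsingular N F"
    and L: "L = (\<lambda>x i. \<Sum>j<N. a i j * x j)"
    and semi: "\<And>x. ev F (L x) = \<mu> * ev F x"
    and eig: "\<And>k i. k < N \<Longrightarrow> i < N \<Longrightarrow> L (v k) i = l k * v k i"
    and l0: "\<And>k. k < N \<Longrightarrow> l k \<noteq> 0"
    and dual: "\<And>j k. j < N \<Longrightarrow> k < N \<Longrightarrow> (\<Sum>i<N. w j i * v k i) = (if j = k then 1 else 0)"
    and span: "\<And>g. (\<And>k. k < N \<Longrightarrow> (\<Sum>i<N. g i * v k i) = 0) \<Longrightarrow> \<forall>i<N. g i = 0"
begin

lemma some_dir_deriv_nonzero:
  assumes "\<exists>i<N. x i \<noteq> 0" shows "\<exists>k<N. dir_deriv N F x (v k) \<noteq> 0"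
proof (rule ccontr)
  assume "\<not> ?thesis"
  then have "\<forall>i<N. ev (partial_deriv i F) x = 0"
    by (intro span) (auto simp: dir_deriv_def)
  then show False using sm assms unfolding nonsingular_def by blast
qed

lemma eigenvector_nonzero:
  assumes "k < N" shows "\<exists>i<N. v k i \<noteq> 0"
proof (rule ccontr)
  assume "\<not> ?thesis"
  then have "(\<Sum>i<N. w k i * v k i) = 0" by simp
  then show False using dual[of k k] assms by simp
qed

text \<open>
In the eigenbasis this says that the monomial \<open>x\<^sub>i\<^sup>d\<^sup>-\<^sup>1 x\<^sub>j\<close> occurs in \<open>F\<close> for some \<open>j\<close>: otherwise all partial
derivatives would vanish at the \<open>i\<close>-th basis vector.
\<close>

lemma eigenvalue_relation:
  assumes i: "i < N" shows "\<exists>j<N. l i ^ (d - 1) * l j = \<mu>"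
proof -
  obtain j where j: "j < N" "dir_deriv N F (v i) (v j) \<noteq> 0"
    using some_dir_deriv_nonzero eigenvector_nonzero[OF i] by blast
  have "l i ^ (d - 1) * l j * dir_deriv N F (v i) (v j) = dir_deriv N F (\<lambda>m. l i * v i m) (\<lambda>m. l j * v j m)"
    by (simp only: dir_deriv_scale[OF hom])
  also have "\<dots> = dir_deriv N F (L (v i)) (L (v j))"
    using i j by (intro dir_deriv_cong[OF hom] eig[symmetric])
  also have "\<dots> = \<mu> * dir_deriv N F (v i) (v j)"
    by (rule dir_deriv_semi_invariant[OF hom L semi])
  finally have "l i ^ (d - 1) * l j * dir_deriv N F (v i) (v j) = \<mu> * dir_deriv N F (v i) (v j)" .
  then show ?thesis using j by (metis mult_right_cancel)
qed

text \<open>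
In the eigenbasis, consider the partial derivatives of \<open>F\<close> on the plane of the basis vectors \<open>i\<close> and \<open>i'\<close>. If only the
\<open>j\<close>-th were nonzero there, it would still have a zero on the plane, being a binary form of positive degree, and that
zero would be a singular point. So another derivative is nonzero, and a monomial
\<open>x\<^sub>i\<^sup>\<alpha> x\<^sub>i\<^sub>'\<^sup>\<beta> x\<^sub>k\<close> with \<open>k \<noteq> j\<close> occurs.
\<close>

lemma eigenvalue_pair_relation:
  assumes i: "i < N" "i' < N" "i \<noteq> i'"
  shows "\<exists>k<N. k \<noteq> j \<and> (\<exists>\<alpha> \<beta>. \<alpha> + \<beta> = d - 1 \<and> l i ^ \<alpha> * l i' ^ \<beta> * l k = \<mu>)"
proof -
  define B where "B k = dir_deriv_line N F (v i') (v i) (v k)" for k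
  note B = dir_deriv_line[OF hom, of "v i'" "v i" "v _", folded B_def]
  have "\<exists>k<N. k \<noteq> j \<and> B k \<noteq> 0"
  proof (rule ccontr)
    assume no: "\<not> ?thesis"
    have B0: "B k = 0" if "k < N" "k \<noteq> j" for k using no that by blast
    show False
    proof (cases "degree (B j) > 0")
      case True
      then obtain t where t: "poly (B j) t = 0" by (rule root_of_positive_degree)
      then have "poly (B k) t = 0" if "k < N" for k
        using B0[OF that] by (cases "k = j") simp_all
      then have "dir_deriv N F (\<lambda>m. v i' m + t * v i m) (v k) = 0" if "k < N" for k
        using that \<open>\<And>k. k < N \<Longrightarrow> poly (B k) t = 0\<close> by (simp flip: B(1))
      moreover have "\<exists>m<N. v i' m + t * v i m \<noteq> 0"
      proof (rule ccontr)
        assume "\<not> ?thesis"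
        then have "(\<Sum>m<N. w i' m * (v i' m + t * v i m)) = 0" by simp
        moreover have "(\<Sum>m<N. w i' m * (v i' m + t * v i m))
            = (\<Sum>m<N. w i' m * v i' m) + t * (\<Sum>m<N. w i' m * v i m)"
          by (simp add: sum.distrib sum_distrib_left algebra_simps)
        ultimately show False using dual[of i' i'] dual[of i' i] i by simp
      qed
      ultimately show False using some_dir_deriv_nonzero[of "\<lambda>m. v i' m + t * v i m"] by auto
    next
      case False
      then have "coeff (B j) (d - 1) = 0" using d by (intro coeff_eq_0) simp
      then have "coeff (B k) (d - 1) = 0" if "k < N" for k
        using B0[OF that] by (cases "k = j") simp_all
      then have "dir_deriv N F (v i) (v k) = 0" if "k < N" for k
        using that by (simp only: B(3))
      then show False using some_dir_deriv_nonzero[OF eigenvector_nonzero[OF i(1)]] by auto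
    qed
  qed
  then obtain k where k: "k < N" "k \<noteq> j" "B k \<noteq> 0" by blast
  \<comment> \<open>any exponent with a nonzero coefficient of \<open>B k\<close> would do\<close>
  define \<alpha> where "\<alpha> = degree (B k)"
  define r where "r = l i / l i'"
  have c: "coeff (B k) \<alpha> \<noteq> 0" using k(3) by (simp add: \<alpha>_def)
  have \<alpha>: "\<alpha> \<le> d - 1" unfolding \<alpha>_def by (rule B(2))
  have "poly (smult (l i' ^ (d - 1) * l k) (pcompose (B k) [:0, r:])) = poly (smult \<mu> (B k))"
  proof
    fix t
    have "\<mu> * poly (B k) t = dir_deriv N F (L (\<lambda>m. v i' m + t * v i m)) (L (v k))"
      unfolding dir_deriv_semi_invariant[OF hom L semi] B(1) ..
    also have "\<dots> = dir_deriv N F (\<lambda>m. l i' * (v i' m + (r * t) * v i m)) (\<lambda>m. l k * v k m)"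
    proof (intro dir_deriv_cong[OF hom])
      fix m assume m: "m < N"
      have "L (\<lambda>m. v i' m + t * v i m) m = L (v i') m + t * L (v i) m"
        by (simp add: L sum.distrib sum_distrib_left algebra_simps)
      also have "\<dots> = l i' * v i' m + t * (l i * v i m)" by (simp only: eig[OF i(1) m] eig[OF i(2) m])
      also have "\<dots> = l i' * (v i' m + (r * t) * v i m)" using l0[OF i(2)]
        by (simp add: r_def distrib_left)
      finally show "L (\<lambda>m. v i' m + t * v i m) m = l i' * (v i' m + (r * t) * v i m)" .
    qed (use eig k in auto)
    also have "\<dots> = l i' ^ (d - 1) * l k * poly (B k) (r * t)"
      unfolding dir_deriv_scale[OF hom] B(1) ..
    finally show "poly (smult (l i' ^ (d - 1) * l k) (pcompose (B k) [:0, r:])) t = poly (smult \<mu> (B k)) t"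
      by (simp add: poly_pcompose mult.commute)
  qed
  then have "coeff (smult (l i' ^ (d - 1) * l k) (pcompose (B k) [:0, r:])) \<alpha> = coeff (smult \<mu> (B k)) \<alpha>"
    by (simp only: poly_eq_poly_eq_iff)
  then have "l i' ^ (d - 1) * l k * r ^ \<alpha> = \<mu>"
    using c by (simp add: coeff_pcompose_linear mult.assoc)
  moreover have "l i' ^ (d - 1) * r ^ \<alpha> = l i ^ \<alpha> * l i' ^ (d - 1 - \<alpha>)"
  proof -
    have "l i' ^ (d - 1) = l i' ^ \<alpha> * l i' ^ (d - 1 - \<alpha>)" using \<alpha> by (metis le_add_diff_inverse power_add)
    then show ?thesis using l0[OF i(2)] by (simp add: r_def power_divide)
  qed
  ultimately have "l i ^ \<alpha> * l i' ^ (d - 1 - \<alpha>) * l k = \<mu>" by (simp add: mult_ac)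
  moreover have "\<alpha> + (d - 1 - \<alpha>) = d - 1" using \<alpha> by simp
  ultimately show ?thesis using k(1,2) by blast
qed

end

lemma peval_eq_ev: "peval F v = ev F (\<lambda>i. v $ i)"
  by (simp add: peval_def eval_at_def monomial_at_def)

lemma ev_eq_peval:
  assumes "pvars F \<subseteq> {..<N}" shows "ev F x = peval F (vec N x)"
  unfolding peval_eq_ev by (rule eval_at_cong[OF assms]) simp

lemma smooth_imp_nonsingular:
  assumes hom: "homogeneous N d F" and "smooth N F" shows "nonsingular N F"
  unfolding nonsingular_def
proof (intro allI impI)
  fix x i assume z: "\<forall>i<N. ev (partial_deriv i F) x = 0" and i: "i < N"
  have "vec N x \<in> {v \<in> carrier_vec N. \<forall>i<N. peval (partial_deriv i F) v = 0}"
    using z by (simp add: ev_eq_peval[OF homogeneousD(1)[OF homogeneous_partial_deriv[OF hom]]])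
  then have "vec N x = 0\<^sub>v N" using assms(2) unfolding smooth_def by blast
  then have "vec N x $ i = 0\<^sub>v N $ i" by simp
  then show "x i = 0" using i by simp
qed

text \<open>
Translates the action on points of projective space back to vectors.
\<close>

lemma linear_automorphism_eval_zero:
  assumes hom: "homogeneous N d F" "d > 0" and A: "A \<in> carrier (GL N)"
    and aut: "linear_automorphism N F (proj_class A)"
    and v: "v \<in> carrier_vec N" "peval F v = 0"
  shows "peval F (A *\<^sub>v v) = 0"
proof -
  obtain B where B: "B * A = 1\<^sub>m N" "B \<in> carrier_mat N N" "A \<in> carrier_mat N N"
    using A unfolding GL_def units_of_def Units_def ring_mat_def by auto
  show ?thesis
  proof (cases "A *\<^sub>v v = 0\<^sub>v N")
    case True
    have "v = (B * A) *\<^sub>v v" unfolding B(1) using v by simp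
    also have "\<dots> = B *\<^sub>v (A *\<^sub>v v)" by (rule assoc_mult_mat_vec[OF B(2,3) v(1)])
    finally have "v = A *\<^sub>v v" using B(2) unfolding True by (auto intro!: eq_vecI)
    then show ?thesis using v by simp
  next
    case False
    then have "v \<noteq> 0\<^sub>v N" using B by auto
    then have "proj_point v \<in> hypersurface N F"
      using proj_point_in_hypersurface[OF hom(1)] v by blast
    then have "proj_action (proj_class A) (proj_point v) \<in> hypersurface N F"
      using aut unfolding linear_automorphism_def by blast
    then have "proj_point (A *\<^sub>v v) \<in> hypersurface N F"
      by (simp add: proj_action_point[OF B(3) v(1)])
    then show ?thesis
      using proj_point_in_hypersurface[OF hom(1) _ False] B(3) v by auto
  qed
qed

text \<open>
All that the rest of the proof needs to know about the automorphism. The eigenvalues are those of \<open>s A\<close>, where the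
scalar \<open>s\<close> is chosen so that \<open>F\<close> becomes invariant and not only semi-invariant.
\<close>

theorem eigenvalues_of_linear_automorphism:
  assumes d: "d \<ge> 2" and N: "N > 0" and hom: "homogeneous N d F" and sm: "smooth N F"
    and ord: "order_of_linear_automorphism N F n"
  obtains l where "\<And>i. i < N \<Longrightarrow> l i \<noteq> (0::complex)"
    "\<And>i. i < N \<Longrightarrow> \<exists>j<N. l i ^ (d - 1) * l j = 1"
    "\<And>i i' j. i < N \<Longrightarrow> i' < N \<Longrightarrow> i \<noteq> i' \<Longrightarrow>
       \<exists>k<N. k \<noteq> j \<and> (\<exists>\<alpha> \<beta>. \<alpha> + \<beta> = d - 1 \<and> l i ^ \<alpha> * l i' ^ \<beta> * l k = 1)"
    "\<And>m c. (\<And>i. i < N \<Longrightarrow> l i ^ m = c) \<Longrightarrow> n dvd m"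
proof -
  obtain g where n: "n > 0" and aut: "linear_automorphism N F g" and n_eq: "group.ord (PGL N) g = n"
    using ord unfolding order_of_linear_automorphism_def by blast
  then obtain A where A: "A \<in> carrier (GL N)" and g: "g = proj_class A"
    unfolding linear_automorphism_def carrier_PGL by blast
  have A': "A \<in> carrier_mat N N" using A by (simp add: carrier_GL)
  have "A ^\<^sub>m n \<in> scalars N" using ord_PGL_dvd_iff[OF A, of n] n_eq g by simp
  then obtain c where c: "c \<noteq> 0" "A ^\<^sub>m n = c \<cdot>\<^sub>m 1\<^sub>m N" by (auto simp: scalars_def)
  obtain P Q l where PQ: "P \<in> carrier_mat N N" "Q \<in> carrier_mat N N" "P * Q = 1\<^sub>m N" "Q * P = 1\<^sub>m N"
    and APQ: "A = P * diag N l * Q"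
    by (rule root_of_scalar_diagonalizable[OF A' n c])
  have wit: "similar_mat_wit A (diag N l) P Q"
    using PQ A' APQ by (auto simp: similar_mat_wit_def Let_def)
  have AP: "A * P = P * diag N l"
  proof -
    have "A * P = P * diag N l * (Q * P)"
      unfolding APQ using PQ(1,2) by (intro assoc_mult_mat) auto
    then show ?thesis using PQ by simp
  qed
  have l0: "l k \<noteq> 0" if k: "k < N" for k
  proof
    assume l: "l k = 0"
    have "diag N l ^\<^sub>m n = Q * (A ^\<^sub>m n * P)"
      using similar_mat_wit_pow_id[OF similar_mat_wit_sym[OF wit], of n] PQ A'
      by (simp add: assoc_mult_mat[of _ N N _ N _ N])
    also have "\<dots> = c \<cdot>\<^sub>m 1\<^sub>m N"
      unfolding c(2) using PQ by (simp add: scalar_mult mult_smult_distrib[of _ N N])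
    finally have "diag N (\<lambda>i. l i ^ n) $$ (k, k) = (c \<cdot>\<^sub>m 1\<^sub>m N) $$ (k, k)" by (simp add: diag_pow)
    then show False using k l n c(1) by (simp add: diag_index power_0_left)
  qed

  define L where "L = (\<lambda>x i. \<Sum>j<N. A $$ (i, j) * (x j :: complex))"
  define v where "v k i = P $$ (i, k)" for k i
  define w where "w k i = Q $$ (k, i)" for k i
  have d0: "d > 0" using d by simp
  note ns = smooth_imp_nonsingular[OF hom sm]
  have evL: "ev F (L x) = peval F (A *\<^sub>v vec N x)" for x
    unfolding peval_eq_ev using A'
    by (intro eval_at_cong[OF homogeneousD(1)[OF hom]])
       (auto simp: L_def scalar_prod_def lessThan_atLeast0)
  have pres: "ev F (L x) = 0" if "ev F x = 0" for x
    unfolding evL using linear_automorphism_eval_zero[OF hom d0 A aut[unfolded g], of "vec N x"] that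
    by (simp add: ev_eq_peval[OF homogeneousD(1)[OF hom]])
  have dual: "(\<Sum>i<N. w j i * v k i) = (if j = k then 1 else 0)" if "j < N" "k < N" for j k
  proof -
    have "(\<Sum>i<N. w j i * v k i) = (Q * P) $$ (j, k)"
      using that PQ(1,2) by (simp add: w_def v_def scalar_prod_def lessThan_atLeast0)
    then show ?thesis using that PQ(4) by simp
  qed
  have dual': "(\<Sum>k<N. v k i * w k j) = (if i = j then 1 else 0)" if "j < N" "i < N" for i j
  proof -
    have "(\<Sum>k<N. v k i * w k j) = (P * Q) $$ (i, j)"
      using that PQ(1,2) by (simp add: w_def v_def scalar_prod_def lessThan_atLeast0)
    then show ?thesis using that PQ(3) by simp
  qed
  have span: "\<forall>j<N. g j = 0" if "\<And>k. k < N \<Longrightarrow> (\<Sum>i<N. g i * v k i) = 0" for g :: "nat \<Rightarrow> complex"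
  proof (intro allI impI)
    fix j assume j: "j < N"
    have "g j = (\<Sum>i<N. g i * (if i = j then 1 else 0))"
      using j by (simp add: if_distrib[where f = "\<lambda>x. _ * x"] cong: if_cong)
    also have "\<dots> = (\<Sum>i<N. g i * (\<Sum>k<N. v k i * w k j))" using j dual' by (intro sum.cong) auto
    also have "\<dots> = (\<Sum>k<N. (\<Sum>i<N. g i * v k i) * w k j)"
      by (simp add: sum_distrib_left sum_distrib_right mult.assoc) (rule sum.swap)
    finally show "g j = 0" using that by simp
  qed
  have eig: "L (v k) i = l k * v k i" if "k < N" "i < N" for k i
  proof -
    have "L (v k) i = (A * P) $$ (i, k)"
      using that PQ(1) A' by (simp add: L_def v_def scalar_prod_def lessThan_atLeast0)
    also have "\<dots> = l k * v k i"
      unfolding AP using that PQ(1)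
      by (auto simp: diag_def v_def scalar_prod_def if_distrib[where f = "\<lambda>x. _ * x"] cong: if_cong)
    finally show ?thesis .
  qed
  obtain q where q: "ev F q \<noteq> 0"
  proof (rule ccontr)
    assume "\<not> thesis"
    then have z: "ev F x = 0" for x using that by blast
    have "dir_deriv N F (\<lambda>_. 1) y = 0" for y
    proof -
      let ?p = "eval_at (\<lambda>c. [:c:]) F (\<lambda>i. [:1, y i:])"
      have "poly ?p = poly 0" by (auto simp: eval_line z)
      then have "?p = 0" by (simp only: poly_eq_poly_eq_iff)
      then show ?thesis using pderiv_eval_line[OF homogeneousD(1)[OF hom], of "\<lambda>_. 1" y 0] by simp
    qed
    then have D: "dir_deriv N F (\<lambda>_. 1) (\<lambda>k. if k = i then 1 else 0) = 0" for i by blast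
    have "ev (partial_deriv i F) (\<lambda>_. 1) = 0" if "i < N" for i
      using D[of i] that by (simp add: dir_deriv_def if_distrib[where f = "\<lambda>x. _ * x"] cong: if_cong)
    then show False using ns N unfolding nonsingular_def by (metis one_neq_zero)
  qed
  define \<mu> where "\<mu> = ev F (L q) / ev F q"
  have semi: "ev F (L x) = \<mu> * ev F x" for x
    unfolding \<mu>_def by (rule hypersurface_preserved_imp_semi_invariant[OF hom d0 ns q L_def pres])
  have "\<mu> \<noteq> 0"
  proof -
    obtain j where "l 0 ^ (d - 1) * l j = \<mu>" "j < N"
      using eigenvalue_relation[OF hom d ns L_def semi eig l0 dual span N] by blast
    then show ?thesis using l0 N by auto
  qed
  define s where "s = rcis (root d (cmod (inverse \<mu>))) (Arg (inverse \<mu>) / d)"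
  have s: "s ^ d = inverse \<mu>"
    using d0 by (simp add: s_def DeMoivre2 rcis_cmod_Arg)
  then have s0: "s \<noteq> 0" using \<open>\<mu> \<noteq> 0\<close> d0 by (auto simp: power_0_left)
  have s1: "s ^ d * \<mu> = 1" using s \<open>\<mu> \<noteq> 0\<close> by simp
  show ?thesis
  proof (rule that[of "\<lambda>i. s * l i"])
    show "s * l i \<noteq> 0" if "i < N" for i using l0[OF that] s0 by simp
    show "\<exists>j<N. (s * l i) ^ (d - 1) * (s * l j) = 1" if i: "i < N" for i
    proof -
      obtain j where j: "j < N" "l i ^ (d - 1) * l j = \<mu>"
        using eigenvalue_relation[OF hom d ns L_def semi eig l0 dual span i] by blast
      have "(s * l i) ^ (d - 1) * (s * l j) = s ^ (d - 1) * s * (l i ^ (d - 1) * l j)"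
        by (simp add: power_mult_distrib mult_ac)
      also have "s ^ (d - 1) * s = s ^ d" using d0 by (metis power_minus_mult)
      finally have "(s * l i) ^ (d - 1) * (s * l j) = 1" unfolding j(2) s1 .
      then show ?thesis using j(1) by blast
    qed
    show "\<exists>k<N. k \<noteq> j \<and> (\<exists>\<alpha> \<beta>. \<alpha> + \<beta> = d - 1 \<and> (s * l i) ^ \<alpha> * (s * l i') ^ \<beta> * (s * l k) = 1)"
      if i: "i < N" "i' < N" "i \<noteq> i'" for i i' j
    proof -
      obtain k \<alpha> \<beta> where k: "k < N" "k \<noteq> j" "\<alpha> + \<beta> = d - 1" "l i ^ \<alpha> * l i' ^ \<beta> * l k = \<mu>"
        using eigenvalue_pair_relation[OF hom d ns L_def semi eig l0 dual span i] by blast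
      have "(s * l i) ^ \<alpha> * (s * l i') ^ \<beta> * (s * l k) = s ^ (\<alpha> + \<beta>) * s * (l i ^ \<alpha> * l i' ^ \<beta> * l k)"
        by (simp add: power_mult_distrib power_add mult_ac)
      also have "s ^ (\<alpha> + \<beta>) * s = s ^ d" unfolding k(3) using d0 by (metis power_minus_mult)
      finally have "(s * l i) ^ \<alpha> * (s * l i') ^ \<beta> * (s * l k) = 1" unfolding k(4) s1 .
      then show ?thesis using k(1-3) by blast
    qed
    show "n dvd m" if eq: "\<And>i. i < N \<Longrightarrow> (s * l i) ^ m = c'" for m c'
    proof -
      have "l i ^ m = c' / s ^ m" if "i < N" for i
        using eq[OF that] s0 by (simp add: power_mult_distrib field_simps)
      then have D: "diag N l ^\<^sub>m m = (c' / s ^ m) \<cdot>\<^sub>m 1\<^sub>m N"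
        by (auto simp: diag_pow simp flip: diag_const intro!: diag_cong)
      have "A ^\<^sub>m m = P * (diag N l ^\<^sub>m m * Q)"
        using similar_mat_wit_pow_id[OF wit, of m] PQ
        by (simp add: assoc_mult_mat[of _ N N _ N _ N])
      also have "\<dots> = (c' / s ^ m) \<cdot>\<^sub>m 1\<^sub>m N"
        unfolding D using PQ by (simp add: scalar_mult mult_smult_distrib[of _ N N])
      finally have "A ^\<^sub>m m = (c' / s ^ m) \<cdot>\<^sub>m 1\<^sub>m N" .
      moreover have "c' / s ^ m \<noteq> 0" using eq[OF N] l0[OF N] s0 by auto
      ultimately have "A ^\<^sub>m m \<in> scalars N" by (auto simp: scalars_def)
      then show ?thesis using ord_PGL_dvd_iff[OF A] n_eq g by simp
    qed
  qed
qed

section \<open>Self-maps of a finite set\<close>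

definition periodic_points :: "nat \<Rightarrow> (nat \<Rightarrow> nat) \<Rightarrow> nat set" where
  "periodic_points N \<phi> = {x. x < N \<and> (\<exists>k>0. (\<phi> ^^ k) x = x)}"

definition period :: "(nat \<Rightarrow> nat) \<Rightarrow> nat \<Rightarrow> nat" where
  "period \<phi> x = (LEAST k. k > 0 \<and> (\<phi> ^^ k) x = x)"

definition depth :: "nat \<Rightarrow> (nat \<Rightarrow> nat) \<Rightarrow> nat \<Rightarrow> nat" where
  "depth N \<phi> x = (LEAST r. (\<phi> ^^ r) x \<in> periodic_points N \<phi>)"

locale finite_self_map =
  fixes N :: nat and \<phi> :: "nat \<Rightarrow> nat"
  assumes \<phi>: "\<And>x. x < N \<Longrightarrow> \<phi> x < N"
begin

abbreviation (input) "C \<equiv> periodic_points N \<phi>"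
abbreviation (input) "per \<equiv> period \<phi>"
abbreviation (input) "dep \<equiv> depth N \<phi>"

lemma iterate_less: "x < N \<Longrightarrow> (\<phi> ^^ k) x < N"
  by (induction k) (auto simp: \<phi>)

lemma periodic_less: "x \<in> C \<Longrightarrow> x < N"
  by (simp add: periodic_points_def)

lemma finite_periodic: "finite C"
  by (rule finite_subset[of _ "{..<N}"]) (auto dest: periodic_less)

lemma iterate_add: "(\<phi> ^^ m) ((\<phi> ^^ n) x) = (\<phi> ^^ (m + n)) x"
  by (simp add: funpow_add)

lemma iterate_commute: "(\<phi> ^^ m) ((\<phi> ^^ n) x) = (\<phi> ^^ n) ((\<phi> ^^ m) x)"
  by (simp add: iterate_add add.commute)

text \<open>
Two equal iterates can only occur on a cycle; so the iterates before the first periodic one are distinct.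
\<close>

lemma repeat_imp_periodic:
  assumes "x < N" "i < j" "(\<phi> ^^ i) x = (\<phi> ^^ j) x" shows "(\<phi> ^^ i) x \<in> C"
proof -
  have "(\<phi> ^^ (j - i)) ((\<phi> ^^ i) x) = (\<phi> ^^ i) x"
    unfolding iterate_add using assms(2,3) by simp
  then show ?thesis using assms(1,2) iterate_less
    by (auto simp: periodic_points_def intro!: exI[of _ "j - i"])
qed

lemma eventually_periodic:
  assumes "x < N" shows "\<exists>r. (\<phi> ^^ r) x \<in> C"
proof -
  have "finite (range (\<lambda>k. (\<phi> ^^ k) x))"
    by (rule finite_subset[of _ "{..<N}"]) (use iterate_less[OF assms] in auto)
  then have "\<not> inj (\<lambda>k. (\<phi> ^^ k) x)" using range_inj_infinite by blast
  then obtain i j where "i < j" "(\<phi> ^^ i) x = (\<phi> ^^ j) x"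
    unfolding inj_def by (metis linorder_neqE_nat)
  then show ?thesis using repeat_imp_periodic[OF assms] by blast
qed

lemma period:
  assumes "x \<in> C"
  shows "per x > 0" "(\<phi> ^^ per x) x = x" "\<And>k. 0 < k \<Longrightarrow> (\<phi> ^^ k) x = x \<Longrightarrow> per x \<le> k"
proof -
  have "\<exists>k. k > 0 \<and> (\<phi> ^^ k) x = x" using assms by (auto simp: periodic_points_def)
  from LeastI_ex[OF this] show "per x > 0" "(\<phi> ^^ per x) x = x" by (simp_all add: period_def)
  show "per x \<le> k" if "0 < k" "(\<phi> ^^ k) x = x" for k
    unfolding period_def using that by (intro Least_le) auto
qed

lemma iterate_mult_period:
  assumes "x \<in> C" shows "(\<phi> ^^ (m * per x)) x = x"
proof (induction m)
  case (Suc m)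
  have "(\<phi> ^^ (Suc m * per x)) x = (\<phi> ^^ per x) ((\<phi> ^^ (m * per x)) x)"
    by (simp add: iterate_add)
  then show ?case using Suc period(2)[OF assms] by simp
qed simp

lemma iterate_mod_period:
  assumes "x \<in> C" shows "(\<phi> ^^ m) x = (\<phi> ^^ (m mod per x)) x"
proof -
  have "(\<phi> ^^ m) x = (\<phi> ^^ (m mod per x)) ((\<phi> ^^ (m div per x * per x)) x)"
    unfolding iterate_add by (simp add: mod_div_mult_eq)
  then show ?thesis by (simp add: iterate_mult_period[OF assms])
qed

lemma iterate_periodic:
  assumes "x \<in> C" shows "(\<phi> ^^ m) x \<in> C"
proof -
  obtain k where "k > 0" "(\<phi> ^^ k) x = x" "x < N" using assms by (auto simp: periodic_points_def)
  then have "(\<phi> ^^ k) ((\<phi> ^^ m) x) = (\<phi> ^^ m) x" "(\<phi> ^^ m) x < N"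
    by (simp_all only: iterate_commute[of k m] iterate_less)
  then show ?thesis using \<open>k > 0\<close> unfolding periodic_points_def by blast
qed

text \<open>
A periodic point is reached again from each of its iterates.
\<close>

lemma iterate_fixed_iff:
  assumes "x \<in> C" shows "(\<phi> ^^ k) ((\<phi> ^^ m) x) = (\<phi> ^^ m) x \<longleftrightarrow> (\<phi> ^^ k) x = x"
proof
  assume eq: "(\<phi> ^^ k) ((\<phi> ^^ m) x) = (\<phi> ^^ m) x"
  let ?q = "m * per x - m"
  have q: "(\<phi> ^^ ?q) ((\<phi> ^^ m) x) = x"
    using iterate_mult_period[OF assms, of m] period(1)[OF assms] by (simp add: iterate_add)
  have "(\<phi> ^^ k) x = (\<phi> ^^ k) ((\<phi> ^^ ?q) ((\<phi> ^^ m) x))" by (simp only: q)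
  also have "\<dots> = (\<phi> ^^ ?q) ((\<phi> ^^ k) ((\<phi> ^^ m) x))" by (rule iterate_commute)
  finally show "(\<phi> ^^ k) x = x" by (simp only: eq q)
qed (simp add: iterate_commute[of k m])

lemma period_iterate: "x \<in> C \<Longrightarrow> per ((\<phi> ^^ m) x) = per x"
  by (simp add: period_def iterate_fixed_iff)

definition "orbit x = (\<lambda>k. (\<phi> ^^ k) x) ` {..<per x}"

lemma orbit:
  assumes "x \<in> C"
  shows "card (orbit x) = per x" "orbit x \<subseteq> C" "\<And>y. y \<in> orbit x \<Longrightarrow> per y = per x"
proof -
  have "(\<phi> ^^ i) x \<noteq> (\<phi> ^^ j) x" if "i < j" "j < per x" for i j
  proof
    assume "(\<phi> ^^ i) x = (\<phi> ^^ j) x"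
    then have "(\<phi> ^^ (j - i)) ((\<phi> ^^ i) x) = (\<phi> ^^ i) x" 
      unfolding iterate_add using that by simp
    then have "(\<phi> ^^ (j - i)) x = x" by (simp add: iterate_fixed_iff[OF assms])
    then show False using period(3)[OF assms, of "j - i"] that by simp
  qed
  then have "inj_on (\<lambda>k. (\<phi> ^^ k) x) {..<per x}"
    by (intro inj_onI) (metis lessThan_iff linorder_neqE_nat)
  then show "card (orbit x) = per x" by (simp add: orbit_def card_image)
  show "orbit x \<subseteq> C" using iterate_periodic[OF assms] by (auto simp: orbit_def)
  show "per y = per x" if "y \<in> orbit x" for y
    using that period_iterate[OF assms] by (auto simp: orbit_def)
qed

text \<open>
Points of different periods lie on disjoint orbits, so choosing one orbit for each period gives the inequality. In the
case of equality these orbits exhaust the periodic points, so points of equal period lie on one orbit.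
\<close>

lemma sum_periods:
  shows "\<Sum>(per ` C) \<le> card C"
    "\<Sum>(per ` C) = card C \<Longrightarrow> x \<in> C \<Longrightarrow> y \<in> C \<Longrightarrow> per x = per y \<Longrightarrow> \<exists>s<per x. y = (\<phi> ^^ s) x"
proof -
  let ?A = "per ` C"
  define c where "c = inv_into C per"
  have c: "c a \<in> C" "per (c a) = a" if "a \<in> ?A" for a
    using that by (simp_all add: c_def inv_into_into f_inv_into_f)
  have disj: "orbit (c a) \<inter> orbit (c b) = {}" if "a \<in> ?A" "b \<in> ?A" "a \<noteq> b" for a b
    using orbit(3)[OF c(1)[OF that(1)]] orbit(3)[OF c(1)[OF that(2)]] c(2)[OF that(1)] c(2)[OF that(2)] that(3)
    by (metis disjoint_iff)
  have fin: "finite (orbit (c a))" for a by (simp add: orbit_def)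
  have "card (\<Union>a\<in>?A. orbit (c a)) = (\<Sum>a\<in>?A. card (orbit (c a)))"
    using disj fin by (intro card_UN_disjoint finite_imageI finite_periodic ballI impI) blast+
  also have "\<dots> = \<Sum>?A"
    by (intro sum.cong refl) (simp only: orbit(1)[OF c(1)] c(2))
  finally have card_U: "card (\<Union>a\<in>?A. orbit (c a)) = \<Sum>?A" .
  have sub: "(\<Union>a\<in>?A. orbit (c a)) \<subseteq> C" by (intro UN_least orbit(2) c(1))
  show "\<Sum>?A \<le> card C" using card_mono[OF finite_periodic sub] card_U by simp
  show "\<exists>s<per x. y = (\<phi> ^^ s) x"
    if eq: "\<Sum>?A = card C" and x: "x \<in> C" and y: "y \<in> C" and xy: "per x = per y"
  proof -
    have U: "(\<Union>a\<in>?A. orbit (c a)) = C"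
      using card_subset_eq[OF finite_periodic sub] card_U eq by simp
    have in_orb: "z \<in> orbit (c (per z))" if z: "z \<in> C" for z
    proof -
      obtain a where "a \<in> ?A" "z \<in> orbit (c a)" using z U by blast
      then show ?thesis using orbit(3)[OF c(1)] c(2) by metis
    qed
    obtain s t where s: "x = (\<phi> ^^ s) (c (per x))" and t: "y = (\<phi> ^^ t) (c (per x))"
      using in_orb[OF x] in_orb[OF y] unfolding orbit_def xy[symmetric] by blast
    \<comment> \<open>going \<open>t\<close> steps on from \<open>?z\<close> is the same as going back \<open>s\<close> steps modulo the period and then \<open>t\<close> steps on\<close>
    let ?z = "c (per x)" and ?q = "t + (s * per x - s)"
    have z: "?z \<in> C" "per ?z = per x" by (intro c imageI x)+
    have "(\<phi> ^^ ?q) x = (\<phi> ^^ ?q) ((\<phi> ^^ s) ?z)" using s by (rule arg_cong)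
    also have "\<dots> = (\<phi> ^^ (?q + s)) ?z" by (rule iterate_add)
    also have "?q + s = t + s * per x" using mult_le_mono2[of 1 "per x" s] period(1)[OF x] by linarith
    also have "(\<phi> ^^ (t + s * per x)) ?z = (\<phi> ^^ t) ((\<phi> ^^ (s * per ?z)) ?z)"
      unfolding z(2) by (rule iterate_add[symmetric])
    also have "\<dots> = y" unfolding iterate_mult_period[OF z(1)] by (rule t[symmetric])
    finally have "y = (\<phi> ^^ (?q mod per x)) x" using iterate_mod_period[OF x] by simp
    then show ?thesis using period(1)[OF x] by (intro exI[of _ "?q mod per x"]) simp
  qed
qed

lemma depth:
  assumes "x < N"
  shows "(\<phi> ^^ dep x) x \<in> C" "\<And>r. r < dep x \<Longrightarrow> (\<phi> ^^ r) x \<notin> C"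
  using LeastI_ex[OF eventually_periodic[OF assms]] not_less_Least
  by (auto simp: depth_def)

lemma depth_iterate:
  assumes "x < N" "r \<le> dep x" shows "dep ((\<phi> ^^ r) x) = dep x - r"
proof -
  have r: "(\<phi> ^^ r) x < N" using assms(1) by (rule iterate_less)
  have "(\<phi> ^^ (dep x - r)) ((\<phi> ^^ r) x) \<in> C" using depth(1)[OF assms(1)] assms(2) by (simp add: iterate_add)
  then have "dep ((\<phi> ^^ r) x) \<le> dep x - r" using depth(2)[OF r] by (meson not_le)
  moreover have "dep x \<le> dep ((\<phi> ^^ r) x) + r"
    using depth(1)[OF r] depth(2)[OF assms(1)] by (metis iterate_add not_le)
  ultimately show ?thesis by simp
qed

lemma depth_0_iff: "x < N \<Longrightarrow> dep x = 0 \<longleftrightarrow> x \<in> C"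
  using depth[of x] by (metis funpow_0 gr0I)

text \<open>
The iterates of \<open>x\<close> before the first periodic one are \<open>dep x\<close> distinct points that are not periodic. In the case of
equality there are no other points that are not periodic.
\<close>

lemma depth_bound:
  assumes x: "x < N"
  shows "card C + dep x \<le> N"
    "card C + dep x = N \<Longrightarrow> y < N \<Longrightarrow> y \<notin> C \<Longrightarrow> y = (\<phi> ^^ (dep x - dep y)) x \<and> dep y \<le> dep x"
proof -
  let ?P = "(\<lambda>k. (\<phi> ^^ k) x) ` {..<dep x}"
  have ne: "(\<phi> ^^ i) x \<noteq> (\<phi> ^^ j) x" if "i < j" "j < dep x" for i j
    using repeat_imp_periodic[OF x that(1)] depth(2)[OF x, of i] that by auto
  then have "inj_on (\<lambda>k. (\<phi> ^^ k) x) {..<dep x}"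
    by (intro inj_onI) (metis lessThan_iff linorder_neqE_nat)
  then have card: "card ?P = dep x" by (simp add: card_image)
  have dis: "C \<inter> ?P = {}" using depth(2)[OF x] by auto
  have sub: "C \<union> ?P \<subseteq> {..<N}" using periodic_less iterate_less[OF x] by auto
  have card_U: "card (C \<union> ?P) = card C + dep x"
    using card_Un_disjoint[OF finite_periodic _ dis] card by simp
  show "card C + dep x \<le> N" using card_mono[OF _ sub] card_U by simp
  show "y = (\<phi> ^^ (dep x - dep y)) x \<and> dep y \<le> dep x"
    if eq: "card C + dep x = N" and y: "y < N" "y \<notin> C"
  proof -
    have "C \<union> ?P = {..<N}" using card_subset_eq[OF _ sub] card_U eq by simp
    then obtain k where k: "k < dep x" "y = (\<phi> ^^ k) x" using y by blast
    then have "dep y = dep x - k" using depth_iterate[OF x] by simp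
    then show ?thesis using k by simp
  qed
qed

end

section \<open>Weights along a self-map\<close>

lemma power_int_eq_1_iff_power_nat_abs:
  assumes "z \<noteq> (0::complex)"
  shows "z powi e = 1 \<longleftrightarrow> z ^ nat \<bar>e\<bar> = 1"
  using assms by (cases "e \<ge> 0") (auto simp: power_int_def power_inverse)

lemma power_eq_1_dvd: "z ^ a = 1 \<Longrightarrow> a dvd b \<Longrightarrow> z ^ b = (1::complex)"
  by (auto elim!: dvdE simp: power_mult)

text \<open>
Write \<open>1\<close> as an integer combination of \<open>a\<close> and \<open>b\<close>.
\<close>

lemma coprime_powers_eq_1:
  assumes "z ^ a = (1::complex)" "z ^ b = 1" "coprime a b" "z \<noteq> 0"
  shows "z = 1"
proof -
  obtain u v where "u * int a + v * int b = gcd (int a) (int b)" using bezout_int by blast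
  also have "\<dots> = 1" using assms(3) by (simp add: coprime_iff_gcd_eq_1)
  finally have "z = z powi (int a * u + int b * v)" by (simp add: mult.commute)
  also have "\<dots> = 1" using assms by (simp add: power_int_add power_int_mult)
  finally show ?thesis .
qed

text \<open>
\<open>d - 1\<close> divides \<open>(1 - d)\<^sup>a\<close>, so \<open>cyc d a\<close> is \<open>\<plusminus>1\<close> modulo \<open>d - 1\<close>.
\<close>

lemma coprime_cyc:
  assumes "a > 0" "d > 0" shows "coprime (cyc d a) (d - 1)"
proof -
  have "coprime (1 - (1 - int d) ^ a) (int d - 1)"
  proof (rule coprimeI)
    fix c assume c: "c dvd 1 - (1 - int d) ^ a" "c dvd int d - 1"
    then have "c dvd 1 - int d" by (metis dvd_minus_iff minus_diff_eq)
    then have "c dvd (1 - int d) ^ a" using assms(1) by (meson dvd_power dvd_trans)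
    then show "is_unit c" using c(1) by (metis dvd_add diff_add_cancel)
  qed
  then have "coprime (int (cyc d a)) (int (d - 1))" using assms by (simp add: cyc_def)
  then show ?thesis by (simp only: coprime_int_iff)
qed

lemma coprime_Lcm_cyc:
  assumes "finite A" "0 \<notin> A" "d > 0" shows "coprime (Lcm (cyc d ` A)) (d - 1)"
proof -
  have "Lcm (cyc d ` A) dvd (\<Prod>a\<in>A. cyc d a)"
    using assms by (intro Lcm_least) (auto intro: dvd_prodI)
  moreover have "coprime (\<Prod>a\<in>A. cyc d a) (d - 1)"
    using assms by (intro prod_coprime_left coprime_cyc) (auto intro: gr0I)
  ultimately show ?thesis using coprime_divisors dvd_refl by blast
qed

text \<open>
The function \<open>l\<close> assigns weights to the variables so that the monomials \<open>x\<^sub>i\<^sup>d\<^sup>-\<^sup>1 x\<^sub>\<phi>\<^sub>(\<^sub>i\<^sub>)\<close> have weight \<open>1\<close>. The condition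
is inherited by powers and by suitable quotients of weights, and the proof applies the lemmas of this locale to several
such functions.
\<close>

locale link_weights = finite_self_map +
  fixes d :: nat and l :: "nat \<Rightarrow> complex"
  assumes d: "d \<ge> 2"
    and nonzero: "\<And>x. x < N \<Longrightarrow> l x \<noteq> 0"
    and link_relation: "\<And>x. x < N \<Longrightarrow> l x ^ (d - 1) * l (\<phi> x) = 1"
begin

lemma value_iterate:
  assumes "x < N" shows "l ((\<phi> ^^ k) x) = l x powi (1 - int d) ^ k"
proof (induction k)
  case (Suc k)
  let ?y = "(\<phi> ^^ k) x"
  have y: "?y < N" using iterate_less assms by blast
  have "l (\<phi> ?y) = inverse (l ?y ^ (d - 1))"
    using link_relation[OF y] by (metis inverse_unique)
  also have "\<dots> = l ?y powi (- int (d - 1))"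
    by (simp add: power_int_minus)
  also have "- int (d - 1) = 1 - int d" using d by simp
  finally show ?case unfolding Suc by (simp add: power_int_mult[symmetric] mult.commute)
qed simp

text \<open>
After one round on its cycle the weight \<open>l x\<close> has become \<open>l x powi (1 - d)\<^sup>a\<close> and is the same again.
\<close>

lemma periodic_value:
  assumes "x \<in> C" shows "l x ^ cyc d (per x) = 1"
proof -
  have x: "x < N" using assms by (rule periodic_less)
  have "l x = l x powi (1 - int d) ^ per x"
    using value_iterate[OF x, of "per x"] period(2)[OF assms] by simp
  then have "l x powi (1 - (1 - int d) ^ per x) = 1"
    using nonzero[OF x] by (simp add: power_int_diff)
  then show ?thesis using nonzero[OF x] by (simp add: power_int_eq_1_iff_power_nat_abs cyc_def)
qed

lemma value_fixed_imp:
  assumes "x < N" "l x powi (1 - int d) ^ k = l x" shows "l x ^ cyc d k = 1"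
proof -
  have "l x powi (1 - (1 - int d) ^ k) = 1"
    using nonzero[OF assms(1)] assms(2) by (simp add: power_int_diff)
  then show ?thesis using nonzero[OF assms(1)] by (simp add: power_int_eq_1_iff_power_nat_abs cyc_def)
qed

lemma power_eq_1_forward:
  assumes "x < N" "l x ^ M = 1" shows "l ((\<phi> ^^ k) x) ^ M = 1"
proof -
  have "l ((\<phi> ^^ k) x) ^ M = (l x ^ M) powi (1 - int d) ^ k"
    unfolding value_iterate[OF assms(1)] by (simp flip: power_int_mult power_int_of_nat add: mult.commute)
  then show ?thesis using assms(2) by simp
qed

lemma power_eq_1_backward:
  assumes "x < N" "l ((\<phi> ^^ k) x) ^ M = 1" shows "l x ^ (M * (d - 1) ^ k) = 1"
proof -
  have "l x powi ((1 - int d) ^ k * int M) = 1"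
    using assms(2) unfolding value_iterate[OF assms(1)] by (simp add: power_int_mult)
  moreover have "nat \<bar>(1 - int d) ^ k * int M\<bar> = M * (d - 1) ^ k"
  proof -
    have "\<bar>1 - int d\<bar> = int (d - 1)" using d by simp
    then have "\<bar>(1 - int d) ^ k * int M\<bar> = int (M * (d - 1) ^ k)"
      by (simp only: abs_mult power_abs abs_of_nat of_nat_mult of_nat_power mult.commute)
    then show ?thesis by (simp only: nat_int)
  qed
  ultimately show ?thesis using nonzero[OF assms(1)] by (simp add: power_int_eq_1_iff_power_nat_abs)
qed

text \<open>
The factors \<open>d - 1\<close> that are picked up along the path do no harm to a weight of order coprime to \<open>d - 1\<close>.
\<close>

lemma power_eq_1_backward_coprime:
  assumes "x < N" "l ((\<phi> ^^ k) x) ^ M = 1" "l x ^ K = 1" "coprime K (d - 1)"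
  shows "l x ^ M = 1"
proof (rule coprime_powers_eq_1)
  show "(l x ^ M) ^ K = 1" using assms(3) by (metis power_commutes power_mult mult.commute power_one)
  show "(l x ^ M) ^ ((d - 1) ^ k) = 1" using power_eq_1_backward[OF assms(1,2)] by (simp add: power_mult)
  show "coprime K ((d - 1) ^ k)" using assms(4) by simp
  show "l x ^ M \<noteq> 0" using nonzero[OF assms(1)] by simp
qed

lemma link_weights_power: "link_weights N \<phi> d (\<lambda>x. l x ^ M)"
proof
  show "(l x ^ M) ^ (d - 1) * l (\<phi> x) ^ M = 1" if "x < N" for x
  proof -
    have "(l x ^ M) ^ (d - 1) * l (\<phi> x) ^ M = (l x ^ (d - 1) * l (\<phi> x)) ^ M"
      by (simp add: power_mult_distrib mult.commute flip: power_mult)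
    then show ?thesis using link_relation[OF that] by simp
  qed
qed (use d nonzero in auto)

end

section \<open>The exponent bound\<close>

text \<open>
\<open>(1 - d)\<^sup>k - 1\<close> is a multiple of \<open>d\<close>. So on a single cycle of length \<open>N\<close> the quotients of weights already have order
dividing \<open>cyc d N div d\<close>, which is where the first number in the list comes from.
\<close>

lemma power_cofactor_cyc:
  assumes "z \<noteq> (0::complex)" "z ^ cyc d N = 1"
  shows "(z powi (1 - int d) ^ k) ^ (cyc d N div d) = z ^ (cyc d N div d)"
proof -
  define q where "q = cyc d N div d"
  have "(1 - (1 - int d)) dvd (1 ^ k - (1 - int d) ^ k)"
    by (simp only: power_diff_sumr2[of 1 k "1 - int d"] dvd_triv_left)
  then have "int d dvd 1 - (1 - int d) ^ k" by simp
  then obtain u where "1 - (1 - int d) ^ k = int d * u" by (elim dvdE)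
  then have u: "(1 - int d) ^ k = 1 + int d * (- u)" by simp
  have dq: "cyc d N = d * q" unfolding q_def by (rule dvd_mult_div_cancel[OF d_dvd_cyc, symmetric])
  have "(z powi (1 - int d) ^ k) ^ q = z powi ((1 + int d * (- u)) * int q)"
    unfolding u by (simp add: power_int_mult)
  also have "(1 + int d * (- u)) * int q = int q + int (cyc d N) * (- u)"
    by (simp add: dq algebra_simps)
  also have "z powi \<dots> = z ^ q * (z ^ cyc d N) powi (- u)"
    using assms(1) by (simp only: power_int_add power_int_mult power_int_of_nat simp_thms)
  finally show ?thesis unfolding assms(2) q_def by simp
qed

text \<open>
The weights of a smooth polynomial. The assumption \<open>pair\<close> is what smoothness on coordinate planes provides.
\<close>

locale smooth_link_weights = link_weights +
  assumes pair: "\<And>i i' j. i < N \<Longrightarrow> i' < N \<Longrightarrow> i \<noteq> i' \<Longrightarrow>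
       \<exists>k<N. k \<noteq> j \<and> (\<exists>\<alpha> \<beta>. \<alpha> + \<beta> = d - 1 \<and> l i ^ \<alpha> * l i' ^ \<beta> * l k = 1)"
    and N: "N > 0"
begin

definition "periods = per ` C"
definition "height = Max (dep ` {..<N})"
abbreviation "L A \<equiv> Lcm (cyc d ` A)"

lemma d0: "d > 0" using d by simp

lemma finite_periods: "finite periods"
  by (simp add: periods_def finite_periodic)

lemma zero_notin_periods: "0 \<notin> periods"
  using period(1) unfolding periods_def by (metis imageE less_irrefl)

lemma periods_nonempty: "periods \<noteq> {}"
  using eventually_periodic[OF N] by (auto simp: periods_def)

lemma depth_le_height: "x < N \<Longrightarrow> dep x \<le> height"
  by (simp add: height_def)

lemma deepest: obtains x where "x < N" "dep x = height"
proof -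
  have "height \<in> dep ` {..<N}" unfolding height_def using N by (intro Max_in) auto
  then show ?thesis using that by auto
qed

lemma periods_height: "\<Sum>periods \<le> card C" "card C + height \<le> N"
proof -
  show "\<Sum>periods \<le> card C" using sum_periods(1) by (simp add: periods_def)
  obtain x where "x < N" "dep x = height" by (rule deepest)
  then show "card C + height \<le> N" using depth_bound(1)[of x] by simp
qed

lemma periodic_power_L: "x \<in> C \<Longrightarrow> per x \<in> A \<Longrightarrow> l x ^ L A = 1"
  using periodic_value by (rule power_eq_1_dvd) (auto intro: dvd_Lcm)

lemma power_L_height:
  assumes "x < N" shows "l x ^ (L periods * (d - 1) ^ height) = 1"
proof -
  have "l x ^ (L periods * (d - 1) ^ dep x) = 1"
    using depth(1)[OF assms] by (intro power_eq_1_backward assms periodic_power_L) (auto simp: periods_def)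
  then show ?thesis
    using depth_le_height[OF assms] by (elim power_eq_1_dvd) (intro mult_dvd_mono dvd_refl le_imp_power_dvd)
qed

text \<open>
The list of divisors, stated for the weights: a constant power of all weights is as good as a trivial one, because scalars are
trivial in the projective group. Cycles without a chain are covered by one case: a singleton \<open>A \<noteq> {N}\<close> is a single cycle of
length below \<open>N\<close>, and larger sets \<open>A\<close> give the least common multiples.
\<close>

definition exponent_bound :: bool where
  "exponent_bound \<longleftrightarrow> (\<exists>c. \<forall>x<N. l x ^ (cyc d N div d) = c) \<or> (\<exists>c. \<forall>x<N. l x ^ (d - 1) ^ (N - 1) = c) \<or>
    (\<exists>A. finite A \<and> A \<noteq> {} \<and> 0 \<notin> A \<and>
       (\<Sum>A \<le> N \<and> A \<noteq> {N} \<and> (\<forall>x<N. l x ^ L A = 1) \<or>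
        (\<exists>b\<ge>2. \<Sum>A + b \<le> N \<and> (\<forall>x<N. l x ^ (L A * (d - 1) ^ (b - 1)) = 1))))"

lemma exponent_boundI_cycles: "finite A \<Longrightarrow> A \<noteq> {} \<Longrightarrow> 0 \<notin> A \<Longrightarrow> \<Sum>A \<le> N \<Longrightarrow> A \<noteq> {N} \<Longrightarrow>
    (\<And>x. x < N \<Longrightarrow> l x ^ L A = 1) \<Longrightarrow> exponent_bound"
  unfolding exponent_bound_def by blast

text \<open>
Here the chain has \<open>h + 1\<close> variables.
\<close>

lemma exponent_boundI_cycles_chain: "finite A \<Longrightarrow> A \<noteq> {} \<Longrightarrow> 0 \<notin> A \<Longrightarrow> h \<ge> 1 \<Longrightarrow> \<Sum>A + h + 1 \<le> N \<Longrightarrow>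
    (\<And>x. x < N \<Longrightarrow> l x ^ (L A * (d - 1) ^ h) = 1) \<Longrightarrow> exponent_bound"
  unfolding exponent_bound_def
  by (intro disjI2 exI[of _ A] conjI) (auto intro!: exI[of _ "Suc h"])

text \<open>
Without tails all indices lie on cycles. The only case in which the bound by the cycle lengths is not yet good enough is a
single cycle through all indices.
\<close>

lemma exponent_bound_height_0:
  assumes h: "height = 0" shows exponent_bound
proof (cases "periods = {N}")
  case False
  then show ?thesis
    using finite_periods periods_nonempty zero_notin_periods power_L_height periods_height h
    by (intro exponent_boundI_cycles[of periods]) auto
next
  case True
  have C: "x \<in> C" if "x < N" for x using depth_le_height[OF that] h depth_0_iff[OF that] by simp
  have per: "per x = N" if "x < N" for x using C[OF that] True by (auto simp: periods_def)
  have "card C = N" using periods_height True h by simp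
  then have sum: "\<Sum>(per ` C) = card C" using True by (simp add: periods_def)
  have "l x ^ (cyc d N div d) = l 0 ^ (cyc d N div d)" if x: "x < N" for x
  proof -
    obtain s where "x = (\<phi> ^^ s) 0"
      using sum_periods(2)[OF sum C[OF N] C[OF x]] per[OF N] per[OF x] by auto
    then have "l x = l 0 powi (1 - int d) ^ s" using value_iterate[OF N] by simp
    then show ?thesis
      using power_cofactor_cyc[OF nonzero[OF N]] periodic_value[OF C[OF N]] per[OF N] by simp
  qed
  then show ?thesis unfolding exponent_bound_def by blast
qed

text \<open>
At least one index is left over, and the longest tail together with it makes room for a chain.
\<close>

lemma exponent_bound_slack:
  assumes "height \<ge> 1" "\<Sum>periods + height + 1 \<le> N" shows exponent_bound
  using finite_periods periods_nonempty zero_notin_periods power_L_height assms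
  by (intro exponent_boundI_cycles_chain[of periods height]) auto

text \<open>
A fixed point contributes \<open>cyc d 1 = d\<close>, which divides every other \<open>cyc d a\<close>. So it can be dropped in favour of the chain
if there are other periods. If there are none, the equality forces a single fixed point \<open>z\<close>, and dividing all weights by
\<open>l z\<close>, which changes nothing in the projective group, leaves only powers of \<open>d - 1\<close>.
\<close>

lemma exponent_bound_fixed_point:
  assumes h: "height \<ge> 1" and eq: "\<Sum>periods + height = N" and one: "1 \<in> periods"
  shows exponent_bound
proof (cases "periods = {1}")
  case False
  define A where "A = periods - {1}"
  have A: "finite A" "A \<noteq> {}" "0 \<notin> A" "\<Sum>periods = 1 + \<Sum>A"
    using False one finite_periods zero_notin_periods sum.remove[OF finite_periods one, of "\<lambda>x. x"]
    by (auto simp: A_def)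
  then obtain a where a: "a \<in> A" by blast
  have "cyc d 1 = d" by (simp add: cyc_def)
  then have "cyc d 1 dvd L A" using d_dvd_cyc[of d a] a by (metis dvd_Lcm dvd_trans imageI)
  then have "L periods = L A"
    using insert_Diff[OF one] by (metis A_def Lcm_insert image_insert lcm_proj2_if_dvd_nat normalize_nat_def id_apply)
  then show ?thesis
    using A h eq power_L_height by (intro exponent_boundI_cycles_chain[of A height]) auto
next
  case True
  have "\<Sum>periods = card C" using periods_height eq by simp
  then have "card C = 1" using True by simp
  then obtain z where z: "C = {z}" by (auto simp: card_1_singleton_iff)
  then have zN: "z < N" using periodic_less by blast
  have "per z = 1" using True z by (auto simp: periods_def)
  then have "\<phi> z = z" using period(2)[of z] z by simp
  then have lz: "l z ^ (d - 1) * l z = 1" using link_relation[OF zN] by simp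
  interpret \<kappa>: link_weights N \<phi> d "\<lambda>x. l x / l z"
  proof
    fix x assume x: "x < N"
    show "l x / l z \<noteq> 0" using nonzero x zN by simp
    show "(l x / l z) ^ (d - 1) * (l (\<phi> x) / l z) = 1"
    proof -
      have "(l x / l z) ^ (d - 1) * (l (\<phi> x) / l z) = l x ^ (d - 1) * l (\<phi> x) / (l z ^ (d - 1) * l z)"
        by (simp only: power_divide times_divide_times_eq)
      then show ?thesis by (simp only: link_relation[OF x] lz) simp
    qed
  qed (rule d)
  have "l x ^ (d - 1) ^ (N - 1) = l z ^ (d - 1) ^ (N - 1)" if x: "x < N" for x
  proof -
    have xz: "(\<phi> ^^ dep x) x = z" using depth(1)[OF x] z by blast
    have "(l x / l z) ^ (1 * (d - 1) ^ dep x) = 1"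
      by (rule \<kappa>.power_eq_1_backward[OF x, where k = "dep x"]) (simp add: xz nonzero[OF zN])
    moreover have "dep x \<le> N - 1" using depth_le_height[OF x] eq True by simp
    ultimately have "(l x / l z) ^ ((d - 1) ^ (N - 1)) = 1"
      unfolding mult_1 by (rule power_eq_1_dvd[OF _ le_imp_power_dvd])
    then show ?thesis using nonzero[OF zN] by (simp add: power_divide)
  qed
  then show ?thesis unfolding exponent_bound_def by blast
qed

text \<open>
After raising weights to the power \<open>(d - 1)\<^sup>h\<close>, with \<open>h\<close> the height, their orders are coprime to \<open>d - 1\<close>, and the
bound for a weight depends only on the cycle that its index runs into. By the equality that cycle is determined by its
length. So if the weight on the cycle of \<open>j\<close> satisfies a better bound than \<open>cyc d (per j)\<close>, the period of \<open>j\<close> can be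
replaced in the set of periods; since the sum decreases, there is room for a chain.
\<close>

lemma exponent_bound_replace_period:
  assumes h: "height \<ge> 1" and eq: "\<Sum>periods + height = N" "\<Sum>periods = card C"
    and j: "j \<in> C" and A: "finite A" "A \<noteq> {}" "0 \<notin> A" "periods - {per j} \<subseteq> A" "\<Sum>A < \<Sum>periods"
    and pow: "(l j ^ (d - 1) ^ height) ^ L A = 1"
  shows exponent_bound
proof (rule exponent_boundI_cycles_chain[of A height])
  interpret \<eta>: link_weights N \<phi> d "\<lambda>x. l x ^ (d - 1) ^ height" by (rule link_weights_power)
  fix x assume x: "x < N"
  let ?y = "(\<phi> ^^ dep x) x"
  have y: "?y \<in> C" by (rule depth(1)[OF x])
  have "(l ?y ^ (d - 1) ^ height) ^ L A = 1"
  proof (cases "per ?y = per j")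
    case True
    then obtain s where "?y = (\<phi> ^^ s) j"
      using sum_periods(2)[OF _ j y] eq(2) by (auto simp: periods_def)
    then show ?thesis using \<eta>.power_eq_1_forward[OF periodic_less[OF j] pow] by simp
  next
    case False
    then have "per ?y \<in> A" using A(4) y by (auto simp: periods_def)
    then have "cyc d (per ?y) dvd L A" by auto
    then show ?thesis using \<eta>.periodic_value[OF y] by (rule power_eq_1_dvd[rotated])
  qed
  moreover have "(l x ^ (d - 1) ^ height) ^ L periods = 1"
    using power_L_height[OF x] by (simp add: mult.commute flip: power_mult)
  ultimately have "(l x ^ (d - 1) ^ height) ^ L A = 1"
    by (rule \<eta>.power_eq_1_backward_coprime[OF x _ _ coprime_Lcm_cyc[OF finite_periods zero_notin_periods d0]])
  then show "l x ^ (L A * (d - 1) ^ height) = 1" by (simp add: mult.commute flip: power_mult)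
qed (use A h eq in auto)

lemma exponent_bound_shorter_cycle:
  assumes "height \<ge> 1" "\<Sum>periods + height = N" "\<Sum>periods = card C" "j \<in> C" "0 < s" "s < per j"
    and fx: "(l j ^ (d - 1) ^ height) powi (1 - int d) ^ s = l j ^ (d - 1) ^ height"
  shows exponent_bound
proof (rule exponent_bound_replace_period[where A = "insert s (periods - {per j})"])
  interpret \<eta>: link_weights N \<phi> d "\<lambda>x. l x ^ (d - 1) ^ height" by (rule link_weights_power)
  have "(l j ^ (d - 1) ^ height) ^ cyc d s = 1"
    by (rule \<eta>.value_fixed_imp[OF periodic_less[OF assms(4)] fx])
  then show "(l j ^ (d - 1) ^ height) ^ L (insert s (periods - {per j})) = 1"
    by (rule power_eq_1_dvd) auto
  have "per j \<in> periods" using assms(4) by (simp add: periods_def)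
  then have "\<Sum>periods = per j + \<Sum>(periods - {per j})"
    using sum.remove[OF finite_periods, of "per j" "\<lambda>x. x"] by simp
  moreover have "\<Sum>(insert s (periods - {per j})) \<le> s + \<Sum>(periods - {per j})"
    using finite_periods by (simp add: sum.insert_if)
  ultimately show "\<Sum>(insert s (periods - {per j})) < \<Sum>periods" using assms(6) by linarith
qed (use assms finite_periods zero_notin_periods in auto)

text \<open>
The relation from the pair \<open>i\<close>, \<open>i'\<close> is read in two ways. Let \<open>\<eta>\<close> be the \<open>(d - 1)\<^sup>h\<close>-th powers of the weights, which see
only orders coprime to \<open>d - 1\<close>. Then \<open>\<eta> i = \<eta> i'\<close>, since both have the same \<open>(d - 1)\<close>-th power, and the relation
becomes \<open>\<eta> k = \<eta> j\<close>. If \<open>k\<close> lies on another cycle, or less than one round away from \<open>j\<close> on its own cycle or on the path,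
this improves the bound for the cycle of \<open>j\<close>. The remaining case is that \<open>k\<close> lies on the path at distance at least
\<open>per j \<ge> 2\<close> from \<open>j\<close>. Then let \<open>\<rho>\<close> be the powers of the weights with exponent \<open>L periods\<close>, which are trivial on the
cycles. The relation expresses \<open>\<rho> k\<close> by \<open>\<rho> i'\<close>, which is killed by \<open>d - 1\<close> since \<open>i'\<close> is adjacent to the cycle. So \<open>d - 1\<close> kills \<open>\<rho> k\<close>, although \<open>k\<close>
lies further out, and the exponent of \<open>d - 1\<close> that is needed along the path drops by at least one.
\<close>

lemma exponent_bound_tight:
  assumes h: "height \<ge> 1" and eq: "\<Sum>periods + height = N" and one: "1 \<notin> periods"
  shows exponent_bound
proof -
  have sum: "\<Sum>periods = card C" and tight: "card C + height = N" using periods_height eq by simp_all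
  obtain x0 where x0: "x0 < N" "dep x0 = height" by (rule deepest)
  define i' where "i' = (\<phi> ^^ (height - 1)) x0"
  define j where "j = \<phi> i'"
  define i where "i = (\<phi> ^^ (per j - 1)) j"
  have j_x0: "j = (\<phi> ^^ height) x0"
  proof -
    have "j = (\<phi> ^^ Suc (height - 1)) x0" by (simp add: j_def i'_def)
    then show ?thesis using h by simp
  qed
  have j: "j \<in> C" using depth(1)[OF x0(1)] x0(2) j_x0 by simp
  have i': "i' < N" "i' \<notin> C" unfolding i'_def using iterate_less[OF x0(1)] depth(2)[OF x0(1)] x0(2) h by auto
  have i: "i \<in> C" unfolding i_def by (rule iterate_periodic[OF j])
  have iN: "i < N" and jN: "j < N" using i j periodic_less by auto
  have \<phi>i: "\<phi> i = j"
  proof -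
    have "\<phi> i = (\<phi> ^^ Suc (per j - 1)) j" by (simp add: i_def)
    also have "Suc (per j - 1) = per j" using period(1)[OF j] by simp
    finally show ?thesis using period(2)[OF j] by simp
  qed
  have "per j \<in> periods" using j by (simp add: periods_def)
  then have per2: "per j \<ge> 2" using one zero_notin_periods
    by (cases "per j = 0 \<or> per j = 1") auto
  obtain k \<alpha> \<beta> where k: "k < N" "k \<noteq> j" and \<alpha>\<beta>: "\<alpha> + \<beta> = d - 1" and rel: "l i ^ \<alpha> * l i' ^ \<beta> * l k = 1"
  proof -
    have "i \<noteq> i'" using i i'(2) by blast
    from pair[OF iN i'(1) this, of j] show ?thesis by (elim exE conjE) (rule that)
  qed

  define E where "E = (d - 1) ^ height"
  interpret \<eta>: link_weights N \<phi> d "\<lambda>x. l x ^ E" by (rule link_weights_power)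
  have cop: "coprime (L periods) (d - 1)" by (rule coprime_Lcm_cyc[OF finite_periods zero_notin_periods d0])
  have \<eta>L: "(l x ^ E) ^ L periods = 1" if "x < N" for x
    using power_L_height[OF that] by (simp add: E_def mult.commute flip: power_mult)
  have "l i ^ E / l i' ^ E = 1"
  proof (rule coprime_powers_eq_1[OF _ _ cop])
    show "(l i ^ E / l i' ^ E) ^ L periods = 1" using \<eta>L iN i' by (simp add: power_divide)
    have "(l i ^ E) ^ (d - 1) * l j ^ E = (l i' ^ E) ^ (d - 1) * l j ^ E"
      using \<eta>.link_relation[OF iN] \<eta>.link_relation[OF i'(1)] \<phi>i by (simp add: j_def)
    then have "(l i ^ E) ^ (d - 1) = (l i' ^ E) ^ (d - 1)"
      by (simp only: mult_right_cancel[OF \<eta>.nonzero[OF jN]])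
    then show "(l i ^ E / l i' ^ E) ^ (d - 1) = 1"
      using \<eta>.nonzero[OF i'(1)] by (simp add: power_divide)
    show "l i ^ E / l i' ^ E \<noteq> 0" using nonzero iN i' by simp
  qed
  then have \<eta>ii': "l i ^ E = l i' ^ E" using \<eta>.nonzero[OF i'(1)] by simp
  have \<eta>k: "l k ^ E = l j ^ E"
  proof -
    have "(l i ^ E) ^ \<alpha> * (l i' ^ E) ^ \<beta> * l k ^ E = (l i ^ \<alpha> * l i' ^ \<beta> * l k) ^ E"
      by (simp only: power_mult_distrib power_commutes[symmetric] mult.commute[of E] power_mult[symmetric])
    then have "(l i ^ E) ^ (d - 1) * l k ^ E = 1"
      unfolding rel \<eta>ii' \<alpha>\<beta>[symmetric] power_add by simp
    then have "(l i ^ E) ^ (d - 1) * l k ^ E = (l i ^ E) ^ (d - 1) * l j ^ E"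
      using \<eta>.link_relation[OF iN] \<phi>i by simp
    then show ?thesis by (simp only: mult_left_cancel[OF power_not_zero[OF \<eta>.nonzero[OF iN]]])
  qed
  show ?thesis
  proof (cases "k \<in> C")
    case kC: True
    show ?thesis
    proof (cases "per k = per j")
      case False
      show ?thesis
      proof (rule exponent_bound_replace_period[OF h eq sum j, of "periods - {per j}"])
        have pk: "per k \<in> periods - {per j}" using kC False by (simp add: periods_def)
        then have dvd: "cyc d (per k) dvd L (periods - {per j})" by (intro dvd_Lcm imageI)
        show "periods - {per j} \<noteq> {}" using pk by blast
        have "(l k ^ E) ^ L (periods - {per j}) = 1"
          by (rule power_eq_1_dvd[OF \<eta>.periodic_value[OF kC] dvd])
        then show "(l j ^ (d - 1) ^ height) ^ L (periods - {per j}) = 1"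
          unfolding \<eta>k unfolding E_def .
        show "\<Sum>(periods - {per j}) < \<Sum>periods"
          using sum.remove[OF finite_periods \<open>per j \<in> periods\<close>, of "\<lambda>x. x"] per2 by simp
      qed (use finite_periods zero_notin_periods in auto)
    next
      case True
      then obtain s where s: "s < per j" "k = (\<phi> ^^ s) j"
        using sum_periods(2)[OF _ j kC] sum by (auto simp: periods_def)
      have "s > 0" using s k(2) by (cases s) auto
      moreover have "(l j ^ E) powi (1 - int d) ^ s = l j ^ E"
        using \<eta>.value_iterate[OF jN, of s] s(2) \<eta>k by simp
      ultimately show ?thesis
        using exponent_bound_shorter_cycle[OF h eq sum j _ s(1)] by (simp add: E_def)
    qed
  next
    case kC: False
    define r where "r = dep k"
    have r0: "r > 0" using depth_0_iff[OF k(1)] kC by (simp add: r_def)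
    have kx0: "k = (\<phi> ^^ (height - r)) x0" and rh: "r \<le> height"
      using depth_bound(2)[OF x0(1) _ k(1) kC] tight x0(2) by (simp_all add: r_def)
    have kj: "(\<phi> ^^ r) k = j"
      using rh by (simp add: kx0 iterate_add j_x0)
    have fx: "(l j ^ E) powi (1 - int d) ^ r = l j ^ E"
      using \<eta>.value_iterate[OF k(1), of r] kj \<eta>k by simp
    show ?thesis
    proof (cases "r < per j")
      case True
      then show ?thesis using exponent_bound_shorter_cycle[OF h eq sum j r0] fx by (simp add: E_def)
    next
      case False
      then have r2: "r \<ge> 2" using per2 by simp
      define K where "K = L periods"
      interpret \<rho>: link_weights N \<phi> d "\<lambda>x. l x ^ K" by (rule link_weights_power)
      have \<rho>C: "l x ^ K = 1" if "x \<in> C" for x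
        unfolding K_def using that by (intro periodic_power_L) (auto simp: periods_def)
      have \<rho>i': "(l i' ^ K) ^ (d - 1) = 1" using \<rho>.link_relation[OF i'(1)] \<rho>C[OF j] by (simp add: j_def)
      have "(l i ^ K) ^ \<alpha> * (l i' ^ K) ^ \<beta> * l k ^ K = (l i ^ \<alpha> * l i' ^ \<beta> * l k) ^ K"
        by (simp add: power_mult_distrib mult.commute flip: power_mult)
      then have "(l i' ^ K) ^ \<beta> * l k ^ K = 1" using rel \<rho>C[OF i] by simp
      then have "((l i' ^ K) ^ \<beta> * l k ^ K) ^ (d - 1) = 1" by simp
      moreover have "((l i' ^ K) ^ \<beta>) ^ (d - 1) = 1"
        using \<rho>i' by (metis mult.commute power_mult power_one)
      ultimately have \<rho>k: "(l k ^ K) ^ (d - 1) = 1" by (simp add: power_mult_distrib)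
      show ?thesis
      proof (rule exponent_boundI_cycles_chain[of periods "height - 1"])
        fix x assume x: "x < N"
        have "(l x ^ K) ^ ((d - 1) ^ (height - 1)) = 1"
        proof (cases "dep x < height")
          case True
          have "(l x ^ K) ^ (1 * (d - 1) ^ dep x) = 1"
            by (rule \<rho>.power_eq_1_backward[OF x]) (simp add: \<rho>C[OF depth(1)[OF x]])
          then show ?thesis unfolding mult_1
            by (rule power_eq_1_dvd[OF _ le_imp_power_dvd]) (use True in simp)
        next
          case False
          then have dx: "dep x = height" using depth_le_height[OF x] by simp
          then have "x \<notin> C" using depth_0_iff[OF x] h by auto
          then have "x = x0" using depth_bound(2)[OF x0(1) _ x] tight x0(2) dx by simp
          then have "(l ((\<phi> ^^ (height - r)) x) ^ K) ^ (d - 1) = 1" using \<rho>k kx0 by simp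
          then have "(l x ^ K) ^ ((d - 1) * (d - 1) ^ (height - r)) = 1"
            by (rule \<rho>.power_eq_1_backward[OF x])
          moreover have "(d - 1) * (d - 1) ^ (height - r) dvd (d - 1) ^ (height - 1)"
            unfolding power_Suc[symmetric] using r2 rh by (intro le_imp_power_dvd) linarith
          ultimately show ?thesis by (rule power_eq_1_dvd)
        qed
        then show "l x ^ (L periods * (d - 1) ^ (height - 1)) = 1" by (simp add: K_def power_mult)
      qed (use finite_periods periods_nonempty zero_notin_periods eq r2 rh in auto)
    qed
  qed
qed

theorem exponent_bound: exponent_bound
proof (cases "height = 0")
  case False
  then have h: "height \<ge> 1" by simp
  show ?thesis
  proof (cases "\<Sum>periods + height = N")
    case True then show ?thesis using exponent_bound_tight[OF h] exponent_bound_fixed_point[OF h] by blast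
  next
    case False
    then show ?thesis using periods_height by (intro exponent_bound_slack[OF h]) linarith
  qed
qed (rule exponent_bound_height_0)

end

section \<open>The list of divisors\<close>

lemma multiplicity_lcm_nat:
  fixes x y p :: nat
  assumes "x \<noteq> 0" "y \<noteq> 0" "prime p"
  shows "multiplicity p (lcm x y) = max (multiplicity p x) (multiplicity p y)"
proof -
  have "multiplicity p (lcm x y) = count (prime_factorization (lcm x y)) p"
    by (rule count_prime_factorization_prime[OF assms(3), symmetric])
  also have "\<dots> = max (count (prime_factorization x) p) (count (prime_factorization y) p)"
    by (simp add: prime_factorization_lcm[OF assms(1,2)])
  finally show ?thesis by (simp add: count_prime_factorization_prime[OF assms(3)])
qed

lemma coprime_prime_powers_nat:
  fixes p q :: nat
  assumes "prime p" "prime q" "p \<noteq> q" shows "coprime (p ^ a) (q ^ b)"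
  using primes_coprime[OF assms] by simp

text \<open>
Prime powers for different primes are coprime.
\<close>

lemma prod_prime_powers_dvd:
  fixes S :: "nat set"
  assumes "finite S" "\<And>p. p \<in> S \<Longrightarrow> prime p" "\<And>p. p \<in> S \<Longrightarrow> p ^ e p dvd z"
  shows "(\<Prod>p\<in>S. p ^ e p) dvd z"
  using assms
proof (induction S)
  case (insert p S)
  have "coprime (p ^ e p) (\<Prod>p\<in>S. p ^ e p)"
  proof (rule prod_coprime_right)
    fix q assume "q \<in> S"
    then show "coprime (p ^ e p) (q ^ e q)"
      using insert.hyps insert.prems by (intro coprime_prime_powers_nat) auto
  qed
  then show ?case using insert by (simp add: divides_mult)
qed simp

text \<open>
For each prime, the power that occurs in \<open>n\<close> divides \<open>x\<close> or \<open>y\<close>; collect the primes accordingly.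
\<close>

lemma dvd_lcm_coprime_split:
  fixes n x y :: nat
  assumes n: "n dvd lcm x y" "n > 0"
  obtains u v where "n = u * v" "u dvd x" "v dvd y" "coprime u v"
proof (cases "x = 0 \<or> y = 0")
  case True
  then show ?thesis using that[of n 1] that[of 1 n] by auto
next
  case False
  then have xy: "x \<noteq> 0" "y \<noteq> 0" by auto
  define e where "e p = multiplicity p n" for p
  define S where "S = {p \<in> prime_factors n. e p \<le> multiplicity p x}"
  define u where "u = (\<Prod>p\<in>S. p ^ e p)"
  define v where "v = (\<Prod>p\<in>prime_factors n - S. p ^ e p)"
  have pr: "prime p" if "p \<in> prime_factors n" for p using that by blast
  have "n = (\<Prod>p\<in>prime_factors n. p ^ e p)"
    unfolding e_def using n(2) by (simp add: prime_factorization_nat)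
  also have "\<dots> = v * u" unfolding u_def v_def by (intro prod.subset_diff) (auto simp: S_def)
  finally have "n = u * v" by (simp add: mult.commute)
  moreover have "u dvd x" unfolding u_def
    by (rule prod_prime_powers_dvd) (auto simp: S_def intro: multiplicity_dvd')
  moreover have "v dvd y" unfolding v_def
  proof (rule prod_prime_powers_dvd)
    fix p assume p: "p \<in> prime_factors n - S"
    have "e p \<le> multiplicity p (lcm x y)"
      unfolding e_def using n(1) xy by (intro dvd_imp_multiplicity_le) auto
    then have "e p \<le> multiplicity p y"
      using p pr multiplicity_lcm_nat[OF xy, of p] by (auto simp: S_def)
    then show "p ^ e p dvd y" by (rule multiplicity_dvd')
  qed (use pr in auto)
  moreover have "coprime u v" unfolding u_def v_def
  proof (intro prod_coprime_left prod_coprime_right)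
    fix p q assume "p \<in> S" "q \<in> prime_factors n - S"
    then show "coprime (p ^ e p) (q ^ e q)"
      using pr by (intro coprime_prime_powers_nat) (auto simp: S_def)
  qed
  ultimately show ?thesis by (rule that)
qed

definition order_divisor :: "nat \<Rightarrow> nat \<Rightarrow> nat \<Rightarrow> bool" where
  "order_divisor d N n \<longleftrightarrow> n dvd cyc d N div d \<or>
          n dvd (d - 1) ^ (N - 1) \<or>
          (\<exists>a. 1 \<le> a \<and> a \<le> N - 1 \<and> n dvd cyc d a) \<or>
          (\<exists>as. length as \<ge> 2 \<and> sorted_wrt (<) as \<and> (\<forall>a\<in>set as. 1 \<le> a) \<and> sum_list as \<le> N \<and>
             n dvd Lcm (cyc d ` set as)) \<or>
          (\<exists>as b. length as \<ge> 1 \<and> sorted_wrt (<) as \<and> (\<forall>a\<in>set as. 1 \<le> a) \<and> b \<ge> 2 \<and>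
             sum_list as + b \<le> N \<and>
             n dvd Lcm (insert ((d - 1) ^ (b - 1)) (cyc d ` set as)))"

lemma sum_list_sorted_list_of_set: "finite A \<Longrightarrow> sum_list (sorted_list_of_set A) = \<Sum>A"
  for A :: "nat set"
  by (metis map_ident sorted_list_of_set.distinct_sorted_key_list_of_set sorted_list_of_set.set_sorted_key_list_of_set sum.distinct_set_conv_list)

lemma (in smooth_link_weights) order_divisor:
  assumes n: "\<And>m c. (\<And>x. x < N \<Longrightarrow> l x ^ m = c) \<Longrightarrow> n dvd m"
  shows "order_divisor d N n"
proof -
  from exponent_bound consider
      c where "\<And>x. x < N \<Longrightarrow> l x ^ (cyc d N div d) = c"
    | c where "\<And>x. x < N \<Longrightarrow> l x ^ (d - 1) ^ (N - 1) = c"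
    | A where "finite A" "A \<noteq> {}" "0 \<notin> A" "\<Sum>A \<le> N" "A \<noteq> {N}" "\<And>x. x < N \<Longrightarrow> l x ^ L A = 1"
    | A b where "finite A" "A \<noteq> {}" "0 \<notin> A" "b \<ge> 2" "\<Sum>A + b \<le> N"
        "\<And>x. x < N \<Longrightarrow> l x ^ (L A * (d - 1) ^ (b - 1)) = 1"
    unfolding exponent_bound_def by metis
  then show ?thesis
  proof cases
    case 1
    then have "n dvd cyc d N div d" by (rule n)
    then show ?thesis unfolding order_divisor_def by blast
  next
    case 2
    then have "n dvd (d - 1) ^ (N - 1)" by (rule n)
    then show ?thesis unfolding order_divisor_def by blast
  next
    case (3 A)
    have dvd: "n dvd L A" using 3(6) by (rule n)
    show ?thesis
    proof (cases "card A = 1")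
      case True
      then obtain a where a: "A = {a}" by (auto simp: card_1_singleton_iff)
      have "1 \<le> a" "a \<le> N - 1" "n dvd cyc d a" using 3 a dvd by auto
      then show ?thesis unfolding order_divisor_def by blast
    next
      case False
      let ?as = "sorted_list_of_set A"
      have "card A \<ge> 2" using False 3(1,2) by (metis One_nat_def card_0_eq less_2_cases not_le)
      then have "length ?as \<ge> 2" "sorted_wrt (<) ?as" "\<forall>a\<in>set ?as. 1 \<le> a" "sum_list ?as \<le> N"
        "n dvd L (set ?as)"
        using 3 dvd by (auto simp: sum_list_sorted_list_of_set Suc_le_eq intro: gr0I)
      then show ?thesis unfolding order_divisor_def by blast
    qed
  next
    case (4 A b)
    let ?as = "sorted_list_of_set A"
    have "n dvd L A * (d - 1) ^ (b - 1)" using 4(6) by (rule n)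
    also have "\<dots> = lcm ((d - 1) ^ (b - 1)) (L A)"
      using coprime_Lcm_cyc[OF 4(1,3) d0] by (simp add: lcm_coprime coprime_commute mult.commute)
    also have "\<dots> = Lcm (insert ((d - 1) ^ (b - 1)) (cyc d ` set ?as))" using 4(1) by simp
    finally have "n dvd \<dots>" .
    moreover have "length ?as \<ge> 1" using 4(1,2) by (simp add: Suc_le_eq card_gt_0_iff)
    moreover have "sorted_wrt (<) ?as" "\<forall>a\<in>set ?as. 1 \<le> a" "sum_list ?as + b \<le> N"
      using 4 by (auto simp: sum_list_sorted_list_of_set Suc_le_eq intro: gr0I)
    ultimately show ?thesis unfolding order_divisor_def using 4(4) by blast
  qed
qed

section \<open>Cycle and chain polynomials\<close>

definition link :: "nat \<Rightarrow> nat \<Rightarrow> nat \<Rightarrow> cpoly" where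
  "link d i j = pvar i ^ (d - 1) * pvar j"

definition link_exp :: "nat \<Rightarrow> nat \<Rightarrow> nat \<Rightarrow> (nat \<Rightarrow>\<^sub>0 nat)" where
  "link_exp d i j = Poly_Mapping.single i (d - 1) + Poly_Mapping.single j 1"

lemma pvar_power: "pvar i ^ e = Poly_Mapping.single (Poly_Mapping.single i e) 1"
proof (induction e)
  case 0
  show ?case by (simp add: single_one)
next
  case (Suc e)
  then show ?case by (simp add: pvar_def mult_single flip: single_add)
qed

lemma link_eq_single: "link d i j = Poly_Mapping.single (link_exp d i j) 1"
  by (simp add: link_def link_exp_def pvar_power) (simp add: pvar_def mult_single)

lemma keys_link_exp: "d \<ge> 2 \<Longrightarrow> Poly_Mapping.keys (link_exp d i j) = {i, j}"
  by (auto simp: link_exp_def in_keys_iff lookup_add lookup_single when_def split: if_splits)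

text \<open>
All coefficients are counting numbers, so nothing cancels.
\<close>

lemma keys_sum_links:
  assumes "finite S"
  shows "Poly_Mapping.keys (\<Sum>i\<in>S. link d (f i) (g i)) = (\<lambda>i. link_exp d (f i) (g i)) ` S"
proof -
  have "Poly_Mapping.lookup (\<Sum>i\<in>S. link d (f i) (g i)) m = of_nat (card {i\<in>S. link_exp d (f i) (g i) = m})" for m
    using assms by (simp add: lookup_sum link_eq_single lookup_single when_def sum.If_cases Int_def)
  then show ?thesis using assms by (auto simp: in_keys_iff card_gt_0_iff)
qed

lemma pvars_sum_links:
  assumes "finite S" "d \<ge> 2" shows "pvars (\<Sum>i\<in>S. link d (f i) (g i)) = f ` S \<union> g ` S"
  using assms by (auto simp: pvars_def keys_sum_links keys_link_exp)

lemma id_hom: "comm_ring_hom (\<lambda>c::complex. c)" by unfold_locales auto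

lemma ev_sum_links:
  assumes "d \<ge> 2"
  shows "ev (\<Sum>i\<in>S. link d (f i) (g i)) x = (\<Sum>i\<in>S. x (f i) ^ (d - 1) * x (g i))"
proof -
  have "monomial_at (link_exp d i j) x = x i ^ (d - 1) * x j" for i j
  proof -
    have "Poly_Mapping.lookup (link_exp d i j) t = (if i = t then d - 1 else 0) + (if j = t then 1 else 0)" for t
      by (simp add: link_exp_def lookup_add lookup_single when_def)
    then show ?thesis
      unfolding monomial_at_def keys_link_exp[OF assms] by (cases "i = j") (simp_all add: mult.commute)
  qed
  then show ?thesis by (simp add: eval_at_sum[OF id_hom] link_eq_single eval_at_single[OF id_hom])
qed

definition cycle_poly :: "nat \<Rightarrow> nat \<Rightarrow> nat \<Rightarrow> cpoly" where
  "cycle_poly d N k = (\<Sum>i<k. link d (N + i) (N + (i + 1) mod k))"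

text \<open>
The minimum makes the last variable its own successor, and its link is then the pure power that ends a polynomial of
type \<open>T\<close>.
\<close>

definition chain_poly :: "nat \<Rightarrow> nat \<Rightarrow> nat \<Rightarrow> cpoly" where
  "chain_poly d N k = (\<Sum>i<k. link d (N + i) (N + min (i + 1) (k - 1)))"

lemma type_K_cycle_poly: "k \<ge> 1 \<Longrightarrow> type_K d k (cycle_poly d N k)"
  unfolding type_K_def
  by (intro conjI exI[of _ "[N..<N + k]"]) (auto simp: cycle_poly_def link_def intro!: sum.cong)

lemma type_T_alt:
  assumes "d \<ge> 1" "k \<ge> 1"
  shows "(\<Sum>i<k - 1. pvar (xs ! i) ^ (d - 1) * pvar (xs ! (i + 1))) + pvar (xs ! (k - 1)) ^ d
    = (\<Sum>i<k. link d (xs ! i) (xs ! min (i + 1) (k - 1)))"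
proof -
  obtain k' where k: "k = Suc k'" using assms(2) by (cases k) auto
  have "pvar (xs ! k') ^ d = link d (xs ! k') (xs ! k')"
    using assms(1) unfolding link_def by (metis One_nat_def Suc_pred' less_eq_Suc_le power_Suc2)
  moreover have "(\<Sum>i<k'. pvar (xs ! i) ^ (d - 1) * pvar (xs ! (i + 1)))
     = (\<Sum>i<k'. link d (xs ! i) (xs ! min (i + 1) k'))"
    by (intro sum.cong refl) (simp add: link_def min_def)
  ultimately show ?thesis by (simp add: k)
qed

lemma type_T_chain_poly:
  assumes "d \<ge> 1" "k \<ge> 1" shows "type_T d k (chain_poly d N k)"
proof -
  have "chain_poly d N k = (\<Sum>i<k. link d ([N..<N + k] ! i) ([N..<N + k] ! min (i + 1) (k - 1)))"
    unfolding chain_poly_def by (intro sum.cong) auto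
  then show ?thesis
    unfolding type_T_def type_T_alt[OF assms, symmetric]
    using assms by (intro conjI exI[of _ "[N..<N + k]"]) auto
qed

lemma shifted_interval: "(\<lambda>i. N + i) ` {..<k} = {N..<N + k}" for N k :: nat
  using image_add_atLeastLessThan[of N 0 k] by (simp add: lessThan_atLeast0 add.commute)

lemma pvars_cycle_poly:
  assumes "d \<ge> 2" shows "pvars (cycle_poly d N k) = {N..<N + k}"
proof -
  have "(\<lambda>i. N + (i + 1) mod k) ` {..<k} \<subseteq> {N..<N + k}" by auto
  then show ?thesis
    unfolding cycle_poly_def pvars_sum_links[OF finite_lessThan assms] shifted_interval by blast
qed

lemma pvars_chain_poly:
  assumes "d \<ge> 2" shows "pvars (chain_poly d N k) = {N..<N + k}"
proof -
  have "(\<lambda>i. N + min (i + 1) (k - 1)) ` {..<k} \<subseteq> {N..<N + k}" by auto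
  then show ?thesis
    unfolding chain_poly_def pvars_sum_links[OF finite_lessThan assms] shifted_interval by blast
qed

text \<open>
A polynomial of type \<open>T\<close> contains a pure power of a variable. A cycle polynomial does so only if it has just one
variable.
\<close>

lemma not_type_T_ge2_cycle_poly:
  assumes d: "d \<ge> 2" shows "\<not> type_T_ge2 d (cycle_poly d N k)"
proof
  assume "type_T_ge2 d (cycle_poly d N k)"
  then obtain k' xs where k': "k' \<ge> 2" and xs: "distinct xs" "length xs = k'"
    and raw: "cycle_poly d N k =
      (\<Sum>i<k' - 1. pvar (xs ! i) ^ (d - 1) * pvar (xs ! (i + 1))) + pvar (xs ! (k' - 1)) ^ d"
    unfolding type_T_ge2_def type_T_def by blast
  have "d \<ge> 1" "k' \<ge> 1" using d k' by auto
  note eq = raw[unfolded type_T_alt[OF this]]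
  define z where "z = xs ! (k' - 1)"
  have "pvars (cycle_poly d N k) \<supseteq> (!) xs ` {..<k'}"
    unfolding eq using d by (simp add: pvars_sum_links)
  then have "card ((!) xs ` {..<k'}) \<le> card {N..<N + k}"
    using d by (intro card_mono) (simp_all add: pvars_cycle_poly)
  moreover have "card ((!) xs ` {..<k'}) = k'"
    using xs by (subst card_image) (auto simp: inj_on_nth)
  ultimately have "k \<ge> 2" using k' by simp
  have "link_exp d z z \<in> Poly_Mapping.keys (cycle_poly d N k)"
    unfolding eq keys_sum_links[OF finite_lessThan] z_def
    using k' by (intro image_eqI[of _ _ "k' - 1"]) auto
  then obtain i where i: "i < k" "link_exp d z z = link_exp d (N + i) (N + (i + 1) mod k)"
    unfolding cycle_poly_def keys_sum_links[OF finite_lessThan] by auto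
  then have "{z, z} = {N + i, N + (i + 1) mod k}" using keys_link_exp[OF d] by metis
  then have "(i + 1) mod k = i" by (auto simp: doubleton_eq_iff)
  then show False using i(1) \<open>k \<ge> 2\<close> by (cases "i + 1 = k") auto
qed

lemma primitive_root_of_unity:
  assumes "m > 0" shows "\<exists>\<zeta>::complex. (\<forall>j. \<zeta> ^ j = 1 \<longleftrightarrow> m dvd j) \<and> \<zeta> \<noteq> 0"
proof (intro exI conjI allI)
  let ?\<zeta> = "cis (2 * pi * real 1 / real m)"
  show "?\<zeta> \<noteq> 0" by simp
  show "?\<zeta> ^ j = 1 \<longleftrightarrow> m dvd j" for j
  proof -
    have m1: "?\<zeta> ^ m = 1" using assms by (simp add: DeMoivre)
    have "?\<zeta> ^ j = (?\<zeta> ^ m) ^ (j div m) * ?\<zeta> ^ (j mod m)"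
      by (metis mult_div_mod_eq power_add power_mult)
    also have "\<dots> = cis (2 * pi * real (j mod m) / real m)"
      unfolding m1 by (simp add: DeMoivre mult_ac)
    finally have eq: "?\<zeta> ^ j = cis (2 * pi * real (j mod m) / real m)" .
    have "cis (2 * pi * real (j mod m) / real m) = cis (2 * pi * real 0 / real m) \<longleftrightarrow> j mod m = 0"
      using bij_betw_roots_unity[OF assms] assms
      by (intro inj_on_eq_iff[where A = "{..<m}"]) (auto simp: bij_betw_def)
    then show ?thesis using eq by (simp add: dvd_eq_mod_eq_0)
  qed
qed

section \<open>Automorphisms of simple polynomials\<close>

text \<open>
The invariant for building a simple polynomial block by block: \<open>l\<close> is a diagonal automorphism of \<open>G\<close> whose order, as a
matrix, is \<open>n\<close>, and at most \<open>t\<close> components of \<open>G\<close> have type \<open>T\<^sub>\<ge>\<^sub>2\<close>.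
\<close>

definition realizes :: "nat \<Rightarrow> nat \<Rightarrow> cpoly \<Rightarrow> cpoly set \<Rightarrow> (nat \<Rightarrow> complex) \<Rightarrow> nat \<Rightarrow> nat \<Rightarrow> bool" where
  "realizes d N G \<C> l n t \<longleftrightarrow>
     simple_with_components N d G \<C> \<and> card {P \<in> \<C>. type_T_ge2 d P} \<le> t \<and>
     pvars G \<subseteq> {..<N} \<and> (\<forall>x. ev G (\<lambda>i. l i * x i) = ev G x) \<and>
     (\<forall>i<N. l i \<noteq> 0) \<and> (\<forall>m. (\<forall>i<N. l i ^ m = 1) \<longleftrightarrow> n dvd m)"

lemma realizes_empty: "realizes d 0 0 {} (\<lambda>_. 1) 1 0"
  by (simp add: realizes_def simple_with_components_def pvars_def eval_at_def)

text \<open>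
The conditions on \<open>\<zeta>\<close> are those under which its successive \<open>(1 - d)\<close>-th powers close up to a cycle, or end with the value \<open>1\<close>
at the last variable of a chain.
\<close>

definition block :: "nat \<Rightarrow> nat \<Rightarrow> nat \<Rightarrow> cpoly \<Rightarrow> complex \<Rightarrow> bool" where
  "block d N k P \<zeta> \<longleftrightarrow> P = cycle_poly d N k \<and> \<zeta> ^ cyc d k = 1 \<or> P = chain_poly d N k \<and> \<zeta> ^ (d - 1) ^ (k - 1) = 1"

definition block_values :: "nat \<Rightarrow> nat \<Rightarrow> complex \<Rightarrow> nat \<Rightarrow> complex" where
  "block_values d N \<zeta> i = \<zeta> powi (1 - int d) ^ (i - N)"

lemma nat_abs_power_neg: "nat \<bar>(1 - int d) ^ k\<bar> = (d - 1) ^ k" if "d \<ge> 1"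
proof -
  have "\<bar>1 - int d\<bar> = int (d - 1)" using that by simp
  then have "\<bar>(1 - int d) ^ k\<bar> = int ((d - 1) ^ k)" by (simp only: power_abs of_nat_power)
  then show ?thesis by (simp only: nat_int)
qed

lemma block:
  assumes d: "d \<ge> 2" and k: "k \<ge> 1" and \<zeta>: "\<zeta> \<noteq> 0" and b: "block d N k P \<zeta>"
  shows "type_K d k P \<or> type_T d k P" "pvars P = {N..<N + k}"
    "ev P (\<lambda>i. block_values d N \<zeta> i * x i) = ev P x"
proof -
  show "type_K d k P \<or> type_T d k P"
    using b type_K_cycle_poly type_T_chain_poly d k unfolding block_def by auto
  show "pvars P = {N..<N + k}"
    using b pvars_cycle_poly pvars_chain_poly d unfolding block_def by auto
  let ?v = "block_values d N \<zeta>"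
  have v0: "?v i \<noteq> 0" for i using \<zeta> by (simp add: block_values_def)
  have step: "?v (N + i) ^ (d - 1) * ?v (N + Suc i) = 1" for i
  proof -
    have "?v (N + Suc i) = ?v (N + i) powi (1 - int d)"
      by (simp only: block_values_def diff_add_inverse power_Suc2 power_int_mult)
    also have "\<dots> = inverse (?v (N + i) ^ (d - 1))"
      using d by (simp add: power_int_def nat_diff_distrib power_inverse)
    finally show ?thesis using v0 by simp
  qed
  have "ev (\<Sum>i<k. link d (N + i) (N + g i)) (\<lambda>i. ?v i * x i) = ev (\<Sum>i<k. link d (N + i) (N + g i)) x"
    if g: "\<And>i. i < k \<Longrightarrow> ?v (N + g i) = ?v (N + Suc i)" for g
    unfolding ev_sum_links[OF d]
  proof (rule sum.cong[OF refl])
    fix i assume i: "i \<in> {..<k}"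
    have "(?v (N + i) * x (N + i)) ^ (d - 1) * (?v (N + g i) * x (N + g i))
        = (?v (N + i) ^ (d - 1) * ?v (N + Suc i)) * (x (N + i) ^ (d - 1) * x (N + g i))"
      using g i by (simp add: power_mult_distrib)
    then show "(?v (N + i) * x (N + i)) ^ (d - 1) * (?v (N + g i) * x (N + g i)) = x (N + i) ^ (d - 1) * x (N + g i)"
      by (simp only: step mult_1)
  qed
  note inv = this
  from b consider "P = cycle_poly d N k" "\<zeta> ^ cyc d k = 1" | "P = chain_poly d N k" "\<zeta> ^ (d - 1) ^ (k - 1) = 1"
    unfolding block_def by blast
  then show "ev P (\<lambda>i. ?v i * x i) = ev P x"
  proof cases
    case 1
    have "\<zeta> powi (1 - (1 - int d) ^ k) = 1"
      using 1(2) \<zeta> by (simp add: power_int_eq_1_iff_power_nat_abs cyc_def)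
    then have "\<zeta> powi (1 - int d) ^ k = \<zeta>" using \<zeta> by (simp add: power_int_diff)
    then have "?v (N + (i + 1) mod k) = ?v (N + Suc i)" if "i < k" for i
      using that by (cases "Suc i = k") (auto simp: block_values_def)
    then show ?thesis unfolding 1(1) cycle_poly_def by (rule inv)
  next
    case 2
    have "\<zeta> powi (1 - int d) ^ (k - 1) = 1"
      using 2(2) \<zeta> d by (simp add: power_int_eq_1_iff_power_nat_abs nat_abs_power_neg)
    then have *: "?v (N + (k - 1)) = 1" by (simp add: block_values_def)
    have "?v (N + Suc (k - 1)) = 1" using step[of "k - 1"] unfolding * by simp
    then have "?v (N + min (i + 1) (k - 1)) = ?v (N + Suc i)" if "i < k" for i
      using that * by (cases "Suc i = k") (auto simp: min_def)
    then show ?thesis unfolding 2(1) chain_poly_def by (rule inv)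
  qed
qed

definition extend_values :: "nat \<Rightarrow> nat \<Rightarrow> (nat \<Rightarrow> complex) \<Rightarrow> complex \<Rightarrow> nat \<Rightarrow> complex" where
  "extend_values d N l \<zeta> i = (if i < N then l i else block_values d N \<zeta> i)"

text \<open>
The variables of the new block are disjoint from the old ones, so the orders of the two diagonal automorphisms combine to
their least common multiple, which is \<open>n m\<close>.
\<close>

lemma realizes_extend:
  assumes d: "d \<ge> 2" and k: "k \<ge> 1" and R: "realizes d N G \<C> l n t"
    and \<zeta>: "\<And>j. \<zeta> ^ j = 1 \<longleftrightarrow> m dvd j" "\<zeta> \<noteq> 0" and b: "block d N k P \<zeta>"
    and cop: "coprime n m"
    and t': "t' = (if P = cycle_poly d N k then t else Suc t)"
  shows "realizes d (N + k) (G + P) (insert P \<C>) (extend_values d N l \<zeta>) (n * m) t'"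
proof -
  note blk = block[OF d k \<zeta>(2) b]
  have simple: "simple_with_components N d G \<C>" and card: "card {P \<in> \<C>. type_T_ge2 d P} \<le> t"
    and pv: "pvars G \<subseteq> {..<N}" and inv: "\<And>x. ev G (\<lambda>i. l i * x i) = ev G x"
    and l0: "\<And>i. i < N \<Longrightarrow> l i \<noteq> 0" and ord: "\<And>m. (\<forall>i<N. l i ^ m = 1) \<longleftrightarrow> n dvd m"
    using R unfolding realizes_def by auto
  let ?l = "extend_values d N l \<zeta>"
  have fin: "finite \<C>" and un: "(\<Union>P\<in>\<C>. pvars P) = {..<N}" and Gs: "G = (\<Sum>P\<in>\<C>. P)"
    using simple by (auto simp: simple_with_components_def)
  have disj: "pvars P \<inter> pvars Q = {}" if "Q \<in> \<C>" for Q
  proof -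
    have "pvars Q \<subseteq> {..<N}" using that un by blast
    then show ?thesis unfolding blk(2) by auto
  qed
  have notin: "P \<notin> \<C>" using disj[of P] blk(2) k by auto
  have simple': "simple_with_components (N + k) d (G + P) (insert P \<C>)"
    unfolding simple_with_components_def
  proof (intro conjI)
    show "\<forall>P\<in>insert P \<C>. \<exists>k. type_K d k P \<or> type_T d k P"
      using simple blk(1) by (auto simp: simple_with_components_def)
    show "\<forall>Q\<in>insert P \<C>. \<forall>Q'\<in>insert P \<C>. Q \<noteq> Q' \<longrightarrow> pvars Q \<inter> pvars Q' = {}"
    proof (intro ballI impI)
      fix Q Q' assume "Q \<in> insert P \<C>" "Q' \<in> insert P \<C>" "Q \<noteq> Q'"
      then consider "Q = P" "Q' \<in> \<C>" | "Q' = P" "Q \<in> \<C>" | "Q \<in> \<C>" "Q' \<in> \<C>" by blast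
      then show "pvars Q \<inter> pvars Q' = {}"
      proof cases
        case 3
        then show ?thesis using simple \<open>Q \<noteq> Q'\<close> by (simp add: simple_with_components_def)
      qed (use disj in auto)
    qed
    show "(\<Union>P\<in>insert P \<C>. pvars P) = {..<N + k}"
      using un blk(2) by (simp add: ivl_disj_un_one(2) Un_commute)
    show "G + P = (\<Sum>P\<in>insert P \<C>. P)"
      using fin notin by (simp add: Gs add.commute)
  qed (use fin in simp)
  have card': "card {Q \<in> insert P \<C>. type_T_ge2 d Q} \<le> t'"
  proof (cases "P = cycle_poly d N k")
    case True
    then have "{Q \<in> insert P \<C>. type_T_ge2 d Q} = {Q \<in> \<C>. type_T_ge2 d Q}"
      using not_type_T_ge2_cycle_poly[OF d] by auto
    then show ?thesis using card t' True by simp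
  next
    case False
    have "card {Q \<in> insert P \<C>. type_T_ge2 d Q} \<le> card (insert P {Q \<in> \<C>. type_T_ge2 d Q})"
      using fin by (intro card_mono) auto
    also have "\<dots> \<le> Suc t" using card by (simp add: card_insert_le_m1 card_insert_if fin)
    finally show ?thesis using t' False by simp
  qed
  have pv': "pvars (G + P) \<subseteq> {..<N + k}"
  proof -
    have "pvars (G + P) \<subseteq> pvars G \<union> pvars P"
      unfolding pvars_def using Poly_Mapping.keys_add[of G P] by blast
    then show ?thesis using pv blk(2) by fastforce
  qed
  have inv': "ev (G + P) (\<lambda>i. ?l i * x i) = ev (G + P) x" for x
  proof -
    have "ev G (\<lambda>i. ?l i * x i) = ev G (\<lambda>i. l i * x i)"
      by (rule eval_at_cong[OF pv]) (simp add: extend_values_def)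
    moreover have "ev P (\<lambda>i. ?l i * x i) = ev P (\<lambda>i. block_values d N \<zeta> i * x i)"
      unfolding eval_at_def monomial_at_def extend_values_def
    proof (intro sum.cong refl arg_cong2[where f = "(*)"] prod.cong)
      fix q i assume "q \<in> Poly_Mapping.keys P" "i \<in> Poly_Mapping.keys q"
      then have "i \<in> {N..<N + k}" unfolding blk(2)[symmetric] pvars_def by blast
      then show "((if i < N then l i else block_values d N \<zeta> i) * x i) ^ Poly_Mapping.lookup q i
          = (block_values d N \<zeta> i * x i) ^ Poly_Mapping.lookup q i" by simp
    qed
    ultimately show ?thesis using inv blk(3) by (simp add: eval_at_add[OF id_hom])
  qed
  have l0': "?l i \<noteq> 0" if "i < N + k" for i
    using l0 \<zeta>(2) by (simp add: extend_values_def block_values_def)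
  have ord': "(\<forall>i<N + k. ?l i ^ j = 1) \<longleftrightarrow> n * m dvd j" for j
  proof -
    have "(\<forall>i<N + k. ?l i ^ j = 1) \<longleftrightarrow> (\<forall>i<N. l i ^ j = 1) \<and> \<zeta> ^ j = 1"
    proof
      assume a: "\<forall>i<N + k. ?l i ^ j = 1"
      then have "l i ^ j = 1" if "i < N" for i using that by (auto simp: extend_values_def dest: HOL.spec[of _ i])
      moreover have "\<zeta> ^ j = 1" using a k by (auto simp: extend_values_def block_values_def dest: HOL.spec[of _ N])
      ultimately show "(\<forall>i<N. l i ^ j = 1) \<and> \<zeta> ^ j = 1" by blast
    next
      assume a: "(\<forall>i<N. l i ^ j = 1) \<and> \<zeta> ^ j = 1"
      have "block_values d N \<zeta> i ^ j = 1" for i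
      proof -
        have "block_values d N \<zeta> i ^ j = (\<zeta> ^ j) powi (1 - int d) ^ (i - N)"
          unfolding block_values_def by (simp flip: power_int_mult power_int_of_nat add: mult.commute)
        then show ?thesis using a by simp
      qed
      then show "\<forall>i<N + k. ?l i ^ j = 1" using a by (simp add: extend_values_def)
    qed
    also have "\<dots> \<longleftrightarrow> n * m dvd j"
      unfolding ord \<zeta>(1) using cop by (meson divides_mult dvd_mult_left dvd_mult_right)
    finally show ?thesis .
  qed
  show ?thesis unfolding realizes_def using simple' card' pv' inv' l0' ord' by blast
qed

lemma realizes_add_cycle:
  assumes d: "d \<ge> 2" and k: "k \<ge> 1" and R: "realizes d N G \<C> l n t"
    and m: "m dvd cyc d k" "m > 0" "coprime n m"
  shows "\<exists>G \<C> l. realizes d (N + k) G \<C> l (n * m) t"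
proof -
  obtain \<zeta> :: complex where \<zeta>: "\<And>j. \<zeta> ^ j = 1 \<longleftrightarrow> m dvd j" "\<zeta> \<noteq> 0"
    using primitive_root_of_unity[OF m(2)] by blast
  have "block d N k (cycle_poly d N k) \<zeta>" using m \<zeta> by (simp add: block_def)
  from realizes_extend[OF d k R \<zeta> this m(3) refl] show ?thesis by auto
qed

text \<open>
Each unused variable becomes a component \<open>x\<^sub>i\<^sup>d\<close> with eigenvalue \<open>1\<close>.
\<close>

lemma realizes_pad:
  assumes d: "d \<ge> 2" and R: "realizes d N G \<C> l n t" and M: "N \<le> M"
  shows "\<exists>G \<C> l. realizes d M G \<C> l n t"
  using M
proof (induction M rule: dec_induct)
  case (step M)
  then obtain G \<C> l where "realizes d M G \<C> l n t" by blast
  from realizes_add_cycle[OF d _ this, of 1 1] show ?case by simp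
qed (use R in blast)

lemma realizes_cycles:
  assumes d: "d \<ge> 2"
  shows "n > 0 \<Longrightarrow> \<forall>a\<in>set as. 1 \<le> a \<Longrightarrow> n dvd Lcm (cyc d ` set as) \<Longrightarrow>
    \<exists>G \<C> l. realizes d (sum_list as) G \<C> l n 0"
proof (induction as arbitrary: n)
  case Nil
  then show ?case using realizes_empty by auto
next
  case (Cons a as)
  from Cons.prems(3) have "n dvd lcm (cyc d a) (Lcm (cyc d ` set as))" by simp
  then obtain u v where uv: "n = u * v" "u dvd cyc d a" "v dvd Lcm (cyc d ` set as)" "coprime u v"
    using Cons.prems(1) by (rule dvd_lcm_coprime_split)
  then obtain G \<C> l where "realizes d (sum_list as) G \<C> l v 0" using Cons by fastforce
  from realizes_add_cycle[OF d _ this, of a u] uv Cons.prems show ?case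
    by (simp add: coprime_commute mult.commute add.commute)
qed

lemma diag_mult_vec_eq_0:
  assumes "v \<in> carrier_vec N" "\<And>i. i < N \<Longrightarrow> l i \<noteq> 0" "diag N l *\<^sub>v v = 0\<^sub>v N"
  shows "v = 0\<^sub>v N"
proof (rule eq_vecI)
  fix i assume "i < dim_vec (0\<^sub>v N :: complex vec)"
  then have i: "i < N" by simp
  then have "l i * v $ i = 0" using diag_mult_vec[OF assms(1) i, of l] assms(3) by simp
  then show "v $ i = 0\<^sub>v N $ i" using assms(2) i by simp
qed (use assms in auto)

lemma diag_preserves_hypersurface:
  assumes pv: "pvars G \<subseteq> {..<N}" and inv: "\<And>x. ev G (\<lambda>i. l i * x i) = ev G x"
    and l0: "\<And>i. i < N \<Longrightarrow> l i \<noteq> 0"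
  shows "linear_automorphism N G (proj_class (diag N l))"
proof -
  have scale: "peval G (diag N l *\<^sub>v v) = peval G v" if "v \<in> carrier_vec N" for v
  proof -
    have "peval G (diag N l *\<^sub>v v) = ev G (\<lambda>i. l i * v $ i)"
      unfolding peval_eq_ev using that by (intro eval_at_cong[OF pv]) (simp add: diag_mult_vec del: index_mult_mat_vec)
    then show ?thesis by (simp add: inv peval_eq_ev)
  qed
  let ?k = "\<lambda>i. inverse (l i)"
  have car: "diag N f *\<^sub>v v \<in> carrier_vec N" if "v \<in> carrier_vec N" for f v
    by (rule mult_mat_vec_carrier[OF diag_carrier(1) that])
  have bwd: "diag N l *\<^sub>v (diag N ?k *\<^sub>v v) = v" if v: "v \<in> carrier_vec N" for v
  proof (rule eq_vecI)
    fix i assume "i < dim_vec v"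
    then have i: "i < N" using v by simp
    show "(diag N l *\<^sub>v (diag N ?k *\<^sub>v v)) $ i = v $ i"
      unfolding diag_mult_vec[OF car[OF v] i] diag_mult_vec[OF v i] using l0[OF i] by simp
  qed (use v in simp)
  have "proj_action (proj_class (diag N l)) ` hypersurface N G = hypersurface N G"
  proof (intro equalityI subsetI)
    fix p assume "p \<in> proj_action (proj_class (diag N l)) ` hypersurface N G"
    then obtain v where v: "v \<in> carrier_vec N" "v \<noteq> 0\<^sub>v N" "peval G v = 0"
      and p: "p = proj_point (diag N l *\<^sub>v v)"
      unfolding hypersurface_def using proj_action_point[OF diag_carrier(1)] by blast
    have "diag N l *\<^sub>v v \<noteq> 0\<^sub>v N" "diag N l *\<^sub>v v \<in> carrier_vec N"
      using diag_mult_vec_eq_0[OF v(1), of l] v(2) l0 car[OF v(1)] by auto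
    moreover have "peval G (diag N l *\<^sub>v v) = 0" using scale[OF v(1)] v(3) by simp
    ultimately show "p \<in> hypersurface N G" unfolding hypersurface_def p by blast
  next
    fix p assume "p \<in> hypersurface N G"
    then obtain v where v: "v \<in> carrier_vec N" "v \<noteq> 0\<^sub>v N" "peval G v = 0" "p = proj_point v"
      unfolding hypersurface_def by blast
    let ?w = "diag N ?k *\<^sub>v v"
    have w: "?w \<in> carrier_vec N" by (rule car[OF v(1)])
    have "?w \<noteq> 0\<^sub>v N" using diag_mult_vec_eq_0[OF v(1), of ?k] v(2) l0 by auto
    moreover have "peval G ?w = 0" using scale[OF w] unfolding bwd[OF v(1)] v(3) by simp
    ultimately have "proj_point ?w \<in> hypersurface N G" using w unfolding hypersurface_def by blast
    moreover have "p = proj_action (proj_class (diag N l)) (proj_point ?w)"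
      unfolding proj_action_point[OF diag_carrier(1) w] bwd[OF v(1)] by (rule v(4))
    ultimately show "p \<in> proj_action (proj_class (diag N l)) ` hypersurface N G" by blast
  qed
  moreover have "proj_class (diag N l) \<in> carrier (PGL N)"
    using diag_in_GL[OF l0] by (auto simp: carrier_PGL)
  ultimately show ?thesis by (simp add: linear_automorphism_def)
qed

definition simple_order :: "nat \<Rightarrow> nat \<Rightarrow> nat \<Rightarrow> bool" where
  "simple_order d N n \<longleftrightarrow> (\<exists>G \<C>. simple_with_components N d G \<C> \<and> card {P \<in> \<C>. type_T_ge2 d P} \<le> 1 \<and>
           order_of_linear_automorphism N G n)"

lemma simple_orderI:
  assumes R: "realizes d N G \<C> l n t" and t: "t \<le> 1" and N: "N > 0" and n: "n' > 0"
    and ord: "\<And>m. (\<exists>c. \<forall>i<N. l i ^ m = c) \<longleftrightarrow> n' dvd m"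
  shows "simple_order d N n'"
proof -
  have r: "simple_with_components N d G \<C>" "card {P \<in> \<C>. type_T_ge2 d P} \<le> 1"
    "pvars G \<subseteq> {..<N}" "\<And>x. ev G (\<lambda>i. l i * x i) = ev G x" "\<And>i. i < N \<Longrightarrow> l i \<noteq> 0"
    using R t unfolding realizes_def by auto
  have iff: "group.ord (PGL N) (proj_class (diag N l)) dvd m \<longleftrightarrow> n' dvd m" for m
    using ord_diag_dvd_iff[of N l m] r(5) N ord by simp
  have "group.ord (PGL N) (proj_class (diag N l)) = n'"
  proof (rule dvd_antisym)
    show "group.ord (PGL N) (proj_class (diag N l)) dvd n'"
      unfolding iff by simp
    show "n' dvd group.ord (PGL N) (proj_class (diag N l))"
      unfolding iff[symmetric] by simp
  qed
  with diag_preserves_hypersurface[OF r(3,4,5)] n have "order_of_linear_automorphism N G n'"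
    unfolding order_of_linear_automorphism_def by blast
  with r(1,2) show ?thesis unfolding simple_order_def by blast
qed

text \<open>
If the power of the automorphism with exponent \<open>j\<close> is a scalar \<open>c\<close>, then \<open>c\<close> is a power of an eigenvalue in each of the two
parts, so \<open>c\<^sup>n = 1\<close> and \<open>c\<^sup>m = 1\<close>, whence \<open>c = 1\<close>. So the order in the projective group is the order of the matrix.
\<close>

lemma simple_order_two_blocks:
  assumes d: "d \<ge> 2" and k: "k \<ge> 1" and N: "N > 0" and n: "n > 0" and R: "realizes d N G \<C> l n t"
    and m: "m > 0" "coprime n m"
    and P: "P = cycle_poly d N k \<and> m dvd cyc d k \<and> t \<le> 1 \<or> P = chain_poly d N k \<and> m dvd (d - 1) ^ (k - 1) \<and> t = 0"
  shows "simple_order d (N + k) (n * m)"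
proof -
  obtain \<zeta> :: complex where \<zeta>: "\<And>j. \<zeta> ^ j = 1 \<longleftrightarrow> m dvd j" "\<zeta> \<noteq> 0"
    using primitive_root_of_unity[OF m(1)] by blast
  have "block d N k P \<zeta>" using P \<zeta> by (auto simp: block_def)
  from realizes_extend[OF d k R \<zeta> this m(2) refl]
  have R': "realizes d (N + k) (G + P) (insert P \<C>) (extend_values d N l \<zeta>) (n * m)
     (if P = cycle_poly d N k then t else Suc t)" .
  show ?thesis
  proof (rule simple_orderI[OF R'])
    show "(if P = cycle_poly d N k then t else Suc t) \<le> 1" using P by auto
    show "N + k > 0" "n * m > 0" using N n m by auto
    fix j
    have R1: "(\<forall>i<N. l i ^ j = 1) \<longleftrightarrow> n dvd j" for j using R by (simp add: realizes_def)
    have R2: "(\<forall>i<N + k. extend_values d N l \<zeta> i ^ j = 1) \<longleftrightarrow> n * m dvd j"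
      using R' by (simp add: realizes_def)
    show "(\<exists>c. \<forall>i<N + k. extend_values d N l \<zeta> i ^ j = c) \<longleftrightarrow> n * m dvd j"
    proof
      assume "\<exists>c. \<forall>i<N + k. extend_values d N l \<zeta> i ^ j = c"
      then obtain c where c: "\<And>i. i < N + k \<Longrightarrow> extend_values d N l \<zeta> i ^ j = c" by blast
      have c0: "c = l 0 ^ j" using c[of 0] N by (simp add: extend_values_def)
      have cN: "c = \<zeta> ^ j" using c[of N] k by (simp add: extend_values_def block_values_def)
      have "l 0 \<noteq> 0" using R N by (simp add: realizes_def)
      have "c = 1"
      proof (rule coprime_powers_eq_1[OF _ _ m(2)])
        have "l 0 ^ n = 1" using R1[of n] N by simp
        then show "c ^ n = 1" unfolding c0 by (metis mult.commute power_mult power_one)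
        have "\<zeta> ^ m = 1" using \<zeta>(1) by simp
        then show "c ^ m = 1" unfolding cN by (metis mult.commute power_mult power_one)
        show "c \<noteq> 0" using c0 \<open>l 0 \<noteq> 0\<close> by simp
      qed
      then show "n * m dvd j" using R2 c by blast
    qed (use R2 in blast)
  qed
qed

text \<open>
In all cases but the first two the polynomial has at least two blocks. A single chain has the eigenvalue \<open>1\<close> at its last
variable, so a scalar power is the identity. For a single cycle of length \<open>N\<close> a root of unity of order \<open>d n\<close> is used: the
first two eigenvalues \<open>\<zeta>\<close> and \<open>\<zeta> powi (1 - d)\<close> have equal \<open>j\<close>-th powers exactly if \<open>\<zeta> ^ (d j) = 1\<close>.
\<close>

lemma simple_order_if_order_divisor:
  assumes d: "d \<ge> 2" and N: "N > 0" and n: "n > 0" and "order_divisor d N n"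
  shows "simple_order d N n"
proof -
  from assms(4) consider
      (K) "n dvd cyc d N div d"
    | (T) "n dvd (d - 1) ^ (N - 1)"
    | (K1) a where "1 \<le> a" "a \<le> N - 1" "n dvd cyc d a"
    | (Ks) as where "length as \<ge> 2" "\<forall>a\<in>set as. 1 \<le> a" "sum_list as \<le> N" "n dvd Lcm (cyc d ` set as)"
    | (KT) as b where "length as \<ge> 1" "\<forall>a\<in>set as. 1 \<le> a" "b \<ge> 2" "sum_list as + b \<le> N"
        "n dvd Lcm (insert ((d - 1) ^ (b - 1)) (cyc d ` set as))"
    unfolding order_divisor_def by blast
  then show ?thesis
  proof cases
    case K
    have "d * n dvd cyc d N" using K d d_dvd_cyc[of d N] by (metis dvd_mult_div_cancel mult_dvd_mono dvd_refl)
    obtain \<zeta> :: complex where \<zeta>: "\<And>j. \<zeta> ^ j = 1 \<longleftrightarrow> d * n dvd j" "\<zeta> \<noteq> 0"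
      using primitive_root_of_unity[of "d * n"] d n by (metis mult_pos_pos not_numeral_le_zero gr0I)
    have b: "block d 0 N (cycle_poly d 0 N) \<zeta>" using \<zeta> \<open>d * n dvd cyc d N\<close> by (simp add: block_def)
    have R: "realizes d (0 + N) (0 + cycle_poly d 0 N) {cycle_poly d 0 N} (extend_values d 0 (\<lambda>_. 1) \<zeta>) (1 * (d * n)) 0"
      by (rule realizes_extend[OF d _ realizes_empty \<zeta> b]) (use N in auto)
    have val: "extend_values d 0 (\<lambda>_. 1) \<zeta> i = \<zeta> powi (1 - int d) ^ i" for i
      by (simp add: extend_values_def block_values_def)
    show ?thesis
    proof (rule simple_orderI[OF R[unfolded add_0] _ N n])
      fix j
      show "(\<exists>c. \<forall>i<N. extend_values d 0 (\<lambda>_. 1) \<zeta> i ^ j = c) \<longleftrightarrow> n dvd j"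
      proof
        assume "\<exists>c. \<forall>i<N. extend_values d 0 (\<lambda>_. 1) \<zeta> i ^ j = c"
        then obtain c where c: "\<And>i. i < N \<Longrightarrow> (\<zeta> powi (1 - int d) ^ i) ^ j = c"
          unfolding val by blast
        \<comment> \<open>the values close up after \<open>N\<close> steps, so for \<open>N = 1\<close> the second value is the first one\<close>
        have closed: "\<zeta> powi (1 - int d) ^ N = \<zeta>"
        proof -
          have "\<zeta> ^ cyc d N = 1" using \<zeta>(1) \<open>d * n dvd cyc d N\<close> by simp
          then have "\<zeta> powi (1 - (1 - int d) ^ N) = 1"
            using \<zeta>(2) by (simp add: power_int_eq_1_iff_power_nat_abs cyc_def)
          then show ?thesis using \<zeta>(2) by (simp add: power_int_diff)
        qed
        have c0: "\<zeta> ^ j = c" using c[OF N] by simp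
        have c1: "(\<zeta> powi (1 - int d)) ^ j = c"
        proof (cases "N = 1")
          case True then show ?thesis using closed c0 by simp
        next
          case False then show ?thesis using c[of 1] N by simp
        qed
        have "\<zeta> powi (1 - int d) = \<zeta> * inverse (\<zeta> ^ d)"
          using \<zeta>(2) by (simp add: power_int_diff field_simps)
        then have "\<zeta> ^ j * inverse ((\<zeta> ^ d) ^ j) = \<zeta> ^ j"
          using c0 c1 by (simp add: power_mult_distrib power_inverse)
        then have "(\<zeta> ^ d) ^ j = 1" using \<zeta>(2) by simp
        then have "\<zeta> ^ (d * j) = 1" by (simp only: power_mult)
        then show "n dvd j" using \<zeta>(1) d by simp
      next
        assume "n dvd j"
        then have "\<zeta> ^ (d * j) = 1" using \<zeta>(1) by simp
        then have *: "(\<zeta> ^ j) ^ d = 1" by (simp add: mult.commute flip: power_mult)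
        have "(\<zeta> powi (1 - int d) ^ i) ^ j = \<zeta> ^ j" for i
        proof (induction i)
          case (Suc i)
          have "(\<zeta> powi (1 - int d) ^ Suc i) ^ j = ((\<zeta> powi (1 - int d) ^ i) ^ j) powi (1 - int d)"
            by (simp only: power_Suc2 power_int_mult) (simp flip: power_int_mult power_int_of_nat add: mult_ac)
          also have "\<dots> = \<zeta> ^ j" unfolding Suc using * \<zeta>(2) by (simp add: power_int_diff)
          finally show ?case .
        qed simp
        then show "\<exists>c. \<forall>i<N. extend_values d 0 (\<lambda>_. 1) \<zeta> i ^ j = c" unfolding val by blast
      qed
    qed simp
  next
    case T
    obtain \<zeta> :: complex where \<zeta>: "\<And>j. \<zeta> ^ j = 1 \<longleftrightarrow> n dvd j" "\<zeta> \<noteq> 0"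
      using primitive_root_of_unity[OF n] by blast
    have b: "block d 0 N (chain_poly d 0 N) \<zeta>" using \<zeta> T by (simp add: block_def)
    let ?l = "extend_values d 0 (\<lambda>_. 1) \<zeta>"
    have R: "realizes d (0 + N) (0 + chain_poly d 0 N) {chain_poly d 0 N} ?l (1 * n)
      (if chain_poly d 0 N = cycle_poly d 0 N then 0 else Suc 0)"
      by (rule realizes_extend[OF d _ realizes_empty \<zeta> b]) (use N in auto)
    have "\<zeta> powi (1 - int d) ^ (N - 1) = 1"
      using T \<zeta> d by (simp add: power_int_eq_1_iff_power_nat_abs nat_abs_power_neg)
    then have last: "?l (N - 1) = 1" by (simp add: extend_values_def block_values_def)
    have ord: "(\<forall>i<N. ?l i ^ j = 1) \<longleftrightarrow> n dvd j" for j using R by (simp add: realizes_def)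
    show ?thesis
    proof (rule simple_orderI[OF R[unfolded add_0] _ N n])
      fix j
      have "(\<exists>c. \<forall>i<N. ?l i ^ j = c) \<longleftrightarrow> (\<forall>i<N. ?l i ^ j = 1)"
        using last N by (metis diff_less less_one power_one)
      then show "(\<exists>c. \<forall>i<N. ?l i ^ j = c) \<longleftrightarrow> n dvd j" using ord by simp
    qed simp
  next
    case (K1 a)
    obtain G \<C> l where R: "realizes d (N - a) G \<C> l 1 0"
      using realizes_pad[OF d realizes_empty] by blast
    have "simple_order d (N - a + a) (1 * n)"
      by (rule simple_order_two_blocks[OF d _ _ _ R, of a n "cycle_poly d (N - a) a"]) (use K1 n in auto)
    then show ?thesis using K1 N by simp
  next
    case (Ks as)
    then obtain a as' where as: "as = a # as'" "as' \<noteq> []" by (cases as) fastforce+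
    from Ks(4) have "n dvd lcm (cyc d a) (Lcm (cyc d ` set as'))" by (simp add: as)
    then obtain u v where uv: "n = u * v" "u dvd cyc d a" "v dvd Lcm (cyc d ` set as')" "coprime u v"
      using n by (rule dvd_lcm_coprime_split)
    then have pos: "u > 0" "v > 0" using n by auto
    obtain G \<C> l where R0: "realizes d (sum_list as') G \<C> l v 0"
      using realizes_cycles[OF d pos(2) _ uv(3)] Ks(2) as by auto
    have le: "sum_list as' \<le> N - a" "a \<le> N" using Ks(3) by (simp_all add: as)
    obtain G \<C> l where R: "realizes d (N - a) G \<C> l v 0"
      using realizes_pad[OF d R0 le(1)] by blast
    have "sum_list as' > 0" using as Ks(2) by (cases as') auto
    then have "simple_order d (N - a + a) (v * u)"
      using le uv pos Ks(2) as
      by (intro simple_order_two_blocks[OF d _ _ _ R, of a u "cycle_poly d (N - a) a"]) (auto simp: coprime_commute)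
    then show ?thesis using le uv(1) by (simp add: mult.commute)
  next
    case (KT as b)
    from KT(5) have "n dvd lcm ((d - 1) ^ (b - 1)) (Lcm (cyc d ` set as))" by simp
    then obtain u v where uv: "n = u * v" "u dvd (d - 1) ^ (b - 1)" "v dvd Lcm (cyc d ` set as)" "coprime u v"
      using n by (rule dvd_lcm_coprime_split)
    then have pos: "u > 0" "v > 0" using n by auto
    obtain G \<C> l where R0: "realizes d (sum_list as) G \<C> l v 0"
      using realizes_cycles[OF d pos(2) KT(2) uv(3)] by blast
    have le: "sum_list as \<le> N - b" "b \<le> N" using KT(4) by auto
    obtain G \<C> l where R: "realizes d (N - b) G \<C> l v 0"
      using realizes_pad[OF d R0 le(1)] by blast
    have "sum_list as > 0" using KT(1,2) by (cases as) auto
    then have "simple_order d (N - b + b) (v * u)"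
      using le uv pos KT(3)
      by (intro simple_order_two_blocks[OF d _ _ _ R, of b u "chain_poly d (N - b) b"]) (auto simp: coprime_commute)
    then show ?thesis using le uv(1) by (simp add: mult.commute)
  qed
qed

section \<open>Orders of automorphisms of smooth hypersurfaces\<close>

lemma order_divisor_if_smooth:
  assumes d: "d \<ge> 3" and N: "N > 0" and hom: "homogeneous N d F" and sm: "smooth N F"
    and ord: "order_of_linear_automorphism N F n"
  shows "order_divisor d N n"
proof -
  have d2: "d \<ge> 2" using d by simp
  obtain l where l0: "\<And>i. i < N \<Longrightarrow> l i \<noteq> (0::complex)"
    and rel: "\<And>i. i < N \<Longrightarrow> \<exists>j<N. l i ^ (d - 1) * l j = 1"
    and pair: "\<And>i i' j. i < N \<Longrightarrow> i' < N \<Longrightarrow> i \<noteq> i' \<Longrightarrow>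
       \<exists>k<N. k \<noteq> j \<and> (\<exists>\<alpha> \<beta>. \<alpha> + \<beta> = d - 1 \<and> l i ^ \<alpha> * l i' ^ \<beta> * l k = 1)"
    and n: "\<And>m c. (\<And>i. i < N \<Longrightarrow> l i ^ m = c) \<Longrightarrow> n dvd m"
    using eigenvalues_of_linear_automorphism[OF d2 N hom sm ord] by blast
  obtain \<phi> where \<phi>: "\<And>i. i < N \<Longrightarrow> \<phi> i < N \<and> l i ^ (d - 1) * l (\<phi> i) = 1"
    using rel by metis
  interpret smooth_link_weights N \<phi> d l
    by unfold_locales (use d2 N l0 \<phi> pair in auto)
  show ?thesis using n by (rule order_divisor)
qed

theorem theorem4p8:
  fixes d N n :: nat and F :: cpoly
  assumes "d \<ge> 3" and "N \<ge> 3"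
    and "homogeneous N d F" and "smooth N F"
    and "order_of_linear_automorphism N F n"
  shows "(\<exists>G \<C>. simple_with_components N d G \<C> \<and> card {P \<in> \<C>. type_T_ge2 d P} \<le> 1 \<and>
           order_of_linear_automorphism N G n) \<and>
         (n dvd cyc d N div d \<or>
          n dvd (d - 1) ^ (N - 1) \<or>
          (\<exists>a. 1 \<le> a \<and> a \<le> N - 1 \<and> n dvd cyc d a) \<or>
          (\<exists>as. length as \<ge> 2 \<and> sorted_wrt (<) as \<and> (\<forall>a\<in>set as. 1 \<le> a) \<and> sum_list as \<le> N \<and>
             n dvd Lcm (cyc d ` set as)) \<or>
          (\<exists>as b. length as \<ge> 1 \<and> sorted_wrt (<) as \<and> (\<forall>a\<in>set as. 1 \<le> a) \<and> b \<ge> 2 \<and>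
             sum_list as + b \<le> N \<and>
             n dvd Lcm (insert ((d - 1) ^ (b - 1)) (cyc d ` set as))))"
proof -
  have "N > 0" "d \<ge> 2" using assms(1,2) by simp_all
  have "n > 0" using assms(5) by (simp add: order_of_linear_automorphism_def)
  have dvd: "order_divisor d N n"
    by (rule order_divisor_if_smooth[OF assms(1) \<open>N > 0\<close> assms(3,4,5)])
  moreover have "simple_order d N n"
    by (rule simple_order_if_order_divisor[OF \<open>d \<ge> 2\<close> \<open>N > 0\<close> \<open>n > 0\<close> dvd])
  ultimately show ?thesis unfolding order_divisor_def simple_order_def by (rule conjI[rotated])
qed

end
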